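(* Let $X$ be the solution of the one-dimensional It\^o SDE $$dX_t=a(X_t,t)\,dt+b(X_t,t)\,dW_t,\qquad X_0=x_0\in\mathbb{R},$$ where the coefficients $a$ and $b$ are smooth and the diffusion coefficient $b$ never vanishes. Assume that sufficient conditions hold for the Lamperti transformed SDE $dY_t=\bar a(Y_t,t)\,dt+dW_t$, $Y_0=0$ (see context), and for the associated Fokker--Planck equation $$\frac12\frac{\partial^2p}{\partial y^2}-\frac{\partial(\bar a(y,t)p)}{\partial y}-\frac{\partial p}{\partial t}=0$$ to have a unique regular solution. Write $a_0=a(x_0,0)$, $b_0=b(x_0,0)$, $b_0'=\frac{\partial b}{\partial x}(x_0,0)$, and let $\Phi$ be the standard normal cumulative distribution function. Then for sufficiently small $t$ the $\alpha$-th percentile of $X_t$ is given by $$x_0+b_0\sqrt t\,\Phi^{-1}(\alpha)+\Big(a_0-\tfrac12b_0b_0'\big(1-\Phi^{-1}(\alpha)^2\big)\Big)t+O(t^{3/2}).$$ In particular, the median process is a straight line up to $O(t^{3/2})$ with tangent given by the drift (at $(x_0,0)$) of the Stratonovich version of the It\^o SDE. The $\Phi(1)$ and $\Phi(-1)$ percentiles correspond up to $O(t^{3/2})$ to the curves $\gamma_{x_0}(\pm\sqrt t)$, where $\gamma_{x_0}$ is any representative of the 2-jet that defines the SDE in It\^o form.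
   Context: $W$ is a one-dimensional Brownian motion. The $\alpha$-th percentile ($\alpha\in(0,1)$) of a real random variable is its $\alpha$-quantile, and the median is the case $\alpha=1/2$. Lamperti transformation: let $\phi(t,x)$ be a primitive of $1/b(x,t)$ with respect to $x$, and put $Z_t=\phi(t,X_t)$. Then $Z$ satisfies an SDE with unit diffusion coefficient, $dZ_t=\mu(Z_t,t)\,dt+dW_t$, $Z_0=z_0=\phi(0,x_0)$. Let $z^0(t)$ solve $\frac{dz^0}{dt}=\mu(z^0(t),t)$, $z^0(0)=z_0$, and put $Y_t=Z_t-z^0(t)$. Then $Y$ satisfies the Lamperti transformed SDE $dY_t=\bar a(Y_t,t)\,dt+dW_t$, $Y_0=0$, with $\bar a(y,t)=\mu(y+z^0(t),t)-\mu(z^0(t),t)$, so that $\bar a(0,t)=0$ for all $t$. The Stratonovich version of $dX_t=a\,dt+b\,dW_t$ is $dX_t=(a-\tfrac12 b\,\partial_xb)\,dt+b\circ dW_t$. A representative of the 2-jet defining the It\^o SDE at $x_0$ (at time $0$) is any smooth curve $\gamma_{x_0}:\mathbb{R}\to\mathbb{R}$ with $\gamma_{x_0}(0)=x_0$, $\gamma_{x_0}'(0)=b_0$ and $\tfrac12\gamma_{x_0}''(0)=a_0$.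
   Formalization: The percentile formula is proved with |b_0| in place of b_0, and the curves are γ(±sgn(b_0)√t), since for negative b (e.g. a=0, b=-1, x_0=0) the printed formula has the wrong sign; for b_0>0 it is the statement as printed. *)

theory Defs
  imports "HOL-Probability.Probability" "HOL-Library.Landau_Symbols"
begin

section \<open>Smooth functions\<close>

text \<open>
  \<open>D i j\<close> is the partial derivative of order \<open>i\<close> in the first and \<open>j\<close> in the second
  variable.  Derivatives are taken within \<open>S\<close>, so that \<open>S\<close> may contain the boundary \<open>t = 0\<close>
  of the time axis.
\<close>
definition smooth_on :: "(real \<times> real) set \<Rightarrow> (real \<times> real \<Rightarrow> real) \<Rightarrow> bool" where
  "smooth_on S f \<longleftrightarrow>
    (\<exists>D :: nat \<Rightarrow> nat \<Rightarrow> real \<times> real \<Rightarrow> real.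
       (\<forall>z\<in>S. D 0 0 z = f z) \<and>
       (\<forall>i j. \<forall>z\<in>S. (D i j has_derivative
           (\<lambda>h. D (Suc i) j z * fst h + D i (Suc j) z * snd h)) (at z within S)))"

definition smooth_curve :: "(real \<Rightarrow> real) \<Rightarrow> bool" where
  "smooth_curve \<gamma> \<longleftrightarrow> (\<forall>n s. (deriv ^^ n) \<gamma> field_differentiable at s)"


section \<open>Quantiles\<close>

definition quantile :: "'a measure \<Rightarrow> ('a \<Rightarrow> real) \<Rightarrow> real \<Rightarrow> real" where
  "quantile M X \<alpha> = Inf {x. \<alpha> \<le> cdf (distr M borel X) x}"

definition median :: "'a measure \<Rightarrow> ('a \<Rightarrow> real) \<Rightarrow> real" where
  "median M X = quantile M X (1/2)"

definition std_normal_cdf :: "real \<Rightarrow> real" where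
  "std_normal_cdf = cdf std_normal_distribution"


section \<open>Brownian motion and the It\^o integral\<close>

text \<open>
  Only times \<open>t \<ge> 0\<close> matter; a filtration indexed by them is extended to negative times by \<open>F 0\<close>.
\<close>
definition brownian_motion ::
  "'a measure \<Rightarrow> (real \<Rightarrow> 'a measure) \<Rightarrow> (real \<Rightarrow> 'a \<Rightarrow> real) \<Rightarrow> bool" where
  "brownian_motion M F W \<longleftrightarrow>
    prob_space M \<and> filtration (space M) F \<and> (\<forall>t. subalgebra M (F t)) \<and>
    (\<forall>t\<ge>0. W t \<in> borel_measurable (F t)) \<and>
    (\<forall>\<omega>\<in>space M. continuous_on {0..} (\<lambda>t. W t \<omega>)) \<and>
    (AE \<omega> in M. W 0 \<omega> = 0) \<and>
    (\<forall>s t. 0 \<le> s \<and> s < t \<longrightarrow>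
       distributed M lborel (\<lambda>\<omega>. W t \<omega> - W s \<omega>) (\<lambda>x. ennreal (normal_density 0 (sqrt (t - s)) x)) \<and>
       prob_space.indep_set M (sets (F s))
         (sets (vimage_algebra (space M) (\<lambda>\<omega>. W t \<omega> - W s \<omega>) borel)))"

text \<open>
  The elementary process \<open>\<Sum>i<n. \<xi> i * 1\<^bsub>(\<tau> i, \<tau> (i+1)]\<^esub>\<close> on \<open>[0, t]\<close> is represented by \<open>n\<close>, \<open>\<tau>\<close>, \<open>\<xi>\<close>.
\<close>
definition elementary_process ::
  "'a measure \<Rightarrow> (real \<Rightarrow> 'a measure) \<Rightarrow> real \<Rightarrow> nat \<Rightarrow> (nat \<Rightarrow> real) \<Rightarrow> (nat \<Rightarrow> 'a \<Rightarrow> real) \<Rightarrow> bool" where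
  "elementary_process M F t n \<tau> \<xi> \<longleftrightarrow>
    \<tau> 0 = 0 \<and> \<tau> n = t \<and>
    (\<forall>i<n. \<tau> i \<le> \<tau> (Suc i) \<and> \<xi> i \<in> borel_measurable (F (\<tau> i)) \<and>
           (\<exists>C. \<forall>\<omega>\<in>space M. \<bar>\<xi> i \<omega>\<bar> \<le> C))"

definition elementary_value ::
  "nat \<Rightarrow> (nat \<Rightarrow> real) \<Rightarrow> (nat \<Rightarrow> 'a \<Rightarrow> real) \<Rightarrow> real \<Rightarrow> 'a \<Rightarrow> real" where
  "elementary_value n \<tau> \<xi> s \<omega> = (\<Sum>i<n. \<xi> i \<omega> * indicator {\<tau> i<..\<tau> (Suc i)} s)"

definition elementary_integral ::
  "(real \<Rightarrow> 'a \<Rightarrow> real) \<Rightarrow> nat \<Rightarrow> (nat \<Rightarrow> real) \<Rightarrow> (nat \<Rightarrow> 'a \<Rightarrow> real) \<Rightarrow> 'a \<Rightarrow> real" where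
  "elementary_integral W n \<tau> \<xi> \<omega> = (\<Sum>i<n. \<xi> i \<omega> * (W (\<tau> (Suc i)) \<omega> - W (\<tau> i) \<omega>))"

definition progressively_measurable ::
  "(real \<Rightarrow> 'a measure) \<Rightarrow> real \<Rightarrow> (real \<Rightarrow> 'a \<Rightarrow> real) \<Rightarrow> bool" where
  "progressively_measurable F t H \<longleftrightarrow>
    (\<forall>u\<in>{0..t}. (\<lambda>(s, \<omega>). H s \<omega>) \<in> borel_measurable (restrict_space borel {0..u} \<Otimes>\<^sub>M F u))"

text \<open>
  \<open>I\<close> is a version of \<open>\<integral>\<^sub>0\<^sup>t H dW\<close>: the limit in probability of the integrals of elementary
  processes that approximate \<open>H\<close> in \<open>L\<^sup>2[0,t]\<close>, in probability.  The \<open>L\<^sup>2\<close> error is an extended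
  nonnegative integral because the Bochner integral of a non-integrable function is \<open>0\<close>;
  progressive measurability makes the sets below measurable (\<open>measure\<close> is \<open>0\<close> on other sets).
\<close>
definition ito_integral ::
  "'a measure \<Rightarrow> (real \<Rightarrow> 'a measure) \<Rightarrow> (real \<Rightarrow> 'a \<Rightarrow> real) \<Rightarrow> (real \<Rightarrow> 'a \<Rightarrow> real) \<Rightarrow> real
    \<Rightarrow> ('a \<Rightarrow> real) \<Rightarrow> bool" where
  "ito_integral M F W H t I \<longleftrightarrow>
    progressively_measurable F t H \<and> I \<in> borel_measurable M \<and>
    (\<exists>n \<tau> \<xi>. (\<forall>k. elementary_process M F t (n k) (\<tau> k) (\<xi> k)) \<and>
      (\<forall>\<epsilon>>0. (\<lambda>k. measure M {\<omega> \<in> space M.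
          ennreal \<epsilon> < (\<integral>\<^sup>+s\<in>{0..t}. ennreal ((elementary_value (n k) (\<tau> k) (\<xi> k) s \<omega> - H s \<omega>)\<^sup>2) \<partial>lborel)})
        \<longlonglongrightarrow> 0) \<and>
      (\<forall>\<epsilon>>0. (\<lambda>k. measure M {\<omega> \<in> space M.
          \<epsilon> < \<bar>elementary_integral W (n k) (\<tau> k) (\<xi> k) \<omega> - I \<omega>\<bar>})
        \<longlonglongrightarrow> 0))"


section \<open>Stochastic differential equations\<close>

text \<open>The time axis \<open>[0, T)\<close>, which is \<open>[0, \<infinity>)\<close> for \<open>T = \<infinity>\<close>.\<close>
definition time_range :: "ereal \<Rightarrow> real set" where
  "time_range T = {t. 0 \<le> t \<and> ereal t < T}"

text \<open>
  \<open>dX\<^sub>t = a(X\<^sub>t,t) dt + b(X\<^sub>t,t) dW\<^sub>t\<close>, \<open>X\<^sub>0 = x0\<close>, with coefficients defined for \<open>(x, t) \<in> D\<close>.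
\<close>
definition sde_solution ::
  "'a measure \<Rightarrow> (real \<Rightarrow> 'a measure) \<Rightarrow> (real \<Rightarrow> 'a \<Rightarrow> real) \<Rightarrow> ereal \<Rightarrow> (real \<times> real) set
    \<Rightarrow> (real \<Rightarrow> real \<Rightarrow> real) \<Rightarrow> (real \<Rightarrow> real \<Rightarrow> real) \<Rightarrow> real \<Rightarrow> (real \<Rightarrow> 'a \<Rightarrow> real) \<Rightarrow> bool" where
  "sde_solution M F W T D a b x0 X \<longleftrightarrow>
    (\<forall>t\<in>time_range T. X t \<in> borel_measurable (F t)) \<and>
    (\<forall>\<omega>\<in>space M. continuous_on (time_range T) (\<lambda>t. X t \<omega>)) \<and>
    (\<forall>\<omega>\<in>space M. \<forall>t\<in>time_range T. (X t \<omega>, t) \<in> D) \<and>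
    (\<forall>t\<in>time_range T. \<exists>I. ito_integral M F W (\<lambda>s \<omega>. b (X s \<omega>) s) t I \<and>
       (AE \<omega> in M. set_integrable lborel {0..t} (\<lambda>s. a (X s \<omega>) s) \<and>
          X t \<omega> = x0 + (LINT s:{0..t}|lborel. a (X s \<omega>) s) + I \<omega>))"

definition sde_well_posed ::
  "'a measure \<Rightarrow> (real \<Rightarrow> 'a measure) \<Rightarrow> (real \<Rightarrow> 'a \<Rightarrow> real) \<Rightarrow> ereal \<Rightarrow> (real \<times> real) set
    \<Rightarrow> (real \<Rightarrow> real \<Rightarrow> real) \<Rightarrow> (real \<Rightarrow> real \<Rightarrow> real) \<Rightarrow> real \<Rightarrow> bool" where
  "sde_well_posed M F W T D a b x0 \<longleftrightarrow>
    (\<exists>X. sde_solution M F W T D a b x0 X \<and>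
      (\<forall>X'. sde_solution M F W T D a b x0 X' \<longrightarrow>
        (AE \<omega> in M. \<forall>t\<in>time_range T. X' t \<omega> = X t \<omega>)))"

definition stratonovich_drift ::
  "(real \<Rightarrow> real \<Rightarrow> real) \<Rightarrow> (real \<Rightarrow> real \<Rightarrow> real) \<Rightarrow> real \<Rightarrow> real \<Rightarrow> real" where
  "stratonovich_drift a b x t = a x t - 1/2 * b x t * deriv (\<lambda>x. b x t) x"

definition ito_jet_representative ::
  "(real \<Rightarrow> real \<Rightarrow> real) \<Rightarrow> (real \<Rightarrow> real \<Rightarrow> real) \<Rightarrow> real \<Rightarrow> (real \<Rightarrow> real) \<Rightarrow> bool" where
  "ito_jet_representative a b x0 \<gamma> \<longleftrightarrow>
    smooth_curve \<gamma> \<and> \<gamma> 0 = x0 \<and> deriv \<gamma> 0 = b x0 0 \<and> 1/2 * deriv (deriv \<gamma>) 0 = a x0 0"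


section \<open>Lamperti transformation\<close>

text \<open>
  The drift \<open>\<mu>\<close> of \<open>Z\<^sub>t = \<phi>(t, X\<^sub>t)\<close> given by It\^o's formula, where \<open>\<partial>\<^sub>x\<phi> = 1/b\<close> and hence
  \<open>1/2 b\<^sup>2 \<partial>\<^sub>x\<partial>\<^sub>x\<phi> = - 1/2 \<partial>\<^sub>xb\<close>.  It is meaningful only for \<open>z \<in> range (\<phi> t)\<close>, which need not
  be the whole line.
\<close>
definition lamperti_drift ::
  "ereal \<Rightarrow> (real \<Rightarrow> real \<Rightarrow> real) \<Rightarrow> (real \<Rightarrow> real \<Rightarrow> real) \<Rightarrow> (real \<Rightarrow> real \<Rightarrow> real)
    \<Rightarrow> real \<Rightarrow> real \<Rightarrow> real" where
  "lamperti_drift T a b \<phi> z t =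
    (let x = inv (\<phi> t) z
     in vector_derivative (\<lambda>s. \<phi> s x) (at t within time_range T)
        + a x t / b x t - 1/2 * deriv (\<lambda>x. b x t) x)"

text \<open>
  \<open>\<phi>\<close> is a primitive of \<open>1/b\<close> in \<open>x\<close>, smooth also in \<open>t\<close>, and \<open>z0\<close> is the solution of
  \<open>dz0/dt = \<mu>(z0, t)\<close> started at \<open>\<phi>(0, x0)\<close>.
\<close>
definition lamperti_transform ::
  "ereal \<Rightarrow> (real \<Rightarrow> real \<Rightarrow> real) \<Rightarrow> (real \<Rightarrow> real \<Rightarrow> real) \<Rightarrow> real
    \<Rightarrow> (real \<Rightarrow> real \<Rightarrow> real) \<Rightarrow> (real \<Rightarrow> real) \<Rightarrow> bool" where
  "lamperti_transform T a b x0 \<phi> z0 \<longleftrightarrow>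
    smooth_on (time_range T \<times> UNIV) (\<lambda>(t, x). \<phi> t x) \<and>
    (\<forall>t\<in>time_range T. \<forall>x. (\<phi> t has_real_derivative 1 / b x t) (at x)) \<and>
    z0 0 = \<phi> 0 x0 \<and>
    (\<forall>t\<in>time_range T. z0 t \<in> range (\<phi> t) \<and>
       (z0 has_real_derivative lamperti_drift T a b \<phi> (z0 t) t) (at t within time_range T))"

definition transformed_drift ::
  "ereal \<Rightarrow> (real \<Rightarrow> real \<Rightarrow> real) \<Rightarrow> (real \<Rightarrow> real \<Rightarrow> real) \<Rightarrow> (real \<Rightarrow> real \<Rightarrow> real)
    \<Rightarrow> (real \<Rightarrow> real) \<Rightarrow> real \<Rightarrow> real \<Rightarrow> real" where
  "transformed_drift T a b \<phi> z0 y t =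
    lamperti_drift T a b \<phi> (y + z0 t) t - lamperti_drift T a b \<phi> (z0 t) t"

text \<open>The domain of \<open>transformed_drift\<close>; all of \<open>UNIV \<times> [0, T)\<close> if each \<open>\<phi> t\<close> is onto.\<close>
definition transformed_domain ::
  "ereal \<Rightarrow> (real \<Rightarrow> real \<Rightarrow> real) \<Rightarrow> (real \<Rightarrow> real) \<Rightarrow> (real \<times> real) set" where
  "transformed_domain T \<phi> z0 = {(y, t). t \<in> time_range T \<and> y + z0 t \<in> range (\<phi> t)}"


section \<open>Fokker--Planck equation\<close>

text \<open>
  A regular solution for \<open>dY\<^sub>t = c(Y\<^sub>t,t) dt + dW\<^sub>t\<close>, \<open>Y\<^sub>0 = 0\<close>, is a smooth family of probability
  densities that solves the equation at positive times and converges weakly to the point mass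
  at \<open>0\<close>, the law of \<open>Y\<^sub>0\<close>.
\<close>
definition fokker_planck_solution ::
  "ereal \<Rightarrow> (real \<times> real) set \<Rightarrow> (real \<Rightarrow> real \<Rightarrow> real) \<Rightarrow> (real \<Rightarrow> real \<Rightarrow> real) \<Rightarrow> bool" where
  "fokker_planck_solution T D c p \<longleftrightarrow>
    smooth_on {(y, t) \<in> D. 0 < t} (\<lambda>(y, t). p y t) \<and>
    (\<forall>(y, t)\<in>D. 0 < t \<longrightarrow>
       0 \<le> p y t \<and>
       1/2 * deriv (deriv (\<lambda>y. p y t)) y - deriv (\<lambda>y. c y t * p y t) y - deriv (\<lambda>t. p y t) t = 0) \<and>
    (\<forall>t\<in>time_range T. 0 < t \<longrightarrow> (\<integral>\<^sup>+y\<in>{y. (y, t) \<in> D}. ennreal (p y t) \<partial>lborel) = 1) \<and>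
    (\<forall>f :: real \<Rightarrow> real. continuous_on UNIV f \<and> bounded (range f) \<longrightarrow>
       ((\<lambda>t. LINT y:{y. (y, t) \<in> D}|lborel. f y * p y t) \<longlongrightarrow> f 0) (at_right 0))"

definition fokker_planck_well_posed ::
  "ereal \<Rightarrow> (real \<times> real) set \<Rightarrow> (real \<Rightarrow> real \<Rightarrow> real) \<Rightarrow> bool" where
  "fokker_planck_well_posed T D c \<longleftrightarrow>
    (\<exists>p. fokker_planck_solution T D c p \<and>
      (\<forall>p'. fokker_planck_solution T D c p' \<longrightarrow> (\<forall>(y, t)\<in>D. 0 < t \<longrightarrow> p' y t = p y t)))"

end

theory Submission
  imports Defs
begin

text \<open>
  Put \<open>\<psi>(t, x) = sgn b\<^sub>0 (\<phi>(t, x) - \<phi>(0, x0) - c t)\<close>, with \<open>c\<close> chosen so that the drift of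
  \<open>Y\<^sub>t = \<psi>(t, X\<^sub>t)\<close> vanishes at \<open>(x0, 0)\<close>; the diffusion coefficient of \<open>Y\<close> is \<open>\<plusminus>1\<close>.  Apply It\^o's
  formula to \<open>u(s, X\<^sub>s)\<close>, where \<open>u(s, x) = \<Phi>((k - \<psi>(s, x)) / sqrt (t + \<epsilon> - s))\<close> solves the backward
  heat equation in the coordinate \<open>\<psi>\<close>: only the drift contributes, by at most
  \<open>C (\<bar>X\<^sub>s - x0\<bar> + s) / sqrt (t - s)\<close>.  Its expectation is of order \<open>sqrt s / sqrt (t - s)\<close>, which integrates
  to \<open>O(t)\<close>; hence \<open>P(Y\<^sub>t \<le> k) = \<Phi>(k / sqrt t) + O(t)\<close> uniformly in \<open>k\<close>.  As \<open>\<psi>(t, \<cdot>)\<close> is increasing and the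
  normal density is bounded below near \<open>\<Phi>\<^sup>-\<^sup>1(\<alpha>)\<close>, a Taylor expansion of \<open>\<psi>\<close> at \<open>(0, x0)\<close> gives the quantiles.

  It\^o's formula is used only in expectation, for the Euler scheme on a uniform grid, stopped when
  \<open>X\<close> leaves a neighbourhood of \<open>x0\<close>.  The scheme approximates \<open>X\<close> at all grid points simultaneously, in
  probability, by Lenglart's inequality, which is proved for elementary processes by truncation.
\<close>

section \<open>Brownian increments and integrals of elementary processes\<close>

text \<open>An error of order t in the distribution function is just small enough: in the coordinate
  \<psi> the solution lives on the scale sqrt t, so such an error moves a quantile by sqrt t * O(t).
  If the drift did not vanish at the starting point, its bound would be a constant, the error O(sqrt
  t), and its effect on the quantiles would be as large as the second term of the expansion. Two
  obstacles shape the probabilistic half. \<open>ito_integral\<close> speaks of one time at a time,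
  in probability, with a separate approximating sequence for each time; a comparison at all grid
  points must therefore not depend on their number, and Lenglart's inequality has this property.
  Moreover no moments of \<open>X\<close> are available. Expectations are taken for a frozen, square
  integrable scheme, and \<open>X\<close> enters only through bounded functions and through events
  whose probability tends to 0. The coefficients of the scheme are read along \<open>X\<close>, not
  along the scheme: it is a Riemann sum for \<open>X\<close>, and errors do not feed back.\<close>

definition grid :: "(nat \<Rightarrow> real) \<Rightarrow> nat \<Rightarrow> bool" where
  "grid \<sigma> m \<longleftrightarrow> 0 \<le> \<sigma> 0 \<and> (\<forall>l<m. \<sigma> l < \<sigma> (Suc l))"

lemma grid_mono: "grid \<sigma> m \<Longrightarrow> j \<le> m \<Longrightarrow> i \<le> j \<Longrightarrow> \<sigma> i \<le> \<sigma> j"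
proof (induction j)
  case (Suc j)
  have "\<sigma> j < \<sigma> (Suc j)"
    using Suc.prems by (simp add: grid_def)
  moreover have "i = Suc j \<or> \<sigma> i \<le> \<sigma> j"
    using Suc by (auto simp: le_Suc_eq)
  ultimately show ?case
    by auto
qed auto

lemma grid_strict_mono: "grid \<sigma> m \<Longrightarrow> j \<le> m \<Longrightarrow> i < j \<Longrightarrow> \<sigma> i < \<sigma> j"
  using grid_mono[of \<sigma> m j "Suc i"] unfolding grid_def
  by (meson Suc_leI less_le_trans)

lemma grid_nonneg: "grid \<sigma> m \<Longrightarrow> i \<le> m \<Longrightarrow> 0 \<le> \<sigma> i"
  using grid_mono[of \<sigma> m i 0] by (auto simp: grid_def)

locale brownian =
  fixes M :: "'a measure" and F :: "real \<Rightarrow> 'a measure" and W :: "real \<Rightarrow> 'a \<Rightarrow> real"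
  assumes bm: "brownian_motion M F W"

sublocale brownian \<subseteq> prob_space M
  using bm by (simp add: brownian_motion_def)

context brownian
begin

lemma subalg: "subalgebra M (F t)"
  using bm by (simp add: brownian_motion_def)

lemma measurable_F_mono:
  assumes "Z \<in> borel_measurable (F s)" "s \<le> t"
  shows "Z \<in> borel_measurable (F t)"
proof -
  have "filtration (space M) F"
    using bm by (simp add: brownian_motion_def)
  then have "subalgebra (F t) (F s)"
    using assms(2) filtration.sets_F_mono filtration.space_F unfolding subalgebra_def by metis
  then show ?thesis
    using measurable_from_subalg assms(1) by blast
qed

lemma measurable_F_M: "Z \<in> borel_measurable (F s) \<Longrightarrow> Z \<in> borel_measurable M"
  using measurable_from_subalg[OF subalg] .

lemma W_measurable_F: "0 \<le> s \<Longrightarrow> s \<le> t \<Longrightarrow> W s \<in> borel_measurable (F t)"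
  using bm measurable_F_mono[of "W s" s t] by (simp add: brownian_motion_def)

lemma W_measurable: "0 \<le> s \<Longrightarrow> W s \<in> borel_measurable M"
  using W_measurable_F[of s s] measurable_F_M by blast

lemma increment_distributed:
  "0 \<le> s \<Longrightarrow> s < t \<Longrightarrow> distributed M lborel (\<lambda>\<omega>. W t \<omega> - W s \<omega>) (\<lambda>x. ennreal (normal_density 0 (sqrt (t - s)) x))"
  using bm by (simp add: brownian_motion_def)

text \<open>The independence in \<open>brownian_motion\<close> is one of sigma-algebras; it passes
  to the smaller ones generated by \<open>Z\<close> and by a function of the increment. The function
  \<open>f\<close> is there so that the increment and its square are both covered.\<close>

lemma increment_indep_var:
  assumes "0 \<le> s" "s < t" and Z: "Z \<in> borel_measurable (F s)"
    and f: "f \<in> borel_measurable borel"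
  shows "indep_var borel Z borel (\<lambda>\<omega>. f (W t \<omega> - W s \<omega>))"
proof -
  let ?D = "\<lambda>\<omega>. W t \<omega> - W s \<omega>"
  have D [measurable]: "?D \<in> borel_measurable M"
    using assms(1,2) by (intro borel_measurable_diff W_measurable) auto
  have ind: "indep_set (sets (F s)) (sets (vimage_algebra (space M) ?D borel))"
    using bm assms(1,2) by (simp add: brownian_motion_def)
  have sp: "space (F s) = space M"
    using subalg by (simp add: subalgebra_def)
  have 1: "sigma_sets (space M) {Z -` A \<inter> space M | A. A \<in> sets borel} \<subseteq> sets (F s)"
    using measurable_sets[OF Z] unfolding sp[symmetric]
    by (intro sets.sigma_sets_subset) auto
  have fD: "(\<lambda>\<omega>. f (?D \<omega>)) \<in> borel_measurable (vimage_algebra (space M) ?D borel)"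
    by (intro measurable_compose[OF _ f] measurable_vimage_algebra1) auto
  have 2: "sigma_sets (space M) {(\<lambda>\<omega>. f (?D \<omega>)) -` A \<inter> space M | A. A \<in> sets borel}
      \<subseteq> sets (vimage_algebra (space M) ?D borel)"
  proof -
    let ?V = "vimage_algebra (space M) ?D borel"
    have "{(\<lambda>\<omega>. f (?D \<omega>)) -` A \<inter> space M | A. A \<in> sets borel} \<subseteq> sets ?V"
      using measurable_sets[OF fD] unfolding space_vimage_algebra by blast
    then have "sigma_sets (space ?V) {(\<lambda>\<omega>. f (?D \<omega>)) -` A \<inter> space M | A. A \<in> sets borel} \<subseteq> sets ?V"
      by (rule sets.sigma_sets_subset)
    then show ?thesis
      unfolding space_vimage_algebra .
  qed
  have "indep_set (sigma_sets (space M) {Z -` A \<inter> space M | A. A \<in> sets borel})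
     (sigma_sets (space M) {(\<lambda>\<omega>. f (?D \<omega>)) -` A \<inter> space M | A. A \<in> sets borel})"
    using ind unfolding indep_set_def
    by (rule indep_sets_mono_sets) (use 1 2 in \<open>auto split: bool.split\<close>)
  moreover have "(\<lambda>\<omega>. f (?D \<omega>)) \<in> borel_measurable M"
    using f by measurable
  ultimately show ?thesis
    unfolding indep_var_eq using measurable_F_M[OF Z] by simp
qed

lemma increment_power_abs:
  assumes "0 \<le> s" "s < t"
  shows "integrable M (\<lambda>\<omega>. \<bar>W t \<omega> - W s \<omega>\<bar> ^ k)"
  using distributed_integrable[OF increment_distributed[OF assms], of "\<lambda>x. \<bar>x\<bar> ^ k"]
    integrable_normal_moment_abs[of "sqrt (t - s)" 0 k] assms by simp

lemma increment_power:
  assumes "0 \<le> s" "s < t"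
  shows "integrable M (\<lambda>\<omega>. (W t \<omega> - W s \<omega>) ^ k)"
  using distributed_integrable[OF increment_distributed[OF assms], of "\<lambda>x. x ^ k"]
    integrable_normal_moment[of "sqrt (t - s)" 0 k] assms by simp

lemma expectation_increment:
  assumes "0 \<le> s" "s < t"
  shows "expectation (\<lambda>\<omega>. W t \<omega> - W s \<omega>) = 0"
  using distributed_integral[OF increment_distributed[OF assms], of "\<lambda>x. x"]
    integral_normal_moment_odd[of "sqrt (t - s)" 0 0] assms by simp

lemma expectation_increment_square:
  assumes "0 \<le> s" "s < t"
  shows "expectation (\<lambda>\<omega>. (W t \<omega> - W s \<omega>)\<^sup>2) = t - s"
  using distributed_integral[OF increment_distributed[OF assms], of "\<lambda>x. x\<^sup>2"]
    integral_normal_moment_even[of "sqrt (t - s)" 0 1] assms by (simp add: fact_numeral)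

lemma expectation_increment_cube:
  assumes "0 \<le> s" "s < t"
  shows "expectation (\<lambda>\<omega>. \<bar>W t \<omega> - W s \<omega>\<bar> ^ 3) \<le> 2 * sqrt (t - s) ^ 3"
proof -
  \<comment> \<open>The third absolute moment is \<open>2 * sqrt (2 / pi)\<close> times the cube of
    the standard deviation; only its order matters.\<close>
  have "sqrt (2 / pi) \<le> 1"
    using pi_gt3 by (simp add: real_sqrt_le_1_iff)
  moreover have "0 \<le> sqrt (t - s) ^ 3"
    using assms by simp
  ultimately have "sqrt (t - s) ^ 3 * sqrt (2 / pi) \<le> sqrt (t - s) ^ 3"
    using mult_left_le by blast
  then show ?thesis
    using distributed_integral[OF increment_distributed[OF assms], of "\<lambda>x. \<bar>x\<bar> ^ 3"]
      integral_normal_moment_abs_odd[of "sqrt (t - s)" 0 1] assms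
    by (simp add: numeral_3_eq_3 mult.assoc)
qed

lemma bounded_mult_integrable:
  fixes Y :: "'a \<Rightarrow> real"
  assumes "integrable M Y" "Z \<in> borel_measurable M" "\<And>\<omega>. \<omega> \<in> space M \<Longrightarrow> \<bar>Z \<omega>\<bar> \<le> C"
  shows "integrable M (\<lambda>\<omega>. Z \<omega> * Y \<omega>)"
proof (rule Bochner_Integration.integrable_bound)
  show "integrable M (\<lambda>\<omega>. C * Y \<omega>)"
    using assms(1) by simp
  show "AE \<omega> in M. norm (Z \<omega> * Y \<omega>) \<le> norm (C * Y \<omega>)"
  proof (rule AE_I2)
    fix \<omega> assume "\<omega> \<in> space M"
    then have "\<bar>Z \<omega>\<bar> \<le> \<bar>C\<bar>"
      using assms(3)[of \<omega>] by linarith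
    then show "norm (Z \<omega> * Y \<omega>) \<le> norm (C * Y \<omega>)"
      by (simp add: abs_mult mult_right_mono)
  qed
qed (use assms(1,2) in measurable)

lemma bounded_integrable:
  fixes Z :: "'a \<Rightarrow> real"
  assumes "Z \<in> borel_measurable M" "\<And>\<omega>. \<omega> \<in> space M \<Longrightarrow> \<bar>Z \<omega>\<bar> \<le> C"
  shows "integrable M Z"
  using assms by (intro integrable_const_bound[of _ C]) auto

lemma bounded_square_integrable:
  fixes Z :: "'a \<Rightarrow> real"
  assumes "Z \<in> borel_measurable M" "\<And>\<omega>. \<omega> \<in> space M \<Longrightarrow> \<bar>Z \<omega>\<bar> \<le> C"
  shows "integrable M (\<lambda>\<omega>. (Z \<omega>)\<^sup>2)"
proof (rule bounded_integrable)
  show "\<bar>(Z \<omega>)\<^sup>2\<bar> \<le> C\<^sup>2" if "\<omega> \<in> space M" for \<omega>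
    using power_mono[OF assms(2)[OF that], of 2] by simp
qed (use assms in measurable)

text \<open>As \<open>Z\<close> is known at time \<open>s\<close>, it is independent of the
  increment and the expectations factor. These four facts do the work of conditional expectations in
  the isometry and in the one-step estimate.\<close>

lemma
  assumes "0 \<le> s" "s < t" "Z \<in> borel_measurable (F s)" "integrable M Z"
  shows integrable_mult_increment: "integrable M (\<lambda>\<omega>. Z \<omega> * (W t \<omega> - W s \<omega>))"
    and expectation_mult_increment: "expectation (\<lambda>\<omega>. Z \<omega> * (W t \<omega> - W s \<omega>)) = 0"
    and integrable_mult_increment_square: "integrable M (\<lambda>\<omega>. Z \<omega> * (W t \<omega> - W s \<omega>)\<^sup>2)"
    and expectation_mult_increment_square:
      "expectation (\<lambda>\<omega>. Z \<omega> * (W t \<omega> - W s \<omega>)\<^sup>2) = (t - s) * expectation Z"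
proof -
  note i = increment_indep_var[OF assms(1-3)]
  note p = increment_power[OF assms(1,2)]
  show "integrable M (\<lambda>\<omega>. Z \<omega> * (W t \<omega> - W s \<omega>))"
    using indep_var_integrable[OF i[of "\<lambda>x. x"] assms(4)] p[of 1] by simp
  show "expectation (\<lambda>\<omega>. Z \<omega> * (W t \<omega> - W s \<omega>)) = 0"
    using indep_var_lebesgue_integral[OF i[of "\<lambda>x. x"] assms(4)] p[of 1]
      expectation_increment[OF assms(1,2)] by simp
  show "integrable M (\<lambda>\<omega>. Z \<omega> * (W t \<omega> - W s \<omega>)\<^sup>2)"
    using indep_var_integrable[OF i[of "\<lambda>x. x\<^sup>2"] assms(4)] p[of 2] by simp
  show "expectation (\<lambda>\<omega>. Z \<omega> * (W t \<omega> - W s \<omega>)\<^sup>2) = (t - s) * expectation Z"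
    using indep_var_lebesgue_integral[OF i[of "\<lambda>x. x\<^sup>2"] assms(4)] p[of 2]
      expectation_increment_square[OF assms(1,2)] by simp
qed

section \<open>Integrals of bounded adapted step processes\<close>

definition bounded_adapted :: "(nat \<Rightarrow> real) \<Rightarrow> nat \<Rightarrow> (nat \<Rightarrow> 'a \<Rightarrow> real) \<Rightarrow> bool" where
  "bounded_adapted \<sigma> m \<zeta> \<longleftrightarrow> (\<forall>l<m. \<zeta> l \<in> borel_measurable (F (\<sigma> l)) \<and>
     (\<exists>C. \<forall>\<omega>\<in>space M. \<bar>\<zeta> l \<omega>\<bar> \<le> C))"

lemma bounded_adapted_measurable:
  assumes "grid \<sigma> m" "bounded_adapted \<sigma> m \<zeta>" "i < m" "i \<le> l" "l \<le> m"
  shows "\<zeta> i \<in> borel_measurable (F (\<sigma> l))"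
  using assms measurable_F_mono[of "\<zeta> i" "\<sigma> i" "\<sigma> l"] grid_mono[of \<sigma> m l i]
  unfolding bounded_adapted_def by blast

lemma elementary_integral_measurable_F:
  assumes "grid \<sigma> m" "bounded_adapted \<sigma> m \<zeta>" "q \<le> m"
  shows "elementary_integral W q \<sigma> \<zeta> \<in> borel_measurable (F (\<sigma> q))"
  unfolding elementary_integral_def[abs_def]
proof (intro borel_measurable_sum borel_measurable_times borel_measurable_diff)
  fix i assume i: "i \<in> {..<q}"
  show "\<zeta> i \<in> borel_measurable (F (\<sigma> q))"
    using assms i by (intro bounded_adapted_measurable) auto
  show "W (\<sigma> (Suc i)) \<in> borel_measurable (F (\<sigma> q))" "W (\<sigma> i) \<in> borel_measurable (F (\<sigma> q))"
    using i assms by (auto intro!: W_measurable_F grid_mono[OF assms(1)] grid_nonneg[OF assms(1)])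
qed

text \<open>Induction on the number of steps: in the square of the longer sum the cross term is
  \<open>\<zeta> m\<close> times the shorter sum, known at time \<open>\<sigma> m\<close>, times an
  increment, so it has mean zero; the new square contributes the variance of the increment.\<close>

lemma elementary_isometry:
  assumes "grid \<sigma> m" "bounded_adapted \<sigma> m \<zeta>"
  shows "integrable M (\<lambda>\<omega>. (elementary_integral W m \<sigma> \<zeta> \<omega>)\<^sup>2) \<and>
    expectation (\<lambda>\<omega>. (elementary_integral W m \<sigma> \<zeta> \<omega>)\<^sup>2)
      = (\<Sum>l<m. (\<sigma> (Suc l) - \<sigma> l) * expectation (\<lambda>\<omega>. (\<zeta> l \<omega>)\<^sup>2))"
  using assms
proof (induction m)
  case 0
  then show ?case by (simp add: elementary_integral_def)
next
  case (Suc m)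
  let ?S = "elementary_integral W m \<sigma> \<zeta>" and ?D = "\<lambda>\<omega>. W (\<sigma> (Suc m)) \<omega> - W (\<sigma> m) \<omega>"
  have g: "grid \<sigma> m" "bounded_adapted \<sigma> m \<zeta>" and s: "0 \<le> \<sigma> m" "\<sigma> m < \<sigma> (Suc m)"
    using Suc.prems grid_nonneg[OF Suc.prems(1), of m]
    by (auto simp: grid_def bounded_adapted_def)
  from Suc.prems(2) obtain C where z: "\<zeta> m \<in> borel_measurable (F (\<sigma> m))"
    and C: "\<And>\<omega>. \<omega> \<in> space M \<Longrightarrow> \<bar>\<zeta> m \<omega>\<bar> \<le> C"
    unfolding bounded_adapted_def by blast
  have zM[measurable]: "\<zeta> m \<in> borel_measurable M"
    using z by (rule measurable_F_M)
  have SF: "?S \<in> borel_measurable (F (\<sigma> m))"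
    using elementary_integral_measurable_F[OF g] by simp
  then have SM[measurable]: "?S \<in> borel_measurable M"
    by (rule measurable_F_M)
  note IH = Suc.IH[OF g]
  have S1: "integrable M ?S"
    using square_integrable_imp_integrable[OF SM] IH by simp
  have zS: "(\<lambda>\<omega>. \<zeta> m \<omega> * ?S \<omega>) \<in> borel_measurable (F (\<sigma> m))" "integrable M (\<lambda>\<omega>. \<zeta> m \<omega> * ?S \<omega>)"
    using z SF bounded_mult_integrable[OF S1 zM C] by auto
  have z2: "(\<lambda>\<omega>. (\<zeta> m \<omega>)\<^sup>2) \<in> borel_measurable (F (\<sigma> m))" "integrable M (\<lambda>\<omega>. (\<zeta> m \<omega>)\<^sup>2)"
    using z bounded_square_integrable[OF zM C] by auto
  note c = integrable_mult_increment[OF s zS] expectation_mult_increment[OF s zS]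
  note d = integrable_mult_increment_square[OF s z2] expectation_mult_increment_square[OF s z2]
  have eq: "(elementary_integral W (Suc m) \<sigma> \<zeta> \<omega>)\<^sup>2
    = (?S \<omega>)\<^sup>2 + 2 * (\<zeta> m \<omega> * ?S \<omega> * ?D \<omega>) + (\<zeta> m \<omega>)\<^sup>2 * (?D \<omega>)\<^sup>2" for \<omega>
    by (simp add: elementary_integral_def power2_eq_square algebra_simps)
  show ?case
    unfolding eq using IH c d by simp
qed

text \<open>
  Setting the coefficients to \<open>0\<close> once a partial integral exceeds \<open>\<epsilon>\<close> or the quadratic variation
  exceeds \<open>N\<close> leaves an integral whose second moment is at most \<open>N\<close>.
\<close>
lemma elementary_lenglart:
  assumes g: "grid \<sigma> m" and z: "bounded_adapted \<sigma> m \<zeta>" and \<epsilon>: "0 < \<epsilon>" and N: "0 \<le> N"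
  shows "prob {\<omega>\<in>space M. \<exists>q\<in>{..m}. \<epsilon> < \<bar>elementary_integral W q \<sigma> \<zeta> \<omega>\<bar>}
    \<le> N / \<epsilon>\<^sup>2 + prob {\<omega>\<in>space M. N < (\<Sum>l<m. (\<sigma> (Suc l) - \<sigma> l) * (\<zeta> l \<omega>)\<^sup>2)}"
proof -
  let ?S = "\<lambda>q. elementary_integral W q \<sigma> \<zeta>"
  let ?Q = "\<lambda>q \<omega>. \<Sum>l<q. (\<sigma> (Suc l) - \<sigma> l) * (\<zeta> l \<omega>)\<^sup>2"
  \<comment> \<open>\<open>?Q (Suc l)\<close> already contains the l-th term, yet \<open>P l\<close>
    is known at time \<open>\<sigma> l\<close>, because \<open>\<zeta> l\<close> is. Looking one
    step ahead keeps the truncated quadratic variation below \<open>N\<close> without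
    overshoot.\<close>
  define P where "P l \<omega> \<longleftrightarrow> (\<forall>q\<in>{..l}. \<bar>?S q \<omega>\<bar> \<le> \<epsilon>) \<and> ?Q (Suc l) \<omega> \<le> N" for l \<omega>
  define \<zeta>' where "\<zeta>' l \<omega> = (if P l \<omega> then \<zeta> l \<omega> else 0)" for l \<omega>
  let ?S' = "elementary_integral W m \<sigma> \<zeta>'"
  have zF: "\<zeta> i \<in> borel_measurable (F (\<sigma> l))" if "i \<le> l" "l < m" for i l
    using that by (intro bounded_adapted_measurable[OF g z]) auto
  have SF: "?S i \<in> borel_measurable (F (\<sigma> l))" if "i \<le> l" "l < m" for i l
    using that grid_mono[OF g, of l i]
    by (intro measurable_F_mono[OF elementary_integral_measurable_F[OF g z, of i], of "\<sigma> l"]) auto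
  have z'F: "\<zeta>' l \<in> borel_measurable (F (\<sigma> l))" if l: "l < m" for l
  proof -
    have [measurable]: "\<And>i. i \<in> {..<Suc l} \<Longrightarrow> \<zeta> i \<in> borel_measurable (F (\<sigma> l))"
      using zF l by auto
    have [measurable]: "\<And>i. i \<in> {..l} \<Longrightarrow> ?S i \<in> borel_measurable (F (\<sigma> l))"
      using SF l by auto
    have [measurable]: "\<zeta> l \<in> borel_measurable (F (\<sigma> l))"
      using zF l by auto
    have [measurable]: "Measurable.pred (F (\<sigma> l)) (P l)"
      unfolding P_def[abs_def] by measurable
    show ?thesis
      unfolding \<zeta>'_def by measurable
  qed
  have le: "\<bar>\<zeta>' l \<omega>\<bar> \<le> \<bar>\<zeta> l \<omega>\<bar>" for l \<omega>
    by (simp add: \<zeta>'_def)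
  have z': "bounded_adapted \<sigma> m \<zeta>'"
    unfolding bounded_adapted_def
  proof (intro allI impI conjI)
    fix l assume l: "l < m"
    obtain C where "\<forall>\<omega>\<in>space M. \<bar>\<zeta> l \<omega>\<bar> \<le> C"
      using z l unfolding bounded_adapted_def by blast
    then have "\<forall>\<omega>\<in>space M. \<bar>\<zeta>' l \<omega>\<bar> \<le> C"
      using le by (meson order_trans)
    then show "\<exists>C. \<forall>\<omega>\<in>space M. \<bar>\<zeta>' l \<omega>\<bar> \<le> C" ..
  qed (rule z'F)
  have d0: "0 \<le> \<sigma> (Suc l) - \<sigma> l" if "l < m" for l
    using g that by (simp add: grid_def less_imp_le)
  have Q': "(\<Sum>l<q. (\<sigma> (Suc l) - \<sigma> l) * (\<zeta>' l \<omega>)\<^sup>2) \<le> N" if "q \<le> m" for q \<omega>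
    using that
  proof (induction q)
    case (Suc q)
    show ?case
    proof (cases "P q \<omega>")
      case True
      have "(\<Sum>l<Suc q. (\<sigma> (Suc l) - \<sigma> l) * (\<zeta>' l \<omega>)\<^sup>2) \<le> ?Q (Suc q) \<omega>"
        using le Suc.prems
        by (intro sum_mono mult_left_mono d0) (auto simp: abs_le_square_iff)
      then show ?thesis
        using True unfolding P_def by linarith
    qed (use Suc in \<open>simp add: \<zeta>'_def\<close>)
  qed (use N in simp)
  have zM[measurable]: "\<zeta> l \<in> borel_measurable M" "\<zeta>' l \<in> borel_measurable M" if "l < m" for l
    using measurable_F_M[OF zF[of l l]] measurable_F_M[OF z'F[of l]] that by simp_all
  have SM[measurable]: "?S q \<in> borel_measurable M" if "q \<le> m" for q
    using measurable_F_M[OF elementary_integral_measurable_F[OF g z that]] .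
  have S'M[measurable]: "?S' \<in> borel_measurable M"
    using measurable_F_M[OF elementary_integral_measurable_F[OF g z', of m]] by simp
  have int: "integrable M (\<lambda>\<omega>. (\<zeta>' l \<omega>)\<^sup>2)" if l: "l < m" for l
  proof -
    obtain C where "\<forall>\<omega>\<in>space M. \<bar>\<zeta>' l \<omega>\<bar> \<le> C"
      using z' l unfolding bounded_adapted_def by blast
    then show ?thesis
      using bounded_square_integrable[OF zM(2)[OF l], of C] by blast
  qed
  have "expectation (\<lambda>\<omega>. (?S' \<omega>)\<^sup>2) = expectation (\<lambda>\<omega>. \<Sum>l<m. (\<sigma> (Suc l) - \<sigma> l) * (\<zeta>' l \<omega>)\<^sup>2)"
    using elementary_isometry[OF g z'] int by (subst Bochner_Integration.integral_sum) auto
  also have "\<dots> \<le> expectation (\<lambda>\<omega>. N)"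
    using int Q' by (intro integral_mono Bochner_Integration.integrable_sum) auto
  finally have E: "expectation (\<lambda>\<omega>. (?S' \<omega>)\<^sup>2) \<le> N"
    by (simp add: prob_space)
  have "prob {\<omega>\<in>space M. \<epsilon> \<le> \<bar>?S' \<omega>\<bar>} \<le> expectation (\<lambda>\<omega>. (?S' \<omega>)\<^sup>2) / \<epsilon>\<^sup>2"
    using second_moment_method[OF S'M _ \<epsilon>] elementary_isometry[OF g z'] by simp
  also have "\<dots> \<le> N / \<epsilon>\<^sup>2"
    using E by (simp add: divide_right_mono)
  finally have 1: "prob {\<omega>\<in>space M. \<epsilon> \<le> \<bar>?S' \<omega>\<bar>} \<le> N / \<epsilon>\<^sup>2" .
  have sub: "{\<omega>\<in>space M. \<exists>q\<in>{..m}. \<epsilon> < \<bar>?S q \<omega>\<bar>}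
     \<subseteq> {\<omega>\<in>space M. \<epsilon> \<le> \<bar>?S' \<omega>\<bar>} \<union> {\<omega>\<in>space M. N < ?Q m \<omega>}"
  proof
    fix \<omega> assume "\<omega> \<in> {\<omega>\<in>space M. \<exists>q\<in>{..m}. \<epsilon> < \<bar>?S q \<omega>\<bar>}"
    then obtain q where \<omega>: "\<omega> \<in> space M" "q \<le> m" "\<epsilon> < \<bar>?S q \<omega>\<bar>"
      by blast
    define r where "r = (LEAST q. \<epsilon> < \<bar>?S q \<omega>\<bar>)"
    have r: "\<epsilon> < \<bar>?S r \<omega>\<bar>" "r \<le> q"
      using LeastI[of "\<lambda>q. \<epsilon> < \<bar>?S q \<omega>\<bar>" q] Least_le[of "\<lambda>q. \<epsilon> < \<bar>?S q \<omega>\<bar>" q] \<omega>(3)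
      unfolding r_def by simp_all
    have r': "\<bar>?S i \<omega>\<bar> \<le> \<epsilon>" if "i < r" for i
      using not_less_Least[of i "\<lambda>q. \<epsilon> < \<bar>?S q \<omega>\<bar>"] that unfolding r_def by simp
    have "\<epsilon> \<le> \<bar>?S' \<omega>\<bar>" if N': "?Q m \<omega> \<le> N"
    proof -
      \<comment> \<open>While the quadratic variation stays below \<open>N\<close>, only the first
        condition in \<open>P\<close> can fail. The truncation then acts exactly from the index
        \<open>r\<close> of the first large partial integral on, and \<open>?S'\<close> keeps the
        value \<open>?S r\<close>.\<close>
      have P: "P l \<omega> \<longleftrightarrow> l < r" if l: "l < m" for l
      proof -
        have "?Q (Suc l) \<omega> \<le> ?Q m \<omega>"
          using l d0 by (intro sum_mono2) auto
        then have Q: "?Q (Suc l) \<omega> \<le> N"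
          using N' by (rule order_trans)
        show ?thesis
        proof
          assume "P l \<omega>"
          then show "l < r"
            using r(1) unfolding P_def by (meson atMost_iff not_le)
        next
          assume "l < r"
          then show "P l \<omega>"
            using r' Q unfolding P_def by (meson atMost_iff le_less_trans)
        qed
      qed
      have "?S' \<omega> = (\<Sum>l<m. if l < r then \<zeta> l \<omega> * (W (\<sigma> (Suc l)) \<omega> - W (\<sigma> l) \<omega>) else 0)"
        unfolding elementary_integral_def by (intro sum.cong) (simp_all add: \<zeta>'_def P)
      also have "\<dots> = (\<Sum>l\<in>{..<m} \<inter> {l. l < r}. \<zeta> l \<omega> * (W (\<sigma> (Suc l)) \<omega> - W (\<sigma> l) \<omega>))"
        by (subst sum.inter_restrict) simp_all
      also have "{..<m} \<inter> {l. l < r} = {..<r}"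
        using r(2) \<omega>(2) by auto
      finally show ?thesis
        using r(1) by (simp add: elementary_integral_def)
    qed
    then show "\<omega> \<in> {\<omega>\<in>space M. \<epsilon> \<le> \<bar>?S' \<omega>\<bar>} \<union> {\<omega>\<in>space M. N < ?Q m \<omega>}"
      using \<omega>(1) by (cases "?Q m \<omega> \<le> N") simp_all
  qed
  have [measurable]: "?Q m \<in> borel_measurable M"
    by (intro borel_measurable_sum borel_measurable_times borel_measurable_power zM) auto
  have "prob {\<omega>\<in>space M. \<exists>q\<in>{..m}. \<epsilon> < \<bar>?S q \<omega>\<bar>}
     \<le> prob ({\<omega>\<in>space M. \<epsilon> \<le> \<bar>?S' \<omega>\<bar>} \<union> {\<omega>\<in>space M. N < ?Q m \<omega>})"
    by (intro finite_measure_mono sub) measurable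
  also have "\<dots> \<le> prob {\<omega>\<in>space M. \<epsilon> \<le> \<bar>?S' \<omega>\<bar>} + prob {\<omega>\<in>space M. N < ?Q m \<omega>}"
    by (intro measure_Un_le) measurable
  finally show ?thesis
    using 1 by linarith
qed

end

section \<open>Refinement of elementary processes\<close>

lemma tendsto_zero_if_le:
  fixes f :: "nat \<Rightarrow> real"
  assumes "\<And>k. 0 \<le> f k"
    and "\<And>\<delta>. 0 < \<delta> \<Longrightarrow> \<exists>g. g \<longlonglongrightarrow> 0 \<and> (\<forall>\<^sub>F k in sequentially. f k \<le> \<delta> + g k)"
  shows "f \<longlonglongrightarrow> 0"
proof (rule order_tendstoI)
  fix a :: real assume "0 < a"
  then obtain g where g: "g \<longlonglongrightarrow> 0" "\<forall>\<^sub>F k in sequentially. f k \<le> a / 2 + g k"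
    using assms(2)[of "a / 2"] by auto
  have "\<forall>\<^sub>F k in sequentially. g k < a / 2"
    using g(1) \<open>0 < a\<close> by (intro order_tendstoD(2)) auto
  with g(2) show "\<forall>\<^sub>F k in sequentially. f k < a"
    by eventually_elim linarith
next
  fix a :: real assume "a < 0"
  then show "\<forall>\<^sub>F k in sequentially. a < f k"
    using assms(1) by (intro always_eventually allI) (rule less_le_trans)
qed

text \<open>The finite set is sorted. Strict growth is part of \<open>grid\<close>, whereas the
  partition points of an elementary process may repeat; passing to a set removes the
  repetitions.\<close>

lemma finite_grid:
  fixes s :: real
  assumes P: "finite P" "P \<subseteq> {0..s}" "0 \<in> P" "s \<in> P"
  obtains \<sigma> m where "grid \<sigma> m" "\<sigma> 0 = 0" "\<sigma> m = s" "\<sigma> ` {..m} = P"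
proof -
  define L where "L = sorted_list_of_set P"
  define m where "m = length L - 1"
  have set: "set L = P" and sorted: "sorted_wrt (<) L"
    using P(1) by (simp_all add: L_def)
  have len: "length L = Suc m"
    using set P(3) unfolding m_def by (cases L) auto
  have img: "(!) L ` {..m} = P"
    using set len by (auto simp: set_conv_nth less_Suc_eq_le)
  have less: "L ! i < L ! j" if "i < j" "j \<le> m" for i j
    using sorted_wrt_nth_less[OF sorted that(1)] that(2) len by simp
  have mono: "L ! i \<le> L ! j" if "i \<le> j" "j \<le> m" for i j
    using less[of i j] that by (cases "i = j") auto
  obtain a where a: "a \<le> m" "L ! a = 0"
    using img P(3) by (metis atMost_iff imageE)
  obtain b where b: "b \<le> m" "L ! b = s"
    using img P(4) by (metis atMost_iff imageE)
  have "L ! 0 \<in> P" "L ! m \<in> P"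
    using img by auto
  then have e: "L ! 0 = 0" "L ! m = s"
    using mono[of 0 a] mono[of b m] a b P(2) by force+
  show ?thesis
    by (rule that[of "(!) L" m]) (use e less img in \<open>auto simp: grid_def\<close>)
qed

text \<open>Since \<open>p\<close> cannot lie strictly inside a cell, all points of a half-open
  cell, its right end included, lie on the same side of \<open>p\<close>. Indicators of intervals
  between such points are therefore constant on each cell.\<close>

lemma grid_point_less:
  assumes g: "grid \<sigma> m" and l: "l < m" and u: "\<sigma> l < u" "u \<le> \<sigma> (Suc l)"
    and p: "p \<le> \<sigma> m \<Longrightarrow> p \<in> \<sigma> ` {..m}"
  shows "p < u \<longleftrightarrow> p < \<sigma> (Suc l)"
proof
  assume less: "p < \<sigma> (Suc l)"
  have "\<sigma> (Suc l) \<le> \<sigma> m"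
    using l by (intro grid_mono[OF g]) auto
  then obtain j where j: "j \<le> m" "p = \<sigma> j"
    using p less by force
  have "j \<le> l"
    using grid_mono[OF g, of j "Suc l"] j less by (cases "j \<le> l") auto
  then have "p \<le> \<sigma> l"
    using grid_mono[OF g, of l j] j l by simp
  then show "p < u"
    using u(1) by simp
next
  assume "p < u"
  then show "p < \<sigma> (Suc l)"
    using u(2) by (rule less_le_trans)
qed

lemma nn_integral_grid:
  fixes f :: "real \<Rightarrow> ennreal"
  assumes g: "grid \<sigma> m" and f: "\<And>l u. l < m \<Longrightarrow> \<sigma> l < u \<Longrightarrow> u \<le> \<sigma> (Suc l) \<Longrightarrow> f u = c l"
  shows "(\<integral>\<^sup>+u\<in>{\<sigma> 0..\<sigma> m}. f u \<partial>lborel) = (\<Sum>l<m. ennreal (\<sigma> (Suc l) - \<sigma> l) * c l)"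
proof -
  have "f u * indicator {\<sigma> 0<..\<sigma> k} u = (\<Sum>l<k. c l * indicator {\<sigma> l<..\<sigma> (Suc l)} u)" if "k \<le> m" for k u
    using that
  proof (induction k)
    case (Suc k)
    have "\<sigma> 0 \<le> \<sigma> k" "\<sigma> k \<le> \<sigma> (Suc k)"
      using Suc.prems by (auto intro: grid_mono[OF g])
    then have "indicator {\<sigma> 0<..\<sigma> (Suc k)} u
        = (indicator {\<sigma> 0<..\<sigma> k} u + indicator {\<sigma> k<..\<sigma> (Suc k)} u :: ennreal)"
      by (auto simp: indicator_def)
    moreover have "f u * indicator {\<sigma> k<..\<sigma> (Suc k)} u = c k * indicator {\<sigma> k<..\<sigma> (Suc k)} u"
      using f[of k u] Suc.prems by (auto simp: indicator_def)
    ultimately show ?case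
      using Suc by (simp add: distrib_left)
  qed simp
  then have eq: "f u * indicator {\<sigma> 0<..\<sigma> m} u = (\<Sum>l<m. c l * indicator {\<sigma> l<..\<sigma> (Suc l)} u)" for u
    by simp
  have "(\<integral>\<^sup>+u\<in>{\<sigma> 0..\<sigma> m}. f u \<partial>lborel) = (\<integral>\<^sup>+u\<in>{\<sigma> 0<..\<sigma> m}. f u \<partial>lborel)"
    using AE_lborel_singleton[of "\<sigma> 0"]
    by (intro nn_integral_cong_AE) (auto elim!: eventually_mono simp: indicator_def)
  also have "\<dots> = (\<Sum>l<m. c l * ennreal (\<sigma> (Suc l) - \<sigma> l))"
    unfolding eq using g
    by (subst nn_integral_sum) (auto simp: nn_integral_cmult_indicator grid_def less_imp_le intro!: sum.cong)
  finally show ?thesis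
    by (simp add: mult.commute)
qed

text \<open>By (x - z)^2 \<le> 2 (x - y)^2 + 2 (y - z)^2, two errors of at most N / 4 add up to at
  most N. Measurability is asked only on \<open>A\<close>, because processes are controlled only on
  a time interval, and the integrals are extended ones because they may be infinite.\<close>

lemma nn_integral_L2_triangle:
  fixes f g h :: "real \<Rightarrow> real"
  assumes "f \<in> borel_measurable (restrict_space borel A)" "g \<in> borel_measurable (restrict_space borel A)"
    "h \<in> borel_measurable (restrict_space borel A)" and A: "A \<in> sets borel"
    and N: "0 \<le> N" "ennreal N < (\<integral>\<^sup>+u\<in>A. ennreal ((f u - h u)\<^sup>2) \<partial>lborel)"
  shows "ennreal (N / 4) < (\<integral>\<^sup>+u\<in>A. ennreal ((f u - g u)\<^sup>2) \<partial>lborel) \<or>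
    ennreal (N / 4) < (\<integral>\<^sup>+u\<in>A. ennreal ((g u - h u)\<^sup>2) \<partial>lborel)"
proof (rule ccontr)
  let ?R = "restrict_space lborel A"
  have s: "A \<inter> space lborel \<in> sets lborel"
    using A by simp
  have [measurable]: "f \<in> borel_measurable ?R" "g \<in> borel_measurable ?R" "h \<in> borel_measurable ?R"
    using assms(1-3) by (simp_all cong: measurable_cong_sets add: sets_restrict_space)
  have sq: "(x - z)\<^sup>2 \<le> 2 * (x - y)\<^sup>2 + 2 * (y - z)\<^sup>2" for x y z :: real
    using sum_squares_bound[of "x - y" "y - z"] by (simp add: power2_eq_square algebra_simps)
  assume "\<not> ?thesis"
  then have le: "(\<integral>\<^sup>+u. ennreal ((f u - g u)\<^sup>2) \<partial>?R) \<le> ennreal (N / 4)"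
      "(\<integral>\<^sup>+u. ennreal ((g u - h u)\<^sup>2) \<partial>?R) \<le> ennreal (N / 4)"
    by (simp_all add: nn_integral_restrict_space[OF s] not_less)
  have "(\<integral>\<^sup>+u. ennreal ((f u - h u)\<^sup>2) \<partial>?R)
      \<le> (\<integral>\<^sup>+u. 2 * ennreal ((f u - g u)\<^sup>2) + 2 * ennreal ((g u - h u)\<^sup>2) \<partial>?R)"
  proof (intro nn_integral_mono)
    fix u
    have "ennreal ((f u - h u)\<^sup>2) \<le> ennreal (2 * (f u - g u)\<^sup>2 + 2 * (g u - h u)\<^sup>2)"
      using sq by (rule ennreal_leI)
    then show "ennreal ((f u - h u)\<^sup>2) \<le> 2 * ennreal ((f u - g u)\<^sup>2) + 2 * ennreal ((g u - h u)\<^sup>2)"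
      by (simp add: ennreal_mult)
  qed
  also have "\<dots> = 2 * (\<integral>\<^sup>+u. ennreal ((f u - g u)\<^sup>2) \<partial>?R) + 2 * (\<integral>\<^sup>+u. ennreal ((g u - h u)\<^sup>2) \<partial>?R)"
    by (subst nn_integral_add) (simp_all add: nn_integral_cmult)
  also have "\<dots> \<le> 2 * ennreal (N / 4) + 2 * ennreal (N / 4)"
    using le by (intro add_mono mult_left_mono) auto
  also have "\<dots> = ennreal (2 * (N / 4) + 2 * (N / 4))"
    using N(1) by (simp only: ennreal_plus ennreal_mult ennreal_numeral[symmetric])
  also have "\<dots> = ennreal N"
    by simp
  finally show False
    using N(2) by (simp add: nn_integral_restrict_space[OF s] not_less)
qed

lemma elementary_processD:
  assumes "elementary_process M F t n \<tau> \<xi>" "i < n"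
  shows "\<tau> i \<le> \<tau> (Suc i)" "\<xi> i \<in> borel_measurable (F (\<tau> i))"
    "\<exists>C. \<forall>\<omega>\<in>space M. \<bar>\<xi> i \<omega>\<bar> \<le> C"
proof -
  have *: "\<forall>i<n. \<tau> i \<le> \<tau> (Suc i) \<and> \<xi> i \<in> borel_measurable (F (\<tau> i)) \<and>
      (\<exists>C. \<forall>\<omega>\<in>space M. \<bar>\<xi> i \<omega>\<bar> \<le> C)"
    using assms(1) unfolding elementary_process_def by (elim conjE)
  note ** = *[rule_format, OF assms(2)]
  show "\<tau> i \<le> \<tau> (Suc i)" "\<xi> i \<in> borel_measurable (F (\<tau> i))"
    "\<exists>C. \<forall>\<omega>\<in>space M. \<bar>\<xi> i \<omega>\<bar> \<le> C"
    by (rule **[THEN conjunct1] **[THEN conjunct2, THEN conjunct1] **[THEN conjunct2, THEN conjunct2])+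
qed

lemma elementary_process_mono:
  assumes "elementary_process M F t n \<tau> \<xi>" "j \<le> n" "i \<le> j"
  shows "\<tau> i \<le> \<tau> j"
  using assms(2,3)
proof (induction j)
  case (Suc j)
  have "\<tau> j \<le> \<tau> (Suc j)"
    using Suc.prems assms(1) by (simp add: elementary_process_def)
  moreover have "i = Suc j \<or> \<tau> i \<le> \<tau> j"
    using Suc by (auto simp: le_Suc_eq)
  ultimately show ?case
    by auto
qed auto

lemma elementary_process_range:
  assumes "elementary_process M F t n \<tau> \<xi>" "i \<le> n"
  shows "0 \<le> \<tau> i" "\<tau> i \<le> t"
  using elementary_process_mono[OF assms, of 0] elementary_process_mono[OF assms(1) order_refl assms(2)]
    assms(1) by (simp_all add: elementary_process_def)

context brownian
begin

text \<open>Capping the partition points at \<open>s\<close> makes a cell beyond \<open>s\<close>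
  contribute nothing and cuts the cell that contains \<open>s\<close>. A single elementary process
  thus yields integrals up to all times, which can be compared simultaneously.\<close>

definition stopped_integral ::
  "nat \<Rightarrow> (nat \<Rightarrow> real) \<Rightarrow> (nat \<Rightarrow> 'a \<Rightarrow> real) \<Rightarrow> real \<Rightarrow> 'a \<Rightarrow> real" where
  "stopped_integral n \<tau> \<xi> s \<omega> = (\<Sum>i<n. \<xi> i \<omega> * (W (min (\<tau> (Suc i)) s) \<omega> - W (min (\<tau> i) s) \<omega>))"

lemma stopped_integral_horizon:
  assumes "elementary_process M F t n \<tau> \<xi>"
  shows "stopped_integral n \<tau> \<xi> t = elementary_integral W n \<tau> \<xi>"
  unfolding stopped_integral_def elementary_integral_def
  using elementary_process_range(2)[OF assms] by (intro ext sum.cong) (auto simp: min_absorb1)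

lemma elementary_process_measurable:
  assumes "elementary_process M F t n \<tau> \<xi>" "i < n"
  shows "\<xi> i \<in> borel_measurable M"
  by (rule measurable_F_M[OF elementary_processD(2)[OF assms]])

lemma stopped_integral_measurable:
  assumes e: "elementary_process M F t n \<tau> \<xi>" and s: "0 \<le> s"
  shows "stopped_integral n \<tau> \<xi> s \<in> borel_measurable M"
  unfolding stopped_integral_def[abs_def]
  using elementary_process_range(1)[OF e] s
  by (intro borel_measurable_sum borel_measurable_times borel_measurable_diff
      elementary_process_measurable[OF e] W_measurable) auto

text \<open>An elementary process is constant on half-open cells, so its value on cell
  \<open>l\<close> is read at the right end \<open>\<sigma> (Suc l)\<close>. It is nevertheless
  known at time \<open>\<sigma> l\<close>: a \<open>\<xi> i\<close> that contributes has
  \<open>\<tau> i < \<sigma> (Suc l)\<close>, and as \<open>\<tau> i\<close> is itself a grid point,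
  \<open>\<tau> i \<le> \<sigma> l\<close>.\<close>

lemma refinement_bounded_adapted:
  assumes e: "elementary_process M F t n \<tau> \<xi>" and g: "grid \<sigma> m"
    and \<sigma>: "\<sigma> m \<le> t" "\<And>i. i \<le> n \<Longrightarrow> \<tau> i \<le> \<sigma> m \<Longrightarrow> \<tau> i \<in> \<sigma> ` {..m}"
  shows "bounded_adapted \<sigma> m (\<lambda>l. elementary_value n \<tau> \<xi> (\<sigma> (Suc l)))"
  unfolding bounded_adapted_def
proof (intro allI impI conjI)
  fix l assume l: "l < m"
  let ?I = "\<lambda>i. indicator {\<tau> i<..\<tau> (Suc i)} (\<sigma> (Suc l)) :: real"
  show "elementary_value n \<tau> \<xi> (\<sigma> (Suc l)) \<in> borel_measurable (F (\<sigma> l))"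
    unfolding elementary_value_def[abs_def]
  proof (rule borel_measurable_sum)
    fix i assume i: "i \<in> {..<n}"
    show "(\<lambda>\<omega>. \<xi> i \<omega> * ?I i) \<in> borel_measurable (F (\<sigma> l))"
    proof (cases "\<tau> i < \<sigma> (Suc l)")
      case True
      have "\<sigma> l < \<sigma> (Suc l)" "\<sigma> (Suc l) \<le> \<sigma> m"
        using l g grid_mono[OF g, of m "Suc l"] by (auto simp: grid_def)
      moreover have "\<tau> i \<le> \<sigma> l"
      proof (rule ccontr)
        assume "\<not> \<tau> i \<le> \<sigma> l"
        \<comment> \<open>Here \<open>u\<close> and \<open>p\<close> of
          \<open>grid_point_less\<close> are both \<open>\<tau> i\<close>, which yields
          \<open>\<tau> i < \<tau> i\<close>.\<close>
        then show False
          using grid_point_less[OF g l, of "\<tau> i" "\<tau> i"] True \<sigma>(2)[of i] i by auto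
      qed
      moreover have "\<xi> i \<in> borel_measurable (F (\<tau> i))"
        using elementary_processD(2)[OF e] i by blast
      ultimately have "\<xi> i \<in> borel_measurable (F (\<sigma> l))"
        using measurable_F_mono[of "\<xi> i" "\<tau> i" "\<sigma> l"] by blast
      then show ?thesis
        by (rule borel_measurable_times[OF _ borel_measurable_const])
    qed simp
  qed
  have "\<forall>i\<in>{..<n}. \<exists>C. \<forall>\<omega>\<in>space M. \<bar>\<xi> i \<omega>\<bar> \<le> C"
    using elementary_processD(3)[OF e] by blast
  then obtain C where C: "\<forall>i\<in>{..<n}. \<forall>\<omega>\<in>space M. \<bar>\<xi> i \<omega>\<bar> \<le> C i"
    using bchoice[of "{..<n}" "\<lambda>i C. \<forall>\<omega>\<in>space M. \<bar>\<xi> i \<omega>\<bar> \<le> C"] by blast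
  have "\<bar>elementary_value n \<tau> \<xi> (\<sigma> (Suc l)) \<omega>\<bar> \<le> (\<Sum>i<n. C i)" if "\<omega> \<in> space M" for \<omega>
    unfolding elementary_value_def
  proof (rule order_trans[OF sum_abs sum_mono])
    fix i assume i: "i \<in> {..<n}"
    have "\<bar>\<xi> i \<omega>\<bar> \<le> C i"
      using C i that by blast
    then show "\<bar>\<xi> i \<omega> * ?I i\<bar> \<le> C i"
      by (auto simp: indicator_def)
  qed
  then show "\<exists>C. \<forall>\<omega>\<in>space M. \<bar>elementary_value n \<tau> \<xi> (\<sigma> (Suc l)) \<omega>\<bar> \<le> C"
    by blast
qed

text \<open>After interchanging the two sums, the coefficient of \<open>\<xi> i\<close> is the sum
  of the increments of \<open>W\<close> over the refined cells between \<open>\<tau> i\<close> and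
  \<open>\<tau> (Suc i)\<close>, cut at \<open>\<sigma> q\<close>. It telescopes to the capped
  increment in \<open>stopped_integral\<close>.\<close>

lemma refinement_integral:
  assumes e: "elementary_process M F t n \<tau> \<xi>" and g: "grid \<sigma> m"
    and \<sigma>: "\<And>i. i \<le> n \<Longrightarrow> \<tau> i \<le> \<sigma> m \<Longrightarrow> \<tau> i \<in> \<sigma> ` {..m}" and q: "q \<le> m"
  shows "elementary_integral W q \<sigma> (\<lambda>l. elementary_value n \<tau> \<xi> (\<sigma> (Suc l))) \<omega>
    = stopped_integral n \<tau> \<xi> (\<sigma> q) \<omega>"
proof -
  have qm: "\<sigma> q \<le> \<sigma> m"
    using q by (intro grid_mono[OF g]) auto
  have ex: "\<exists>a\<le>q. min (\<tau> i) (\<sigma> q) = \<sigma> a" if i: "i \<le> n" for i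
  proof (cases "\<tau> i < \<sigma> q")
    case True
    then obtain a where a: "a \<le> m" "\<tau> i = \<sigma> a"
      using \<sigma>[OF i] qm by force
    then have "a \<le> q"
      using grid_mono[OF g, of a q] True by (cases "a \<le> q") auto
    then show ?thesis
      using a True by (auto simp: min_def)
  qed (auto simp: min_def)
  have tele: "(\<Sum>l<q. indicator {\<tau> i<..\<tau> (Suc i)} (\<sigma> (Suc l)) * (W (\<sigma> (Suc l)) \<omega> - W (\<sigma> l) \<omega>))
      = W (min (\<tau> (Suc i)) (\<sigma> q)) \<omega> - W (min (\<tau> i) (\<sigma> q)) \<omega>" if i: "i < n" for i
  proof -
    obtain a b where a: "a \<le> q" "min (\<tau> i) (\<sigma> q) = \<sigma> a" and b: "b \<le> q" "min (\<tau> (Suc i)) (\<sigma> q) = \<sigma> b"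
      using ex[of i] ex[of "Suc i"] i by auto
    have "\<tau> i \<le> \<tau> (Suc i)"
      using e i by (simp add: elementary_process_def)
    then have "\<sigma> a \<le> \<sigma> b"
      unfolding a(2)[symmetric] b(2)[symmetric] by (rule min.mono) simp
    then have ab: "a \<le> b"
      using grid_strict_mono[OF g, of a b] a(1) q by (cases "a \<le> b") auto
    have ind: "indicator {\<tau> i<..\<tau> (Suc i)} (\<sigma> (Suc l)) = (if l \<in> {a..<b} then 1 else 0 :: real)"
      if l: "l < q" for l
    proof -
      have le: "\<sigma> (Suc l) \<le> \<sigma> q"
        using l q by (intro grid_mono[OF g]) auto
      have "\<tau> i < \<sigma> (Suc l) \<longleftrightarrow> \<sigma> a < \<sigma> (Suc l)"
        unfolding a(2)[symmetric] using le by (auto simp: min_def)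
      also have "\<dots> \<longleftrightarrow> a \<le> l"
        using grid_strict_mono[OF g, of "Suc l" a] grid_mono[OF g, of a "Suc l"] l a(1) q
        by (cases "a \<le> l") auto
      finally have 1: "\<tau> i < \<sigma> (Suc l) \<longleftrightarrow> a \<le> l" .
      have "\<sigma> (Suc l) \<le> \<tau> (Suc i) \<longleftrightarrow> \<sigma> (Suc l) \<le> \<sigma> b"
        unfolding b(2)[symmetric] using le by (auto simp: min_def)
      also have "\<dots> \<longleftrightarrow> l < b"
        using grid_strict_mono[OF g, of "Suc l" b] grid_mono[OF g, of b "Suc l"] l b(1) q
        by (cases "l < b") auto
      finally show ?thesis
        using 1 by (auto simp: indicator_def)
    qed
    have "(\<Sum>l<q. indicator {\<tau> i<..\<tau> (Suc i)} (\<sigma> (Suc l)) * (W (\<sigma> (Suc l)) \<omega> - W (\<sigma> l) \<omega>))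
      = (\<Sum>l<q. if l \<in> {a..<b} then W (\<sigma> (Suc l)) \<omega> - W (\<sigma> l) \<omega> else 0)"
      by (intro sum.cong) (auto simp: ind)
    also have "\<dots> = (\<Sum>l\<in>{..<q} \<inter> {a..<b}. W (\<sigma> (Suc l)) \<omega> - W (\<sigma> l) \<omega>)"
      by (subst sum.inter_restrict) simp_all
    also have "{..<q} \<inter> {a..<b} = {a..<b}"
      using b(1) by auto
    also have "(\<Sum>l\<in>{a..<b}. W (\<sigma> (Suc l)) \<omega> - W (\<sigma> l) \<omega>) = W (\<sigma> b) \<omega> - W (\<sigma> a) \<omega>"
      using sum_Suc_diff'[OF ab, of "\<lambda>l. W (\<sigma> l) \<omega>"] .
    finally show ?thesis
      unfolding a(2) b(2) .
  qed
  have "elementary_integral W q \<sigma> (\<lambda>l. elementary_value n \<tau> \<xi> (\<sigma> (Suc l))) \<omega>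
    = (\<Sum>l<q. \<Sum>i<n. \<xi> i \<omega> * (indicator {\<tau> i<..\<tau> (Suc i)} (\<sigma> (Suc l)) * (W (\<sigma> (Suc l)) \<omega> - W (\<sigma> l) \<omega>)))"
    unfolding elementary_integral_def elementary_value_def
    by (simp only: sum_distrib_right mult.assoc)
  also have "\<dots> = (\<Sum>i<n. \<Sum>l<q. \<xi> i \<omega> * (indicator {\<tau> i<..\<tau> (Suc i)} (\<sigma> (Suc l)) * (W (\<sigma> (Suc l)) \<omega> - W (\<sigma> l) \<omega>)))"
    by (rule sum.swap)
  also have "\<dots> = stopped_integral n \<tau> \<xi> (\<sigma> q) \<omega>"
    unfolding stopped_integral_def by (intro sum.cong refl) (simp only: sum_distrib_left[symmetric] tele lessThan_iff)
  finally show ?thesis .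
qed

lemma refinement_value:
  assumes e: "elementary_process M F t n \<tau> \<xi>" and g: "grid \<sigma> m"
    and \<sigma>: "\<And>i. i \<le> n \<Longrightarrow> \<tau> i \<le> \<sigma> m \<Longrightarrow> \<tau> i \<in> \<sigma> ` {..m}"
    and l: "l < m" and u: "\<sigma> l < u" "u \<le> \<sigma> (Suc l)"
  shows "elementary_value n \<tau> \<xi> u \<omega> = elementary_value n \<tau> \<xi> (\<sigma> (Suc l)) \<omega>"
  unfolding elementary_value_def
proof (rule sum.cong)
  fix i assume "i \<in> {..<n}"
  then have "\<tau> i < u \<longleftrightarrow> \<tau> i < \<sigma> (Suc l)" "\<tau> (Suc i) < u \<longleftrightarrow> \<tau> (Suc i) < \<sigma> (Suc l)"
    using grid_point_less[OF g l u, of "\<tau> i"] grid_point_less[OF g l u, of "\<tau> (Suc i)"] \<sigma> by auto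
  then show "\<xi> i \<omega> * indicator {\<tau> i<..\<tau> (Suc i)} u = \<xi> i \<omega> * indicator {\<tau> i<..\<tau> (Suc i)} (\<sigma> (Suc l))"
    by (auto simp: indicator_def not_less[symmetric])
qed simp

text \<open>The two processes are rewritten on a common refinement that contains both partitions and
  the test times \<open>Q\<close>, where \<open>elementary_lenglart\<close> applies to their
  difference. The bound does not involve the number of test times.\<close>

lemma stopped_integral_lenglart:
  assumes e: "elementary_process M F t n \<tau> \<xi>" and e': "elementary_process M F t' n' \<tau>' \<xi>'"
    and s: "0 \<le> s" "s \<le> t" "s \<le> t'" and Q: "finite Q" "Q \<subseteq> {0..s}" and \<epsilon>: "0 < \<epsilon>" and N: "0 \<le> N"
  shows "prob {\<omega>\<in>space M. \<exists>q\<in>Q. \<epsilon> < \<bar>stopped_integral n \<tau> \<xi> q \<omega> - stopped_integral n' \<tau>' \<xi>' q \<omega>\<bar>}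
    \<le> N / \<epsilon>\<^sup>2 + prob {\<omega>\<in>space M. ennreal N < (\<integral>\<^sup>+u\<in>{0..s}.
        ennreal ((elementary_value n \<tau> \<xi> u \<omega> - elementary_value n' \<tau>' \<xi>' u \<omega>)\<^sup>2) \<partial>lborel)}"
proof -
  define P where "P = {0, s} \<union> Q \<union> {u \<in> \<tau> ` {..n} \<union> \<tau>' ` {..n'}. u \<le> s}"
  have P: "finite P" "P \<subseteq> {0..s}" "0 \<in> P" "s \<in> P"
    using Q s(1) elementary_process_range(1)[OF e] elementary_process_range(1)[OF e']
    unfolding P_def by auto
  obtain \<sigma> m where g: "grid \<sigma> m" and \<sigma>: "\<sigma> 0 = 0" "\<sigma> m = s" "\<sigma> ` {..m} = P"
    using finite_grid[OF P] .
  have r: "\<tau> i \<in> \<sigma> ` {..m}" if "i \<le> n" "\<tau> i \<le> \<sigma> m" for i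
    using that unfolding \<sigma>(3) P_def \<sigma>(2) by auto
  have r': "\<tau>' i \<in> \<sigma> ` {..m}" if "i \<le> n'" "\<tau>' i \<le> \<sigma> m" for i
    using that unfolding \<sigma>(3) P_def \<sigma>(2) by auto
  let ?v = "elementary_value n \<tau> \<xi>" and ?v' = "elementary_value n' \<tau>' \<xi>'"
  let ?\<zeta> = "\<lambda>l \<omega>. ?v (\<sigma> (Suc l)) \<omega> - ?v' (\<sigma> (Suc l)) \<omega>"
  have b: "bounded_adapted \<sigma> m (\<lambda>l. ?v (\<sigma> (Suc l)))" "bounded_adapted \<sigma> m (\<lambda>l. ?v' (\<sigma> (Suc l)))"
    using refinement_bounded_adapted[OF e g _ r] refinement_bounded_adapted[OF e' g _ r'] s \<sigma>(2) by auto
  have ba: "bounded_adapted \<sigma> m ?\<zeta>"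
    unfolding bounded_adapted_def
  proof (intro allI impI conjI)
    fix l assume l: "l < m"
    show "?\<zeta> l \<in> borel_measurable (F (\<sigma> l))"
      using b l unfolding bounded_adapted_def by (intro borel_measurable_diff) auto
    obtain C C' where "\<forall>\<omega>\<in>space M. \<bar>?v (\<sigma> (Suc l)) \<omega>\<bar> \<le> C" "\<forall>\<omega>\<in>space M. \<bar>?v' (\<sigma> (Suc l)) \<omega>\<bar> \<le> C'"
      using b l unfolding bounded_adapted_def by blast
    then have "\<forall>\<omega>\<in>space M. \<bar>?\<zeta> l \<omega>\<bar> \<le> C + C'"
      by (meson abs_triangle_ineq4 add_mono order_trans)
    then show "\<exists>C. \<forall>\<omega>\<in>space M. \<bar>?\<zeta> l \<omega>\<bar> \<le> C" ..
  qed
  have int: "elementary_integral W q \<sigma> ?\<zeta> \<omega>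
      = stopped_integral n \<tau> \<xi> (\<sigma> q) \<omega> - stopped_integral n' \<tau>' \<xi>' (\<sigma> q) \<omega>" if q: "q \<le> m" for q \<omega>
  proof -
    have "elementary_integral W q \<sigma> (\<lambda>l. ?v (\<sigma> (Suc l))) \<omega> = stopped_integral n \<tau> \<xi> (\<sigma> q) \<omega>"
      by (rule refinement_integral[OF e g _ q]) (rule r)
    moreover have "elementary_integral W q \<sigma> (\<lambda>l. ?v' (\<sigma> (Suc l))) \<omega> = stopped_integral n' \<tau>' \<xi>' (\<sigma> q) \<omega>"
      by (rule refinement_integral[OF e' g _ q]) (rule r')
    moreover have "elementary_integral W q \<sigma> ?\<zeta> \<omega> = elementary_integral W q \<sigma> (\<lambda>l. ?v (\<sigma> (Suc l))) \<omega>
        - elementary_integral W q \<sigma> (\<lambda>l. ?v' (\<sigma> (Suc l))) \<omega>"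
      unfolding elementary_integral_def by (simp only: sum_subtractf[symmetric] left_diff_distrib)
    ultimately show ?thesis
      by simp
  qed
  have nn: "(\<integral>\<^sup>+u\<in>{0..s}. ennreal ((?v u \<omega> - ?v' u \<omega>)\<^sup>2) \<partial>lborel)
      = ennreal (\<Sum>l<m. (\<sigma> (Suc l) - \<sigma> l) * (?\<zeta> l \<omega>)\<^sup>2)" for \<omega>
  proof -
    have "(\<integral>\<^sup>+u\<in>{\<sigma> 0..\<sigma> m}. ennreal ((?v u \<omega> - ?v' u \<omega>)\<^sup>2) \<partial>lborel)
        = (\<Sum>l<m. ennreal (\<sigma> (Suc l) - \<sigma> l) * ennreal ((?\<zeta> l \<omega>)\<^sup>2))"
    proof (rule nn_integral_grid[OF g])
      fix l u assume l: "l < m" "\<sigma> l < u" "u \<le> \<sigma> (Suc l)"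
      have "?v u \<omega> = ?v (\<sigma> (Suc l)) \<omega>"
        by (rule refinement_value[OF e g _ l]) (rule r)
      moreover have "?v' u \<omega> = ?v' (\<sigma> (Suc l)) \<omega>"
        by (rule refinement_value[OF e' g _ l]) (rule r')
      ultimately show "ennreal ((?v u \<omega> - ?v' u \<omega>)\<^sup>2) = ennreal ((?\<zeta> l \<omega>)\<^sup>2)"
        by simp
    qed
    also have "\<dots> = ennreal (\<Sum>l<m. (\<sigma> (Suc l) - \<sigma> l) * (?\<zeta> l \<omega>)\<^sup>2)"
      using g by (subst sum_ennreal[symmetric]) (auto simp: grid_def less_imp_le ennreal_mult intro!: sum.cong)
    finally show ?thesis
      by (simp add: \<sigma>)
  qed
  have less: "ennreal N < ennreal x \<longleftrightarrow> N < x" for x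
    using N by (rule ennreal_less_iff)
  have mS: "elementary_integral W q \<sigma> ?\<zeta> \<in> borel_measurable M" if "q \<le> m" for q
    using measurable_F_M[OF elementary_integral_measurable_F[OF g ba that]] .
  have "prob {\<omega>\<in>space M. \<exists>q\<in>Q. \<epsilon> < \<bar>stopped_integral n \<tau> \<xi> q \<omega> - stopped_integral n' \<tau>' \<xi>' q \<omega>\<bar>}
      \<le> prob {\<omega>\<in>space M. \<exists>q\<in>{..m}. \<epsilon> < \<bar>elementary_integral W q \<sigma> ?\<zeta> \<omega>\<bar>}"
  proof (rule finite_measure_mono)
    show "{\<omega>\<in>space M. \<exists>q\<in>Q. \<epsilon> < \<bar>stopped_integral n \<tau> \<xi> q \<omega> - stopped_integral n' \<tau>' \<xi>' q \<omega>\<bar>}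
      \<subseteq> {\<omega>\<in>space M. \<exists>q\<in>{..m}. \<epsilon> < \<bar>elementary_integral W q \<sigma> ?\<zeta> \<omega>\<bar>}"
    proof (rule Collect_mono, intro impI, elim conjE bexE)
      fix \<omega> q assume \<omega>: "\<omega> \<in> space M" "q \<in> Q"
        "\<epsilon> < \<bar>stopped_integral n \<tau> \<xi> q \<omega> - stopped_integral n' \<tau>' \<xi>' q \<omega>\<bar>"
      have "q \<in> \<sigma> ` {..m}"
        using \<omega>(2) unfolding \<sigma>(3) P_def by blast
      then obtain j where "j \<le> m" "q = \<sigma> j"
        by blast
      then have "\<exists>q\<in>{..m}. \<epsilon> < \<bar>elementary_integral W q \<sigma> ?\<zeta> \<omega>\<bar>"
        using int[of j \<omega>] \<omega>(3) by (intro bexI[of _ j]) simp_all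
      then show "\<omega> \<in> space M \<and> (\<exists>q\<in>{..m}. \<epsilon> < \<bar>elementary_integral W q \<sigma> ?\<zeta> \<omega>\<bar>)"
        using \<omega>(1) by blast
    qed
    show "{\<omega>\<in>space M. \<exists>q\<in>{..m}. \<epsilon> < \<bar>elementary_integral W q \<sigma> ?\<zeta> \<omega>\<bar>} \<in> events"
      using mS by (intro sets.sets_Collect_finite_Ex) auto
  qed
  also have "\<dots> \<le> N / \<epsilon>\<^sup>2 + prob {\<omega>\<in>space M. N < (\<Sum>l<m. (\<sigma> (Suc l) - \<sigma> l) * (?\<zeta> l \<omega>)\<^sup>2)}"
    by (rule elementary_lenglart[OF g ba \<epsilon> N])
  finally show ?thesis
    unfolding nn less .
qed

end

section \<open>Approximation of the It\^o integral\<close>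

context brownian
begin

text \<open>Joint measurability is what Tonelli's theorem needs to make \<open>L2_error\<close> a
  random variable. The time variable is restricted because progressive measurability controls a
  process only up to its horizon.\<close>

definition jointly_measurable :: "real \<Rightarrow> (real \<Rightarrow> 'a \<Rightarrow> real) \<Rightarrow> bool" where
  "jointly_measurable s v \<longleftrightarrow> (\<lambda>(u, \<omega>). v u \<omega>) \<in> borel_measurable (restrict_space borel {0..s} \<Otimes>\<^sub>M M)"

definition L2_error :: "real \<Rightarrow> (real \<Rightarrow> 'a \<Rightarrow> real) \<Rightarrow> (real \<Rightarrow> 'a \<Rightarrow> real) \<Rightarrow> 'a \<Rightarrow> ennreal" where
  "L2_error s v w \<omega> = (\<integral>\<^sup>+u\<in>{0..s}. ennreal ((v u \<omega> - w u \<omega>)\<^sup>2) \<partial>lborel)"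

lemma progressively_jointly_measurable:
  assumes "progressively_measurable F t H" "s \<in> {0..t}"
  shows "jointly_measurable s H"
proof -
  let ?R = "restrict_space borel {0..s} :: real measure"
  have id: "(\<lambda>\<omega>. \<omega>) \<in> measurable M (F s)"
    by (rule measurable_from_subalg[OF subalg measurable_ident[unfolded id_def]])
  have "(\<lambda>x. (fst x, snd x)) \<in> measurable (?R \<Otimes>\<^sub>M M) (?R \<Otimes>\<^sub>M F s)"
    by (intro measurable_Pair measurable_fst measurable_compose[OF measurable_snd id])
  moreover have "(\<lambda>(u, \<omega>). H u \<omega>) \<in> borel_measurable (?R \<Otimes>\<^sub>M F s)"
    using assms unfolding progressively_measurable_def by blast
  ultimately have "(\<lambda>x. (\<lambda>(u, \<omega>). H u \<omega>) (fst x, snd x)) \<in> borel_measurable (?R \<Otimes>\<^sub>M M)"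
    by (rule measurable_compose)
  then show ?thesis
    by (simp add: jointly_measurable_def)
qed

lemma elementary_jointly_measurable:
  assumes "elementary_process M F t n \<tau> \<xi>"
  shows "jointly_measurable s (elementary_value n \<tau> \<xi>)"
proof -
  let ?R = "restrict_space borel {0..s} :: real measure"
  have "(\<lambda>x. \<Sum>i<n. \<xi> i (snd x) * indicator {\<tau> i<..\<tau> (Suc i)} (fst x)) \<in> borel_measurable (?R \<Otimes>\<^sub>M M)"
  proof (intro borel_measurable_sum borel_measurable_times)
    fix i assume "i \<in> {..<n}"
    then have "\<xi> i \<in> borel_measurable M"
      using elementary_process_measurable[OF assms] by simp
    then show "(\<lambda>x. \<xi> i (snd x)) \<in> borel_measurable (?R \<Otimes>\<^sub>M M)"
      by (rule measurable_compose[OF measurable_snd])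
    have "(indicator {\<tau> i<..\<tau> (Suc i)} :: real \<Rightarrow> real) \<in> borel_measurable ?R"
      by (intro measurable_restrict_space1) simp
    then show "(\<lambda>x. indicator {\<tau> i<..\<tau> (Suc i)} (fst x) :: real) \<in> borel_measurable (?R \<Otimes>\<^sub>M M)"
      by (rule measurable_compose[OF measurable_fst])
  qed
  then show ?thesis
    by (simp add: jointly_measurable_def elementary_value_def split_beta')
qed

lemma jointly_measurable_section:
  assumes "jointly_measurable s v" "\<omega> \<in> space M"
  shows "(\<lambda>u. v u \<omega>) \<in> borel_measurable (restrict_space borel {0..s})"
  using measurable_compose[OF measurable_Pair2'[OF assms(2)] assms(1)[unfolded jointly_measurable_def]]
  by simp

lemma L2_error_measurable:
  assumes v: "jointly_measurable s v" and w: "jointly_measurable s w"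
  shows "L2_error s v w \<in> borel_measurable M"
proof -
  let ?R = "restrict_space lborel {0..s} :: real measure"
  have R: "sets (?R \<Otimes>\<^sub>M M) = sets (restrict_space borel {0..s} \<Otimes>\<^sub>M M)"
    by (intro sets_pair_measure_cong refl) (simp add: sets_restrict_space)
  have [measurable]: "(\<lambda>x. v (fst x) (snd x)) \<in> borel_measurable (?R \<Otimes>\<^sub>M M)"
      "(\<lambda>x. w (fst x) (snd x)) \<in> borel_measurable (?R \<Otimes>\<^sub>M M)"
    using v w unfolding jointly_measurable_def measurable_cong_sets[OF R refl] by (simp_all add: split_beta')
  interpret R: sigma_finite_measure ?R
    by (intro sigma_finite_measure_restrict_space sigma_finite_lborel) simp
  have "(\<lambda>x. ennreal ((v (fst x) (snd x) - w (fst x) (snd x))\<^sup>2)) \<in> borel_measurable (?R \<Otimes>\<^sub>M M)"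
    by measurable
  then have "(\<lambda>(\<omega>, u). ennreal ((v u \<omega> - w u \<omega>)\<^sup>2)) \<in> borel_measurable (M \<Otimes>\<^sub>M ?R)"
    by (rule measurable_compose[OF measurable_pair_swap', THEN iffD1[OF measurable_cong, rotated]])
      (auto simp: split_beta')
  then have "(\<lambda>\<omega>. \<integral>\<^sup>+u. ennreal ((v u \<omega> - w u \<omega>)\<^sup>2) \<partial>?R) \<in> borel_measurable M"
    by (rule R.borel_measurable_nn_integral)
  then show ?thesis
    by (simp add: L2_error_def[abs_def] nn_integral_restrict_space)
qed

lemma L2_error_commute: "L2_error s v w \<omega> = L2_error s w v \<omega>"
  by (simp add: L2_error_def power2_commute)

lemma L2_error_mono: "s \<le> t \<Longrightarrow> L2_error s v w \<omega> \<le> L2_error t v w \<omega>"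
  unfolding L2_error_def by (intro nn_integral_mono) (auto simp: indicator_def)

lemma prob_L2_triangle:
  assumes v: "jointly_measurable s v" and w: "jointly_measurable s w" and H: "jointly_measurable s H" and N: "0 \<le> N"
  shows "prob {\<omega>\<in>space M. ennreal N < L2_error s v w \<omega>}
    \<le> prob {\<omega>\<in>space M. ennreal (N / 4) < L2_error s v H \<omega>} + prob {\<omega>\<in>space M. ennreal (N / 4) < L2_error s H w \<omega>}"
proof -
  note [measurable] = L2_error_measurable[OF v H] L2_error_measurable[OF H w]
  have "prob {\<omega>\<in>space M. ennreal N < L2_error s v w \<omega>}
    \<le> prob ({\<omega>\<in>space M. ennreal (N / 4) < L2_error s v H \<omega>} \<union> {\<omega>\<in>space M. ennreal (N / 4) < L2_error s H w \<omega>})"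
  proof (rule finite_measure_mono)
    show "{\<omega>\<in>space M. ennreal N < L2_error s v w \<omega>} \<subseteq>
      {\<omega>\<in>space M. ennreal (N / 4) < L2_error s v H \<omega>} \<union> {\<omega>\<in>space M. ennreal (N / 4) < L2_error s H w \<omega>}"
    proof
      fix \<omega> assume "\<omega> \<in> {\<omega>\<in>space M. ennreal N < L2_error s v w \<omega>}"
      then have \<omega>: "\<omega> \<in> space M" "ennreal N < L2_error s v w \<omega>"
        by auto
      show "\<omega> \<in> {\<omega>\<in>space M. ennreal (N / 4) < L2_error s v H \<omega>} \<union> {\<omega>\<in>space M. ennreal (N / 4) < L2_error s H w \<omega>}"
        using nn_integral_L2_triangle[OF jointly_measurable_section[OF v \<omega>(1)]
          jointly_measurable_section[OF H \<omega>(1)] jointly_measurable_section[OF w \<omega>(1)] _ N \<omega>(2)[unfolded L2_error_def]] \<omega>(1)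
        unfolding L2_error_def by auto
    qed
  qed measurable
  also have "\<dots> \<le> prob {\<omega>\<in>space M. ennreal (N / 4) < L2_error s v H \<omega>} + prob {\<omega>\<in>space M. ennreal (N / 4) < L2_error s H w \<omega>}"
    by (intro measure_Un_le) measurable
  finally show ?thesis .
qed

lemma prob_sum_le:
  fixes X Y :: "'b \<Rightarrow> 'a \<Rightarrow> real"
  assumes Q: "finite Q" and X: "\<And>q. q \<in> Q \<Longrightarrow> X q \<in> borel_measurable M" and Y: "\<And>q. q \<in> Q \<Longrightarrow> Y q \<in> borel_measurable M"
    and Z: "\<And>q \<omega>. q \<in> Q \<Longrightarrow> \<omega> \<in> space M \<Longrightarrow> \<bar>Z q \<omega>\<bar> \<le> \<bar>X q \<omega>\<bar> + \<bar>Y q \<omega>\<bar>"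
  shows "prob {\<omega>\<in>space M. \<exists>q\<in>Q. \<delta> + \<epsilon> < \<bar>Z q \<omega>\<bar>}
    \<le> prob {\<omega>\<in>space M. \<exists>q\<in>Q. \<delta> < \<bar>X q \<omega>\<bar>} + prob {\<omega>\<in>space M. \<exists>q\<in>Q. \<epsilon> < \<bar>Y q \<omega>\<bar>}"
proof -
  have m: "{\<omega>\<in>space M. \<exists>q\<in>Q. \<delta> < \<bar>X q \<omega>\<bar>} \<in> events" "{\<omega>\<in>space M. \<exists>q\<in>Q. \<epsilon> < \<bar>Y q \<omega>\<bar>} \<in> events"
    using X Y by (intro sets.sets_Collect_finite_Ex[OF _ Q]; measurable)+
  have "prob {\<omega>\<in>space M. \<exists>q\<in>Q. \<delta> + \<epsilon> < \<bar>Z q \<omega>\<bar>}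
    \<le> prob ({\<omega>\<in>space M. \<exists>q\<in>Q. \<delta> < \<bar>X q \<omega>\<bar>} \<union> {\<omega>\<in>space M. \<exists>q\<in>Q. \<epsilon> < \<bar>Y q \<omega>\<bar>})"
  proof (rule finite_measure_mono)
    show "{\<omega>\<in>space M. \<exists>q\<in>Q. \<delta> + \<epsilon> < \<bar>Z q \<omega>\<bar>} \<subseteq>
      {\<omega>\<in>space M. \<exists>q\<in>Q. \<delta> < \<bar>X q \<omega>\<bar>} \<union> {\<omega>\<in>space M. \<exists>q\<in>Q. \<epsilon> < \<bar>Y q \<omega>\<bar>}"
    proof
      fix \<omega> assume "\<omega> \<in> {\<omega>\<in>space M. \<exists>q\<in>Q. \<delta> + \<epsilon> < \<bar>Z q \<omega>\<bar>}"
      then obtain q where q: "q \<in> Q" "\<omega> \<in> space M" "\<delta> + \<epsilon> < \<bar>Z q \<omega>\<bar>"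
        by blast
      then have "\<delta> < \<bar>X q \<omega>\<bar> \<or> \<epsilon> < \<bar>Y q \<omega>\<bar>"
        using Z[OF q(1,2)] by linarith
      then show "\<omega> \<in> {\<omega>\<in>space M. \<exists>q\<in>Q. \<delta> < \<bar>X q \<omega>\<bar>} \<union> {\<omega>\<in>space M. \<exists>q\<in>Q. \<epsilon> < \<bar>Y q \<omega>\<bar>}"
        using q by blast
    qed
  qed (use m in \<open>rule sets.Un\<close>)
  also have "\<dots> \<le> prob {\<omega>\<in>space M. \<exists>q\<in>Q. \<delta> < \<bar>X q \<omega>\<bar>} + prob {\<omega>\<in>space M. \<exists>q\<in>Q. \<epsilon> < \<bar>Y q \<omega>\<bar>}"
    using m by (rule measure_Un_le)
  finally show ?thesis .
qed

text \<open>This is the part of \<open>ito_integral\<close> that concerns the integrand alone.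
  Separated from the value of the integral, one sequence with horizon \<open>t\<close> can serve all
  earlier times as well.\<close>

definition approximants ::
  "(real \<Rightarrow> 'a \<Rightarrow> real) \<Rightarrow> real \<Rightarrow> (nat \<Rightarrow> nat) \<Rightarrow> (nat \<Rightarrow> nat \<Rightarrow> real) \<Rightarrow> (nat \<Rightarrow> nat \<Rightarrow> 'a \<Rightarrow> real) \<Rightarrow> bool" where
  "approximants H t n \<tau> \<xi> \<longleftrightarrow> (\<forall>k. elementary_process M F t (n k) (\<tau> k) (\<xi> k)) \<and>
     (\<forall>\<epsilon>>0. (\<lambda>k. prob {\<omega>\<in>space M. ennreal \<epsilon> < L2_error t (elementary_value (n k) (\<tau> k) (\<xi> k)) H \<omega>}) \<longlonglongrightarrow> 0)"

lemma ito_integralE: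
  assumes "ito_integral M F W H t I"
  obtains n \<tau> \<xi> where "approximants H t n \<tau> \<xi>" "I \<in> borel_measurable M" "progressively_measurable F t H"
    "\<forall>\<epsilon>>0. (\<lambda>k. prob {\<omega>\<in>space M. \<epsilon> < \<bar>stopped_integral (n k) (\<tau> k) (\<xi> k) t \<omega> - I \<omega>\<bar>}) \<longlonglongrightarrow> 0"
proof -
  from assms obtain n \<tau> \<xi> where *: "progressively_measurable F t H" "I \<in> borel_measurable M"
    "\<forall>k. elementary_process M F t (n k) (\<tau> k) (\<xi> k)"
    "\<forall>\<epsilon>>0. (\<lambda>k. prob {\<omega>\<in>space M. ennreal \<epsilon> < L2_error t (elementary_value (n k) (\<tau> k) (\<xi> k)) H \<omega>}) \<longlonglongrightarrow> 0"
    "\<forall>\<epsilon>>0. (\<lambda>k. prob {\<omega>\<in>space M. \<epsilon> < \<bar>elementary_integral W (n k) (\<tau> k) (\<xi> k) \<omega> - I \<omega>\<bar>}) \<longlonglongrightarrow> 0"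
    unfolding ito_integral_def L2_error_def by (elim conjE exE)
  show ?thesis
  proof (rule that[of n \<tau> \<xi>])
    show "approximants H t n \<tau> \<xi>"
      using *(3,4) unfolding approximants_def by blast
    have eq: "stopped_integral (n k) (\<tau> k) (\<xi> k) t = elementary_integral W (n k) (\<tau> k) (\<xi> k)" for k
      using *(3) stopped_integral_horizon by blast
    show "\<forall>\<epsilon>>0. (\<lambda>k. prob {\<omega>\<in>space M. \<epsilon> < \<bar>stopped_integral (n k) (\<tau> k) (\<xi> k) t \<omega> - I \<omega>\<bar>}) \<longlonglongrightarrow> 0"
      using *(5) unfolding eq .
  qed (use * in auto)
qed

text \<open>\<open>ito_integral\<close> at time \<open>s\<close> comes with an approximating
  sequence of its own. Both that sequence and the one with horizon \<open>t\<close> are close to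
  \<open>H\<close> in L2 on [0, s], hence close to each other, and by Lenglart's inequality their
  integrals up to \<open>s\<close> have the same limit in probability.\<close>

lemma approximants_stopped_tendsto:
  assumes A: "approximants H t n \<tau> \<xi>" and H: "progressively_measurable F t H" and I: "ito_integral M F W H s I" and s: "0 \<le> s" "s \<le> t" and \<epsilon>: "0 < \<epsilon>"
  shows "(\<lambda>k. prob {\<omega>\<in>space M. \<epsilon> < \<bar>stopped_integral (n k) (\<tau> k) (\<xi> k) s \<omega> - I \<omega>\<bar>}) \<longlonglongrightarrow> 0"
proof (rule tendsto_zero_if_le)
  obtain n' \<tau>' \<xi>' where A': "approximants H s n' \<tau>' \<xi>'" and Im: "I \<in> borel_measurable M"
    and "progressively_measurable F s H" and lim:
      "\<forall>\<epsilon>>0. (\<lambda>k. prob {\<omega>\<in>space M. \<epsilon> < \<bar>stopped_integral (n' k) (\<tau>' k) (\<xi>' k) s \<omega> - I \<omega>\<bar>}) \<longlonglongrightarrow> 0"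
    by (rule ito_integralE[OF I])
  have jm: "jointly_measurable s H" "jointly_measurable t H"
    using progressively_jointly_measurable[OF H] s by simp_all
  let ?v = "\<lambda>k. elementary_value (n k) (\<tau> k) (\<xi> k)" and ?v' = "\<lambda>k. elementary_value (n' k) (\<tau>' k) (\<xi>' k)"
  let ?S = "\<lambda>k. stopped_integral (n k) (\<tau> k) (\<xi> k)" and ?S' = "\<lambda>k. stopped_integral (n' k) (\<tau>' k) (\<xi>' k)"
  have e: "elementary_process M F t (n k) (\<tau> k) (\<xi> k)" "elementary_process M F s (n' k) (\<tau>' k) (\<xi>' k)" for k
    using A A' by (auto simp: approximants_def)
  fix \<delta> :: real assume \<delta>: "0 < \<delta>"
  \<comment> \<open>With this choice the first term of Lenglart's bound at level
    \<open>\<epsilon> / 2\<close> equals \<open>\<delta>\<close>; the second tends to 0 for any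
    fixed \<open>N\<close>.\<close>
  define N where "N = \<delta> * (\<epsilon> / 2)\<^sup>2"
  have N: "0 < N" "N / (\<epsilon> / 2)\<^sup>2 = \<delta>"
    using \<delta> \<epsilon> by (auto simp: N_def)
  define g where "g k = prob {\<omega>\<in>space M. ennreal (N / 4) < L2_error t (?v k) H \<omega>}
     + prob {\<omega>\<in>space M. ennreal (N / 4) < L2_error s (?v' k) H \<omega>}
     + prob {\<omega>\<in>space M. \<epsilon> / 2 < \<bar>?S' k s \<omega> - I \<omega>\<bar>}" for k
  have "g \<longlonglongrightarrow> 0 + 0 + 0"
    unfolding g_def 
  proof (intro tendsto_add)
    show "(\<lambda>k. prob {\<omega>\<in>space M. ennreal (N / 4) < L2_error t (?v k) H \<omega>}) \<longlonglongrightarrow> 0"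
      using A N(1) unfolding approximants_def by simp
    show "(\<lambda>k. prob {\<omega>\<in>space M. ennreal (N / 4) < L2_error s (?v' k) H \<omega>}) \<longlonglongrightarrow> 0"
      using A' N(1) unfolding approximants_def by simp
    show "(\<lambda>k. prob {\<omega>\<in>space M. \<epsilon> / 2 < \<bar>?S' k s \<omega> - I \<omega>\<bar>}) \<longlonglongrightarrow> 0"
      using lim[rule_format, of "\<epsilon> / 2"] \<epsilon> by (simp only: half_gt_zero)
  qed
  moreover have "prob {\<omega>\<in>space M. \<epsilon> < \<bar>?S k s \<omega> - I \<omega>\<bar>} \<le> \<delta> + g k" for k
  proof -
    note m = elementary_jointly_measurable[OF e(1)] elementary_jointly_measurable[OF e(2)]
    have "prob {\<omega>\<in>space M. \<exists>q\<in>{s}. \<epsilon> / 2 + \<epsilon> / 2 < \<bar>?S k q \<omega> - I \<omega>\<bar>}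
      \<le> prob {\<omega>\<in>space M. \<exists>q\<in>{s}. \<epsilon> / 2 < \<bar>?S k q \<omega> - ?S' k q \<omega>\<bar>}
        + prob {\<omega>\<in>space M. \<exists>q\<in>{s}. \<epsilon> / 2 < \<bar>?S' k q \<omega> - I \<omega>\<bar>}"
      using s stopped_integral_measurable[OF e(1)] stopped_integral_measurable[OF e(2)] Im
      by (intro prob_sum_le borel_measurable_diff) auto
    also have "prob {\<omega>\<in>space M. \<exists>q\<in>{s}. \<epsilon> / 2 < \<bar>?S k q \<omega> - ?S' k q \<omega>\<bar>}
       \<le> N / (\<epsilon> / 2)\<^sup>2 + prob {\<omega>\<in>space M. ennreal N < L2_error s (?v k) (?v' k) \<omega>}"
      unfolding L2_error_def
      using s \<epsilon> N(1) by (intro stopped_integral_lenglart[OF e(1) e(2)]) auto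
    also have "prob {\<omega>\<in>space M. ennreal N < L2_error s (?v k) (?v' k) \<omega>}
       \<le> prob {\<omega>\<in>space M. ennreal (N / 4) < L2_error s (?v k) H \<omega>} + prob {\<omega>\<in>space M. ennreal (N / 4) < L2_error s H (?v' k) \<omega>}"
      using N(1) by (intro prob_L2_triangle m jm(1)) simp
    also have "prob {\<omega>\<in>space M. ennreal (N / 4) < L2_error s (?v k) H \<omega>} \<le> prob {\<omega>\<in>space M. ennreal (N / 4) < L2_error t (?v k) H \<omega>}"
    proof (rule finite_measure_mono)
      show "{\<omega>\<in>space M. ennreal (N / 4) < L2_error s (?v k) H \<omega>} \<subseteq> {\<omega>\<in>space M. ennreal (N / 4) < L2_error t (?v k) H \<omega>}"
        using L2_error_mono[OF s(2)] by (blast intro: less_le_trans)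
      show "{\<omega>\<in>space M. ennreal (N / 4) < L2_error t (?v k) H \<omega>} \<in> events"
        using L2_error_measurable[OF elementary_jointly_measurable[OF e(1)] jm(2)] by measurable
    qed
    finally show ?thesis
      by (simp add: g_def N(2) L2_error_commute[of s H])
  qed
  ultimately show "\<exists>g. g \<longlonglongrightarrow> 0 \<and> (\<forall>\<^sub>F k in sequentially. prob {\<omega>\<in>space M. \<epsilon> < \<bar>?S k s \<omega> - I \<omega>\<bar>} \<le> \<delta> + g k)"
    by (intro exI[of _ g]) (simp add: always_eventually)
qed simp

text \<open>Lenglart's inequality compares the k-th approximant of \<open>H\<close> with the given
  elementary process, and then k tends to infinity. The union bound over \<open>Q\<close> is applied
  only to the approximants, where \<open>Q\<close> is fixed while k grows; the resulting bound is
  independent of the size of \<open>Q\<close>.\<close>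

lemma ito_integral_comparison:
  assumes J: "\<And>q. q \<in> Q \<Longrightarrow> ito_integral M F W H q (J q)" and I: "ito_integral M F W H t I"
    and Q: "finite Q" "Q \<subseteq> {0..t}" and t: "0 \<le> t" and e: "elementary_process M F t n \<tau> \<xi>"
    and \<epsilon>: "0 < \<epsilon>" and N: "0 < N"
  shows "prob {\<omega>\<in>space M. \<exists>q\<in>Q. \<epsilon> + \<epsilon> < \<bar>J q \<omega> - stopped_integral n \<tau> \<xi> q \<omega>\<bar>}
    \<le> N / \<epsilon>\<^sup>2 + prob {\<omega>\<in>space M. ennreal (N / 4) < L2_error t H (elementary_value n \<tau> \<xi>) \<omega>}"
proof -
  obtain n' \<tau>' \<xi>' where A: "approximants H t n' \<tau>' \<xi>'" and "I \<in> borel_measurable M"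
    and pm: "progressively_measurable F t H" and
      "\<forall>\<epsilon>>0. (\<lambda>k. prob {\<omega>\<in>space M. \<epsilon> < \<bar>stopped_integral (n' k) (\<tau>' k) (\<xi>' k) t \<omega> - I \<omega>\<bar>}) \<longlonglongrightarrow> 0"
    by (rule ito_integralE[OF I])
  let ?v = "\<lambda>k. elementary_value (n' k) (\<tau>' k) (\<xi>' k)" and ?S = "\<lambda>k. stopped_integral (n' k) (\<tau>' k) (\<xi>' k)"
  have e': "elementary_process M F t (n' k) (\<tau>' k) (\<xi>' k)" for k
    using A unfolding approximants_def by blast
  have jm: "jointly_measurable t H"
    using progressively_jointly_measurable[OF pm, of t] t by simp
  have Jm: "J q \<in> borel_measurable M" if "q \<in> Q" for q
    using J[OF that] unfolding ito_integral_def by blast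
  have Sm: "?S k q \<in> borel_measurable M" if "q \<in> Q" for q k
    using Q(2) that by (intro stopped_integral_measurable[OF e']) auto
  define p where "p = prob {\<omega>\<in>space M. \<exists>q\<in>Q. \<epsilon> + \<epsilon> < \<bar>J q \<omega> - stopped_integral n \<tau> \<xi> q \<omega>\<bar>}"
  define c where "c = N / \<epsilon>\<^sup>2 + prob {\<omega>\<in>space M. ennreal (N / 4) < L2_error t H (elementary_value n \<tau> \<xi>) \<omega>}"
  define g where "g k = (\<Sum>q\<in>Q. prob {\<omega>\<in>space M. \<epsilon> < \<bar>?S k q \<omega> - J q \<omega>\<bar>})
     + prob {\<omega>\<in>space M. ennreal (N / 4) < L2_error t (?v k) H \<omega>}" for k
  have "g \<longlonglongrightarrow> (\<Sum>q\<in>Q. 0) + 0"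
    unfolding g_def
  proof (intro tendsto_add tendsto_sum)
    show "(\<lambda>k. prob {\<omega>\<in>space M. ennreal (N / 4) < L2_error t (?v k) H \<omega>}) \<longlonglongrightarrow> 0"
      using A N unfolding approximants_def by simp
    fix q assume "q \<in> Q"
    then show "(\<lambda>k. prob {\<omega>\<in>space M. \<epsilon> < \<bar>?S k q \<omega> - J q \<omega>\<bar>}) \<longlonglongrightarrow> 0"
      using Q(2) J by (intro approximants_stopped_tendsto[OF A pm _ _ _ \<epsilon>]) auto
  qed
  then have "(\<lambda>k. c + g k) \<longlonglongrightarrow> c + 0"
    by (intro tendsto_add tendsto_const) simp
  moreover have "p \<le> c + g k" for k
  proof -
    have h1: "p \<le> prob {\<omega>\<in>space M. \<exists>q\<in>Q. \<epsilon> < \<bar>J q \<omega> - ?S k q \<omega>\<bar>}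
        + prob {\<omega>\<in>space M. \<exists>q\<in>Q. \<epsilon> < \<bar>?S k q \<omega> - stopped_integral n \<tau> \<xi> q \<omega>\<bar>}"
      unfolding p_def using Jm Sm stopped_integral_measurable[OF e] Q(2)
      by (intro prob_sum_le[OF Q(1)] borel_measurable_diff) auto
    have h2: "prob {\<omega>\<in>space M. \<exists>q\<in>Q. \<epsilon> < \<bar>?S k q \<omega> - stopped_integral n \<tau> \<xi> q \<omega>\<bar>}
       \<le> N / \<epsilon>\<^sup>2 + prob {\<omega>\<in>space M. ennreal N < L2_error t (?v k) (elementary_value n \<tau> \<xi>) \<omega>}"
      unfolding L2_error_def
      using t N by (intro stopped_integral_lenglart[OF e' e _ _ _ Q \<epsilon>]) auto
    have h3: "prob {\<omega>\<in>space M. ennreal N < L2_error t (?v k) (elementary_value n \<tau> \<xi>) \<omega>}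
       \<le> prob {\<omega>\<in>space M. ennreal (N / 4) < L2_error t (?v k) H \<omega>}
        + prob {\<omega>\<in>space M. ennreal (N / 4) < L2_error t H (elementary_value n \<tau> \<xi>) \<omega>}"
      using N by (intro prob_L2_triangle elementary_jointly_measurable[OF e'] elementary_jointly_measurable[OF e] jm) simp
    have h4: "prob {\<omega>\<in>space M. \<exists>q\<in>Q. \<epsilon> < \<bar>J q \<omega> - ?S k q \<omega>\<bar>}
      \<le> (\<Sum>q\<in>Q. prob {\<omega>\<in>space M. \<epsilon> < \<bar>J q \<omega> - ?S k q \<omega>\<bar>})"
    proof -
      have "{\<omega>\<in>space M. \<exists>q\<in>Q. \<epsilon> < \<bar>J q \<omega> - ?S k q \<omega>\<bar>} = (\<Union>q\<in>Q. {\<omega>\<in>space M. \<epsilon> < \<bar>J q \<omega> - ?S k q \<omega>\<bar>})"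
        by blast
      also have "prob \<dots> \<le> (\<Sum>q\<in>Q. prob {\<omega>\<in>space M. \<epsilon> < \<bar>J q \<omega> - ?S k q \<omega>\<bar>})"
      proof (rule finite_measure_subadditive_finite[OF Q(1)], rule image_subsetI)
        fix q assume "q \<in> Q"
        note [measurable] = Jm[OF this] Sm[OF this]
        show "{\<omega>\<in>space M. \<epsilon> < \<bar>J q \<omega> - ?S k q \<omega>\<bar>} \<in> events"
          by measurable
      qed
      finally show ?thesis .
    qed
    show ?thesis
      using h1 h2 h3 h4 unfolding c_def g_def abs_minus_commute[of "J _ _"] by linarith
  qed
  ultimately have "p \<le> c"
    using LIMSEQ_le_const[of "\<lambda>k. c + g k" c p] by simp
  then show ?thesis
    unfolding p_def c_def .
qed

text \<open>Dominated convergence for the indicators of the events. It turns path by path statements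
  about the grid into convergence in probability.\<close>

lemma prob_tendsto_zero:
  assumes A: "\<And>n. A n \<in> events" and lim: "AE \<omega> in M. \<forall>\<^sub>F n in sequentially. \<omega> \<notin> A n"
  shows "(\<lambda>n. prob (A n)) \<longlonglongrightarrow> 0"
proof -
  have "(\<lambda>n. expectation (indicator (A n) :: 'a \<Rightarrow> real)) \<longlonglongrightarrow> expectation (\<lambda>\<omega>. 0)"
  proof (rule integral_dominated_convergence[where w = "\<lambda>_. 1"])
    show "AE \<omega> in M. (\<lambda>n. indicator (A n) \<omega> :: real) \<longlonglongrightarrow> 0"
      using lim
    proof eventually_elim
      case (elim \<omega>)
      then have "\<forall>\<^sub>F n in sequentially. indicator (A n) \<omega> = (0 :: real)"
        by eventually_elim simp
      then show ?case
        by (rule tendsto_eventually)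
    qed
  qed (use A in \<open>auto simp: indicator_def\<close>)
  then show ?thesis
    using A by simp
qed

end

section \<open>Riemann sums of continuous functions on a uniform grid\<close>

lemma eventually_grid_close:
  fixes f :: "real \<Rightarrow> real"
  assumes f: "continuous_on {0..t} f" and t: "0 < t" and \<eta>: "0 < \<eta>"
  shows "\<forall>\<^sub>F n in sequentially. \<forall>i<n. \<forall>u\<in>{real i * t / real n..real (Suc i) * t / real n}.
    \<bar>f (real i * t / real n) - f u\<bar> \<le> \<eta>"
proof -
  have "uniformly_continuous_on {0..t} f"
    using f by (intro compact_uniformly_continuous) auto
  then obtain \<kappa> where \<kappa>: "0 < \<kappa>" "\<And>x y. x \<in> {0..t} \<Longrightarrow> y \<in> {0..t} \<Longrightarrow> dist y x < \<kappa> \<Longrightarrow> dist (f y) (f x) < \<eta>"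
    using \<eta> unfolding uniformly_continuous_on_def by metis
  obtain n0 :: nat where n0: "t / \<kappa> < real n0"
    using reals_Archimedean2 by blast
  show ?thesis
  proof (intro eventually_sequentiallyI[of "Suc n0"] allI impI ballI)
    fix n i u assume n: "Suc n0 \<le> n" and i: "i < n" and u: "u \<in> {real i * t / real n..real (Suc i) * t / real n}"
    have n_pos: "0 < real n"
      using n by simp
    have "t / \<kappa> < real n"
      using n n0 by linarith
    then have step: "t / real n < \<kappa>"
      using \<kappa>(1) n_pos by (simp add: field_simps)
    have "real (Suc i) * t / real n \<le> real n * t / real n"
      using i t n_pos by (intro divide_right_mono mult_right_mono) auto
    then have le: "real (Suc i) * t / real n \<le> t"
      using n_pos by simp
    have Suc: "real (Suc i) * t / real n = real i * t / real n + t / real n"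
      by (simp add: add_divide_distrib distrib_right)
    have nn: "0 \<le> real i * t / real n"
      using t by simp
    note u' = u[unfolded atLeastAtMost_iff, THEN conjunct1] u[unfolded atLeastAtMost_iff, THEN conjunct2]
    have *: "p \<in> {0..t} \<and> u \<in> {0..t} \<and> dist p u < \<kappa>"
      if "p \<le> u" "u \<le> q" "q = p + d" "0 \<le> p" "q \<le> t" "d < \<kappa>" for p q d
      using that by (auto simp: dist_real_def)
    have "dist (f (real i * t / real n)) (f u) < \<eta>"
      using *[OF u' Suc nn le step] \<kappa>(2) by blast
    then show "\<bar>f (real i * t / real n) - f u\<bar> \<le> \<eta>"
      by (simp add: dist_real_def)
  qed
qed

text \<open>The oscillation bound supplied by \<open>eventually_grid_close\<close> gives an error of
  at most \<open>\<eta>\<close> per unit of time on every initial segment, hence one bound for all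
  \<open>j\<close>.\<close>

lemma riemann_sum_close:
  fixes f :: "real \<Rightarrow> real"
  assumes f: "continuous_on {0..t} f" and t: "0 < t" and n: "0 < n" and j: "j \<le> n"
    and close: "\<forall>i<n. \<forall>u\<in>{real i * t / real n..real (Suc i) * t / real n}. \<bar>f (real i * t / real n) - f u\<bar> \<le> \<eta>"
    and int: "set_integrable lborel {0..real j * t / real n} f"
  shows "\<bar>(LINT u:{0..real j * t / real n}|lborel. f u) - (\<Sum>i<j. f (real i * t / real n) * (t / real n))\<bar> \<le> \<eta> * t"
proof -
  let ?s = "\<lambda>i. real i * t / real n"
  have mono: "?s i \<le> ?s k" if "i \<le> k" for i k
    using t that by (intro divide_right_mono mult_right_mono) auto
  have le_t: "?s k \<le> t" if "k \<le> n" for k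
    using mono[OF that] n by simp
  have step: "?s (Suc i) = ?s i + t / real n" for i
    by (simp add: add_divide_distrib distrib_right)
  have fi: "f integrable_on {?s i..?s k}" if "k \<le> n" for i k
    by (intro integrable_continuous_interval continuous_on_subset[OF f])
      (use that t le_t in \<open>auto intro: order_trans\<close>)
  have ind: "\<bar>integral {0..?s k} f - (\<Sum>i<k. f (?s i) * (t / real n))\<bar> \<le> \<eta> * ?s k" if "k \<le> n" for k
    using that
  proof (induction k)
    case (Suc k)
    have k: "k < n" using Suc.prems by simp
    have "integral {0..?s (Suc k)} f = integral {0..?s k} f + integral {?s k..?s (Suc k)} f"
      using fi[of "Suc k" 0] Suc.prems t mono[of k "Suc k"]
      by (intro Henstock_Kurzweil_Integration.integral_combine[symmetric]) auto
    moreover have "\<bar>integral {?s k..?s (Suc k)} f - f (?s k) * (t / real n)\<bar> \<le> \<eta> * (t / real n)"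
    proof -
      have "integral {?s k..?s (Suc k)} f - f (?s k) * (t / real n) = integral {?s k..?s (Suc k)} (\<lambda>u. f u - f (?s k))"
        using fi[OF Suc.prems, of k] mono[of k "Suc k"] step[of k]
        by (subst Henstock_Kurzweil_Integration.integral_diff) auto
      moreover have "norm (integral {?s k..?s (Suc k)} (\<lambda>u. f u - f (?s k))) \<le> \<eta> * (?s (Suc k) - ?s k)"
      proof (rule integral_bound)
        show "?s k \<le> ?s (Suc k)" by (rule mono) simp
        show "continuous_on {?s k..?s (Suc k)} (\<lambda>u. f u - f (?s k))"
          by (intro continuous_intros continuous_on_subset[OF f])
            (use t le_t[OF Suc.prems] in \<open>auto intro: order_trans\<close>)
        show "norm (f u - f (?s k)) \<le> \<eta>" if "u \<in> {?s k..?s (Suc k)}" for u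
          using close k that by (simp add: abs_minus_commute)
      qed
      moreover have "?s (Suc k) - ?s k = t / real n"
        using step[of k] by linarith
      ultimately show ?thesis
        by (simp only: real_norm_def)
    qed
    ultimately show ?case
      using Suc.IH k unfolding step by (simp add: distrib_left)
  qed simp
  have 0: "0 \<le> \<eta>"
    using close[rule_format, of 0 0] n t by simp
  have "(LINT u:{0..?s j}|lborel. f u) = integral {0..?s j} f"
    using int by (rule set_borel_integral_eq_integral)
  then have "\<bar>(LINT u:{0..?s j}|lborel. f u) - (\<Sum>i<j. f (?s i) * (t / real n))\<bar> \<le> \<eta> * ?s j"
    using ind[OF j] by simp
  also have "\<dots> \<le> \<eta> * t"
    using 0 le_t[OF j] by (rule mult_left_mono[rotated])
  finally show ?thesis .
qed

section \<open>Euler scheme\<close>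

locale sde = brownian M F W for M :: "'a measure" and F W +
  fixes T :: ereal and a b :: "real \<Rightarrow> real \<Rightarrow> real" and x0 :: real and X :: "real \<Rightarrow> 'a \<Rightarrow> real"
  assumes solution: "sde_solution M F W T (UNIV \<times> time_range T) a b x0 X"
    and a_continuous: "continuous_on (UNIV \<times> time_range T) (\<lambda>(x, t). a x t)"
    and b_continuous: "continuous_on (UNIV \<times> time_range T) (\<lambda>(x, t). b x t)"
begin

lemma time_range_subset:
  assumes "t \<in> time_range T"
  shows "{0..t} \<subseteq> time_range T"
proof
  fix s assume "s \<in> {0..t}"
  then have "0 \<le> s" "ereal s \<le> ereal t"
    by simp_all
  moreover have "ereal t < T"
    using assms by (simp add: time_range_def)
  ultimately show "s \<in> time_range T"
    using le_less_trans[of "ereal s" "ereal t" T] by (simp add: time_range_def)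
qed

lemma solutionD:
  shows "\<forall>t\<in>time_range T. X t \<in> borel_measurable (F t)"
    and "\<forall>\<omega>\<in>space M. continuous_on (time_range T) (\<lambda>t. X t \<omega>)"
    and "\<forall>t\<in>time_range T. \<exists>I. ito_integral M F W (\<lambda>s \<omega>. b (X s \<omega>) s) t I \<and>
       (AE \<omega> in M. set_integrable lborel {0..t} (\<lambda>s. a (X s \<omega>) s) \<and>
          X t \<omega> = x0 + (LINT s:{0..t}|lborel. a (X s \<omega>) s) + I \<omega>)"
  by (rule solution[unfolded sde_solution_def, THEN conjunct1]
      solution[unfolded sde_solution_def, THEN conjunct2, THEN conjunct1]
      solution[unfolded sde_solution_def, THEN conjunct2, THEN conjunct2, THEN conjunct2])+

lemma X_measurable_F: "t \<in> time_range T \<Longrightarrow> X t \<in> borel_measurable (F t)"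
  by (rule solutionD(1)[rule_format])

lemma X_measurable: "t \<in> time_range T \<Longrightarrow> X t \<in> borel_measurable M"
  by (rule measurable_F_M[OF X_measurable_F])

lemma path_continuous:
  assumes "t \<in> time_range T" "\<omega> \<in> space M"
  shows "continuous_on {0..t} (\<lambda>s. X s \<omega>)"
proof -
  have "continuous_on (time_range T) (\<lambda>s. X s \<omega>)"
    using solutionD(2) assms(2) by blast
  then show ?thesis
    using time_range_subset[OF assms(1)] by (rule continuous_on_subset)
qed

lemma coefficient_path_continuous:
  assumes c: "continuous_on (UNIV \<times> time_range T) (\<lambda>(x, t). c x t)" and t: "t \<in> time_range T" "\<omega> \<in> space M"
  shows "continuous_on {0..t} (\<lambda>s. c (X s \<omega>) s)"
proof -
  have "continuous_on {0..t} (\<lambda>s. (\<lambda>(x, t). c x t) (X s \<omega>, s))"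
    using time_range_subset[OF t(1)]
    by (intro continuous_on_compose2[OF c] continuous_intros path_continuous[OF t]) auto
  then show ?thesis by simp
qed

lemma coefficient_continuous:
  assumes c: "continuous_on (UNIV \<times> time_range T) (\<lambda>(x, t). c x t)" and t: "t \<in> time_range T"
  shows "continuous_on UNIV (\<lambda>x. c x t)"
proof -
  have "continuous_on UNIV (\<lambda>x. (\<lambda>(x, t). c x t) (x, t))"
    using t by (intro continuous_on_compose2[OF c] continuous_intros) auto
  then show ?thesis by simp
qed

lemma coefficient_measurable_F:
  assumes c: "continuous_on (UNIV \<times> time_range T) (\<lambda>(x, t). c x t)" and t: "t \<in> time_range T"
  shows "(\<lambda>\<omega>. c (X t \<omega>) t) \<in> borel_measurable (F t)"
  by (rule measurable_compose[OF X_measurable_F[OF t]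
        borel_measurable_continuous_onI[OF coefficient_continuous[OF c t]]])

text \<open>
  The cutoff makes the coefficient bounded, as \<open>elementary_process\<close> requires; on each path it is
  inactive for large \<open>n\<close>.
\<close>
definition euler_coeff :: "real \<Rightarrow> nat \<Rightarrow> nat \<Rightarrow> 'a \<Rightarrow> real" where
  "euler_coeff t n i \<omega> = (if \<bar>X (real i * t / real n) \<omega>\<bar> \<le> real n
     then b (X (real i * t / real n) \<omega>) (real i * t / real n) else 0)"

text \<open>The coefficients are evaluated along \<open>X\<close> and not along the scheme. The two
  sums approximate the two integrals in the equation for \<open>X\<close>, so there is no recursion
  through which an error could grow. The drift carries no cutoff because it enters only as a Riemann
  sum on each path.\<close>

definition euler :: "real \<Rightarrow> nat \<Rightarrow> nat \<Rightarrow> 'a \<Rightarrow> real" where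
  "euler t n j \<omega> = x0 + (\<Sum>i<j. a (X (real i * t / real n) \<omega>) (real i * t / real n) * (t / real n)
     + euler_coeff t n i \<omega> * (W (real (Suc i) * t / real n) \<omega> - W (real i * t / real n) \<omega>))"

context
  fixes t :: real
  assumes t: "t \<in> time_range T" "0 < t"
begin

lemma grid_time_mono: "i \<le> j \<Longrightarrow> real i * t / real n \<le> real j * t / real n"
  using t by (intro divide_right_mono mult_right_mono) auto

lemma grid_time_in:
  assumes "i \<le> n"
  shows "real i * t / real n \<in> {0..t}" "real i * t / real n \<in> time_range T"
proof -
  have "real i * t / real n \<le> t"
    using grid_time_mono[OF assms, of n] t(2) by (cases "n = 0") simp_all
  then show "real i * t / real n \<in> {0..t}"
    using t(2) by simp
  then show "real i * t / real n \<in> time_range T"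
    using time_range_subset[OF t(1)] by blast
qed

lemma euler_coeff_measurable_F:
  assumes "i \<le> n"
  shows "euler_coeff t n i \<in> borel_measurable (F (real i * t / real n))"
proof -
  have [measurable]: "X (real i * t / real n) \<in> borel_measurable (F (real i * t / real n))"
    "(\<lambda>\<omega>. b (X (real i * t / real n) \<omega>) (real i * t / real n)) \<in> borel_measurable (F (real i * t / real n))"
    by (intro X_measurable_F coefficient_measurable_F b_continuous grid_time_in assms)+
  show ?thesis
    unfolding euler_coeff_def[abs_def] by measurable
qed

lemma euler_coeff_bounded:
  assumes "i \<le> n"
  shows "\<exists>C. \<forall>\<omega>\<in>space M. \<bar>euler_coeff t n i \<omega>\<bar> \<le> C"
proof -
  let ?s = "real i * t / real n"
  have "continuous_on {- real n..real n} (\<lambda>x. b x ?s)"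
    by (rule continuous_on_subset[OF coefficient_continuous[OF b_continuous grid_time_in(2)[OF assms]]]) simp
  then have "compact ((\<lambda>x. b x ?s) ` {- real n..real n})"
    by (rule compact_continuous_image) simp
  then obtain C where C: "\<forall>y\<in>(\<lambda>x. b x ?s) ` {- real n..real n}. norm y \<le> C"
    by (rule compact_imp_bounded[THEN bounded_iff[THEN iffD1], THEN exE])
  have "\<bar>euler_coeff t n i \<omega>\<bar> \<le> max C 0" for \<omega>
  proof (cases "\<bar>X ?s \<omega>\<bar> \<le> real n")
    case True
    then have "X ?s \<omega> \<in> {- real n..real n}"
      by (simp add: abs_le_iff)
    then have "\<bar>b (X ?s \<omega>) ?s\<bar> \<le> C"
      using C[rule_format, OF imageI] by (simp only: real_norm_def)
    then show ?thesis
      using True by (simp add: euler_coeff_def le_max_iff_disj)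
  qed (simp add: euler_coeff_def)
  then show ?thesis by blast
qed

lemma euler_elementary:
  assumes "0 < n"
  shows "elementary_process M F t n (\<lambda>i. real i * t / real n) (euler_coeff t n)"
  unfolding elementary_process_def
proof (intro conjI allI impI)
  fix i assume "i < n"
  then have i: "i \<le> n"
    by simp
  show "real i * t / real n \<le> real (Suc i) * t / real n"
    by (rule grid_time_mono) simp
  show "euler_coeff t n i \<in> borel_measurable (F (real i * t / real n))"
    by (rule euler_coeff_measurable_F[OF i])
  show "\<exists>C. \<forall>\<omega>\<in>space M. \<bar>euler_coeff t n i \<omega>\<bar> \<le> C"
    by (rule euler_coeff_bounded[OF i])
qed (use assms in auto)

lemma euler_stopped_integral:
  assumes "j \<le> n"
  shows "stopped_integral n (\<lambda>i. real i * t / real n) (euler_coeff t n) (real j * t / real n) \<omega>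
    = (\<Sum>i<j. euler_coeff t n i \<omega> * (W (real (Suc i) * t / real n) \<omega> - W (real i * t / real n) \<omega>))"
proof -
  let ?s = "\<lambda>i. real i * t / real n"
  have eq: "\<xi> * (W (min (?s (Suc i)) (?s j)) \<omega> - W (min (?s i) (?s j)) \<omega>)
    = (if i < j then \<xi> * (W (?s (Suc i)) \<omega> - W (?s i) \<omega>) else 0)" for i \<xi>
  proof (cases "i < j")
    case True
    then show ?thesis
      using grid_time_mono[of "Suc i" j n] grid_time_mono[of i j n] by (simp only: min_absorb1 if_True Suc_leI less_imp_le)
  next
    case False
    then show ?thesis
      using grid_time_mono[of j "Suc i" n] grid_time_mono[of j i n] by (simp add: min_absorb2 del: of_nat_Suc)
  qed
  have "stopped_integral n ?s (euler_coeff t n) (?s j) \<omega>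
    = (\<Sum>i<n. if i < j then euler_coeff t n i \<omega> * (W (?s (Suc i)) \<omega> - W (?s i) \<omega>) else 0)"
    unfolding stopped_integral_def by (intro sum.cong refl eq)
  also have "\<dots> = (\<Sum>i\<in>{..<n} \<inter> {i. i < j}. euler_coeff t n i \<omega> * (W (?s (Suc i)) \<omega> - W (?s i) \<omega>))"
    by (subst sum.inter_restrict) simp_all
  also have "{..<n} \<inter> {i. i < j} = {..<j}"
    using assms by auto
  finally show ?thesis .
qed

text \<open>This is a statement about a single path: for large \<open>n\<close> the cutoff exceeds
  the maximum of the path, and by uniform continuity the step function is within
  \<open>\<eta>\<close> of the integrand. The choice \<open>\<eta> = sqrt (N / t)\<close> makes the
  squared error over [0, t] equal to \<open>N\<close>.\<close>

lemma euler_L2_error: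
  assumes \<omega>: "\<omega> \<in> space M" and N: "0 < N"
  shows "\<forall>\<^sub>F n in sequentially. L2_error t (\<lambda>s \<omega>. b (X s \<omega>) s)
    (elementary_value n (\<lambda>i. real i * t / real n) (euler_coeff t n)) \<omega> \<le> ennreal N"
proof -
  let ?f = "\<lambda>s. b (X s \<omega>) s"
  define \<eta> where "\<eta> = sqrt (N / t)"
  have \<eta>: "0 < \<eta>" "\<eta>\<^sup>2 * t = N"
    using N t by (auto simp: \<eta>_def)
  have "compact ((\<lambda>s. X s \<omega>) ` {0..t})"
    by (rule compact_continuous_image[OF path_continuous[OF t(1) \<omega>]]) simp
  then obtain R where R: "\<forall>y\<in>(\<lambda>s. X s \<omega>) ` {0..t}. norm y \<le> R"
    by (rule compact_imp_bounded[THEN bounded_iff[THEN iffD1], THEN exE])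
  have "\<forall>\<^sub>F n in sequentially. R \<le> real n"
    using filterlim_real_sequentially by (simp add: filterlim_at_top)
  moreover note eventually_gt_at_top[of 0]
  moreover note eventually_grid_close[OF coefficient_path_continuous[OF b_continuous t(1) \<omega>] t(2) \<eta>(1)]
  ultimately show ?thesis
  proof eventually_elim
    case (elim n)
    let ?s = "\<lambda>i. real i * t / real n"
    have g: "grid ?s n"
      using elim(2) t(2) by (auto simp: grid_def divide_strict_right_mono)
    have s: "?s 0 = 0" "?s n = t"
      using elim(2) by auto
    have val: "elementary_value n ?s (euler_coeff t n) u \<omega> = ?f (?s i)" if i: "i < n" "?s i < u" "u \<le> ?s (Suc i)" for i u
    proof -
      have "indicator {?s k<..?s (Suc k)} u = (if k = i then 1 else 0 :: real)" if "k < n" for k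
      proof (cases "k < i")
        case True
        then have "?s (Suc k) \<le> ?s i" by (intro grid_time_mono) auto
        then show ?thesis using i True by (simp del: of_nat_Suc)
      next
        case False
        have "?s (Suc i) \<le> ?s k" if "k \<noteq> i"
          using that False by (intro grid_time_mono) auto
        then show ?thesis using i by (auto simp: indicator_def simp del: of_nat_Suc)
      qed
      then have "elementary_value n ?s (euler_coeff t n) u \<omega> = (\<Sum>k<n. if k = i then euler_coeff t n i \<omega> else 0)"
        unfolding elementary_value_def by (intro sum.cong) (auto simp del: of_nat_Suc)
      also have "\<dots> = euler_coeff t n i \<omega>"
        using i by simp
      also have "\<dots> = ?f (?s i)"
      proof -
        have "?s i \<in> {0..t}" using i by (intro grid_time_in) simp
        then have "\<bar>X (?s i) \<omega>\<bar> \<le> R" using R by auto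
        then show ?thesis using elim(1) by (simp add: euler_coeff_def)
      qed
      finally show ?thesis .
    qed
    have "L2_error t (\<lambda>s \<omega>. b (X s \<omega>) s) (elementary_value n ?s (euler_coeff t n)) \<omega>
      \<le> (\<integral>\<^sup>+u\<in>{0..t}. ennreal (\<eta>\<^sup>2) \<partial>lborel)"
      unfolding L2_error_def
    proof (rule nn_integral_mono_AE)
      \<comment> \<open>The time 0 belongs to no half-open cell, so the pointwise bound holds for
        positive \<open>u\<close> only; the least \<open>i\<close> with \<open>u\<close> below the
        right end selects the cell.\<close>
      have pt: "ennreal ((?f u - elementary_value n ?s (euler_coeff t n) u \<omega>)\<^sup>2) \<le> ennreal (\<eta>\<^sup>2)"
        if u: "0 < u" "u \<le> t" for u
      proof -
        define i where "i = (LEAST i. u \<le> ?s (Suc i))"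
        have ex: "u \<le> ?s (Suc (n - 1))"
          using u(2) s(2) elim(2) by (simp del: of_nat_Suc)
        have i: "u \<le> ?s (Suc i)" "i \<le> n - 1"
          unfolding i_def using LeastI[of "\<lambda>i. u \<le> ?s (Suc i)", OF ex] Least_le[of "\<lambda>i. u \<le> ?s (Suc i)", OF ex] by blast+
        have "?s i < u"
        proof (cases i)
          case 0
          then show ?thesis using u(1) by simp
        next
          case (Suc k)
          then have "\<not> u \<le> ?s (Suc k)"
            using not_less_Least[of k "\<lambda>i. u \<le> ?s (Suc i)"] unfolding i_def by simp
          then show ?thesis using Suc by simp
        qed
        moreover have "i < n"
          using i(2) elim(2) by linarith
        ultimately have v: "elementary_value n ?s (euler_coeff t n) u \<omega> = ?f (?s i)" "\<bar>?f (?s i) - ?f u\<bar> \<le> \<eta>"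
          using val i(1) elim(3) by (blast, force)
        then show ?thesis
          using \<eta>(1) by (intro ennreal_leI) (simp add: v(1) abs_le_square_iff[symmetric] abs_minus_commute)
      qed
      show "AE u in lborel. ennreal ((?f u - elementary_value n ?s (euler_coeff t n) u \<omega>)\<^sup>2) * indicator {0..t} u
          \<le> ennreal (\<eta>\<^sup>2) * indicator {0..t} u"
        using AE_lborel_singleton[of 0]
      proof eventually_elim
        case (elim u)
        then show ?case
          using pt[of u] by (cases "u \<in> {0..t}") auto
      qed
    qed
    also have "\<dots> = ennreal N"
      using t(2) \<eta> by (simp add: nn_integral_cmult_indicator ennreal_mult[symmetric])
    finally show ?case .
  qed
qed

lemma euler_measurable_F:
  assumes "j \<le> n"
  shows "euler t n j \<in> borel_measurable (F (real j * t / real n))"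
  unfolding euler_def[abs_def]
proof (intro borel_measurable_add borel_measurable_const borel_measurable_sum borel_measurable_times borel_measurable_diff)
  let ?s = "\<lambda>i. real i * t / real n"
  fix i assume "i \<in> {..<j}"
  then have ij: "i < j" "i \<le> n"
    using assms by simp_all
  have i: "i \<le> n" "?s i \<le> ?s j" "?s (Suc i) \<le> ?s j" "0 \<le> ?s i" "0 \<le> ?s (Suc i)"
    using ij t(2) grid_time_mono[of i j n] grid_time_mono[of "Suc i" j n] by simp_all
  show "(\<lambda>\<omega>. a (X (?s i) \<omega>) (?s i)) \<in> borel_measurable (F (?s j))"
    by (rule measurable_F_mono[OF coefficient_measurable_F[OF a_continuous grid_time_in(2)[OF i(1)]] i(2)])
  show "euler_coeff t n i \<in> borel_measurable (F (?s j))"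
    by (rule measurable_F_mono[OF euler_coeff_measurable_F[OF i(1)] i(2)])
  show "W (?s (Suc i)) \<in> borel_measurable (F (?s j))" "W (?s i) \<in> borel_measurable (F (?s j))"
    by (rule W_measurable_F[OF i(5,3)] W_measurable_F[OF i(4,2)])+
qed

lemma euler_measurable: "j \<le> n \<Longrightarrow> euler t n j \<in> borel_measurable M"
  by (rule measurable_F_M[OF euler_measurable_F])

lemma X_grid_measurable: "j \<le> n \<Longrightarrow> X (real j * t / real n) \<in> borel_measurable M"
  by (rule X_measurable[OF grid_time_in(2)])

text \<open>The difference of \<open>X\<close> and \<open>euler\<close> is the error of a Riemann
  sum for the drift, which tends to 0 on almost every path, plus the error of an elementary integral
  for an Ito integral. As the number of grid points grows with \<open>n\<close>, it matters that the
  bound of \<open>ito_integral_comparison\<close> does not involve it.\<close>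

lemma euler_convergence:
  assumes \<epsilon>: "0 < \<epsilon>"
  shows "(\<lambda>n. prob {\<omega>\<in>space M. \<exists>j\<in>{..n}. \<epsilon> < \<bar>X (real j * t / real n) \<omega> - euler t n j \<omega>\<bar>}) \<longlonglongrightarrow> 0"
proof -
  let ?s = "\<lambda>n i. real i * t / real n" and ?H = "\<lambda>s \<omega>. b (X s \<omega>) s"
  obtain J where J: "\<forall>s\<in>time_range T. ito_integral M F W ?H s (J s) \<and>
       (AE \<omega> in M. set_integrable lborel {0..s} (\<lambda>s. a (X s \<omega>) s) \<and>
          X s \<omega> = x0 + (LINT s:{0..s}|lborel. a (X s \<omega>) s) + J s \<omega>)"
    using bchoice[OF solutionD(3)] by (rule exE)
  have ito: "ito_integral M F W ?H s (J s)" if "s \<in> time_range T" for s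
    using J that by blast
  have Jm: "J s \<in> borel_measurable M" if "s \<in> time_range T" for s
    using ito[OF that] unfolding ito_integral_def by (elim conjE)
  have AE: "AE \<omega> in M. set_integrable lborel {0..s} (\<lambda>s. a (X s \<omega>) s) \<and>
          X s \<omega> = x0 + (LINT s:{0..s}|lborel. a (X s \<omega>) s) + J s \<omega>" if "s \<in> time_range T" for s
    using J that by blast
  \<comment> \<open>Almost surely this is the drift integral minus its Riemann sum. Written through
    \<open>X\<close> and \<open>J\<close> it is visibly measurable.\<close>
  define Dr where "Dr n j \<omega> = X (?s n j) \<omega> - x0 - J (?s n j) \<omega> - (\<Sum>i<j. a (X (?s n i) \<omega>) (?s n i) * (t / real n))" for n j \<omega>
  let ?S = "\<lambda>n j. stopped_integral n (?s n) (euler_coeff t n) (?s n j)"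
  have Dm: "Dr n j \<in> borel_measurable M" if "j \<le> n" for n j
    unfolding Dr_def[abs_def]
  proof (intro borel_measurable_diff borel_measurable_const borel_measurable_sum borel_measurable_times)
    show "X (?s n j) \<in> borel_measurable M" "J (?s n j) \<in> borel_measurable M"
      by (rule X_grid_measurable[OF that] Jm[OF grid_time_in(2)[OF that]])+
    fix i assume "i \<in> {..<j}"
    then have "i \<le> n" using that by simp
    then show "(\<lambda>\<omega>. a (X (?s n i) \<omega>) (?s n i)) \<in> borel_measurable M"
      by (rule measurable_F_M[OF coefficient_measurable_F[OF a_continuous grid_time_in(2)]])
  qed
  \<comment> \<open>The integral equation holds outside a null set that depends on the time. Only
    the countably many grid times occur, so the exceptional sets can be merged.\<close>
  have AE': "AE \<omega> in M. \<forall>n j. j \<le> n \<longrightarrow> set_integrable lborel {0..?s n j} (\<lambda>s. a (X s \<omega>) s) \<and>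
          X (?s n j) \<omega> = x0 + (LINT s:{0..?s n j}|lborel. a (X s \<omega>) s) + J (?s n j) \<omega>"
    unfolding AE_all_countable
  proof (intro allI)
    fix n j
    show "AE \<omega> in M. j \<le> n \<longrightarrow> set_integrable lborel {0..?s n j} (\<lambda>s. a (X s \<omega>) s) \<and>
          X (?s n j) \<omega> = x0 + (LINT s:{0..?s n j}|lborel. a (X s \<omega>) s) + J (?s n j) \<omega>"
    proof (cases "j \<le> n")
      case True
      show ?thesis
        using AE[OF grid_time_in(2)[OF True]] by eventually_elim simp
    qed simp
  qed
  have D0: "(\<lambda>n. prob {\<omega>\<in>space M. \<exists>j\<in>{..n}. \<epsilon> / 2 < \<bar>Dr n j \<omega>\<bar>}) \<longlonglongrightarrow> 0"
  proof (rule prob_tendsto_zero)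
    show "{\<omega>\<in>space M. \<exists>j\<in>{..n}. \<epsilon> / 2 < \<bar>Dr n j \<omega>\<bar>} \<in> events" for n
    proof (rule sets.sets_Collect_finite_Ex)
      fix j assume "j \<in> {..n}"
      then have [measurable]: "Dr n j \<in> borel_measurable M"
        by (intro Dm) simp
      show "{\<omega>\<in>space M. \<epsilon> / 2 < \<bar>Dr n j \<omega>\<bar>} \<in> events"
        by measurable
    qed simp
    have \<eta>: "0 < \<epsilon> / (2 * t)"
      using \<epsilon> t(2) by simp
    show "AE \<omega> in M. \<forall>\<^sub>F n in sequentially. \<omega> \<notin> {\<omega>\<in>space M. \<exists>j\<in>{..n}. \<epsilon> / 2 < \<bar>Dr n j \<omega>\<bar>}"
      using AE' AE_space
    proof eventually_elim
      case (elim \<omega>)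
      note path = coefficient_path_continuous[OF a_continuous t(1) elim(2)] and eq = elim(1)
      from eventually_grid_close[OF path t(2) \<eta>] eventually_gt_at_top[of 0]
      show ?case
      proof eventually_elim
        case (elim n)
        have "\<bar>Dr n j \<omega>\<bar> \<le> \<epsilon> / 2" if j: "j \<le> n" for j
        proof -
          note A = eq[rule_format, OF j]
          have "Dr n j \<omega> = (LINT s:{0..?s n j}|lborel. a (X s \<omega>) s) - (\<Sum>i<j. a (X (?s n i) \<omega>) (?s n i) * (t / real n))"
            using A by (simp add: Dr_def)
          moreover have "\<bar>\<dots>\<bar> \<le> \<epsilon> / (2 * t) * t"
            by (rule riemann_sum_close[OF path t(2) elim(2) j elim(1)]) (rule A[THEN conjunct1])
          ultimately show ?thesis
            using t(2) by simp
        qed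
        then show ?case
          by (auto simp: not_less)
      qed
    qed
  qed
  show ?thesis
  proof (rule tendsto_zero_if_le)
    fix \<delta> :: real assume \<delta>: "0 < \<delta>"
    define N where "N = \<delta> * (\<epsilon> / 4)\<^sup>2"
    have N: "0 < N" "N / (\<epsilon> / 4)\<^sup>2 = \<delta>"
      using \<delta> \<epsilon> by (auto simp: N_def)
    let ?L = "\<lambda>n. L2_error t ?H (elementary_value n (?s n) (euler_coeff t n))"
    \<comment> \<open>The guard \<open>n \<noteq> 0\<close> makes the second event empty for
      \<open>n = 0\<close>, where the grid is degenerate and the Euler coefficients do not form an
      elementary process with horizon \<open>t\<close>.\<close>
    define g where "g n = prob {\<omega>\<in>space M. \<exists>j\<in>{..n}. \<epsilon> / 2 < \<bar>Dr n j \<omega>\<bar>}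
       + prob {\<omega>\<in>space M. n \<noteq> 0 \<and> ennreal (N / 4) < ?L n \<omega>}" for n
    have pm: "jointly_measurable t ?H"
    proof -
      have "progressively_measurable F t ?H"
        using ito[OF t(1)] unfolding ito_integral_def by (elim conjE)
      then show ?thesis
        using t(2) by (intro progressively_jointly_measurable[where t = t]) auto
    qed
    have "(\<lambda>n. prob {\<omega>\<in>space M. n \<noteq> 0 \<and> ennreal (N / 4) < ?L n \<omega>}) \<longlonglongrightarrow> 0"
    proof (rule prob_tendsto_zero)
      fix n
      show "{\<omega>\<in>space M. n \<noteq> 0 \<and> ennreal (N / 4) < ?L n \<omega>} \<in> events"
      proof (cases "n = 0")
        case False
        then have "0 < n" by simp
        note [measurable] = L2_error_measurable[OF pm elementary_jointly_measurable[OF euler_elementary[OF this]]]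
        show ?thesis by measurable
      qed simp
    next
      have N4: "0 < N / 4" using N(1) by simp
      show "AE \<omega> in M. \<forall>\<^sub>F n in sequentially. \<omega> \<notin> {\<omega>\<in>space M. n \<noteq> 0 \<and> ennreal (N / 4) < ?L n \<omega>}"
        using AE_space
      proof eventually_elim
        case (elim \<omega>)
        show ?case
          using euler_L2_error[OF elim N4] by eventually_elim (simp add: not_less)
      qed
    qed
    then have "g \<longlonglongrightarrow> 0 + 0"
      unfolding g_def by (intro tendsto_add D0)
    moreover have "prob {\<omega>\<in>space M. \<exists>j\<in>{..n}. \<epsilon> < \<bar>X (?s n j) \<omega> - euler t n j \<omega>\<bar>} \<le> \<delta> + g n" if n: "0 < n" for n
    proof -
      note e = euler_elementary[OF n]
      have "prob {\<omega>\<in>space M. \<exists>j\<in>{..n}. \<epsilon> / 2 + \<epsilon> / 2 < \<bar>X (?s n j) \<omega> - euler t n j \<omega>\<bar>}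
        \<le> prob {\<omega>\<in>space M. \<exists>j\<in>{..n}. \<epsilon> / 2 < \<bar>Dr n j \<omega>\<bar>}
          + prob {\<omega>\<in>space M. \<exists>j\<in>{..n}. \<epsilon> / 2 < \<bar>J (?s n j) \<omega> - ?S n j \<omega>\<bar>}"
      proof (rule prob_sum_le)
        fix j assume "j \<in> {..n}"
        then have j: "j \<le> n" by simp
        show "Dr n j \<in> borel_measurable M"
          by (rule Dm[OF j])
        have "0 \<le> ?s n j" using t(2) by simp
        then show "(\<lambda>\<omega>. J (?s n j) \<omega> - ?S n j \<omega>) \<in> borel_measurable M"
          by (intro borel_measurable_diff Jm[OF grid_time_in(2)[OF j]] stopped_integral_measurable[OF e])
        fix \<omega>
        have "X (?s n j) \<omega> - euler t n j \<omega> = Dr n j \<omega> + (J (?s n j) \<omega> - ?S n j \<omega>)"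
          unfolding euler_stopped_integral[OF j] Dr_def euler_def by (simp add: sum.distrib)
        then show "\<bar>X (?s n j) \<omega> - euler t n j \<omega>\<bar> \<le> \<bar>Dr n j \<omega>\<bar> + \<bar>J (?s n j) \<omega> - ?S n j \<omega>\<bar>"
          by simp
      qed simp
      moreover have "prob {\<omega>\<in>space M. \<exists>j\<in>{..n}. \<epsilon> / 2 < \<bar>J (?s n j) \<omega> - ?S n j \<omega>\<bar>}
        \<le> \<delta> + prob {\<omega>\<in>space M. n \<noteq> 0 \<and> ennreal (N / 4) < ?L n \<omega>}"
      proof -
        let ?Q = "?s n ` {..n}"
        have "prob {\<omega>\<in>space M. \<exists>q\<in>?Q. \<epsilon> / 4 + \<epsilon> / 4 < \<bar>J q \<omega> - stopped_integral n (?s n) (euler_coeff t n) q \<omega>\<bar>}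
          \<le> N / (\<epsilon> / 4)\<^sup>2 + prob {\<omega>\<in>space M. ennreal (N / 4) < ?L n \<omega>}"
        proof (rule ito_integral_comparison[OF _ ito[OF t(1)] _ _ _ e _ N(1)])
          show "ito_integral M F W ?H q (J q)" if "q \<in> ?Q" for q
            using that grid_time_in(2) by (intro ito) auto
          show "?Q \<subseteq> {0..t}"
            using grid_time_in(1) by blast
        qed (use t \<epsilon> in auto)
        then show ?thesis
          using n unfolding N(2) by simp
      qed
      ultimately show ?thesis
        unfolding g_def by simp
    qed
    ultimately show "\<exists>g. g \<longlonglongrightarrow> 0 \<and> (\<forall>\<^sub>F n in sequentially.
        prob {\<omega>\<in>space M. \<exists>j\<in>{..n}. \<epsilon> < \<bar>X (?s n j) \<omega> - euler t n j \<omega>\<bar>} \<le> \<delta> + g n)"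
      by (intro exI[of _ g] conjI eventually_mono[OF eventually_gt_at_top[of "0 :: nat"]]) simp_all
  qed simp
qed

end

end

section \<open>Stopped Euler scheme\<close>

text \<open>The increment \<open>h\<close> will be Gaussian and hence unbounded. For small
  \<open>h\<close>, uniform continuity of the derivatives on a compact box gives the factor
  \<open>\<eta>\<close>. For \<open>\<bar>h\<bar>\<close> larger than \<open>\<kappa>\<close>, the
  global bound on \<open>g\<close> and the inequality
  \<open>1 \<le> \<bar>h\<bar> / \<kappa>\<close> push every term into the cubic one, whose
  expectation is of order 3/2 in the step.\<close>

lemma taylor_remainder:
  fixes g gs gx gxx :: "real \<Rightarrow> real \<Rightarrow> real"
  assumes r: "0 < r"
    and cont: "continuous_on ({0..t} \<times> UNIV) (\<lambda>(s, x). gs s x)" "continuous_on ({0..t} \<times> UNIV) (\<lambda>(s, x). gx s x)"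
      "continuous_on ({0..t} \<times> UNIV) (\<lambda>(s, x). gxx s x)"
    and ds: "\<And>s x. s \<in> {0..t} \<Longrightarrow> ((\<lambda>s. g s x) has_real_derivative gs s x) (at s within {0..t})"
    and dx: "\<And>s x. s \<in> {0..t} \<Longrightarrow> (g s has_real_derivative gx s x) (at x)"
    and dxx: "\<And>s x. s \<in> {0..t} \<Longrightarrow> (gx s has_real_derivative gxx s x) (at x)"
    and bound: "\<And>s x. s \<in> {0..t} \<Longrightarrow> \<bar>g s x\<bar> \<le> 1"
    and \<eta>: "0 < \<eta>"
  obtains \<kappa> C where "0 < \<kappa>" "0 \<le> C"
    "\<And>s d x h. 0 \<le> s \<Longrightarrow> 0 < d \<Longrightarrow> d \<le> \<kappa> \<Longrightarrow> s + d \<le> t \<Longrightarrow> \<bar>x - x0\<bar> \<le> 2 * r \<Longrightarrow>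
      \<bar>g (s + d) (x + h) - g s x - gs s x * d - gx s x * h - gxx s x * h\<^sup>2 / 2\<bar> \<le> \<eta> * (d + h\<^sup>2) + C * \<bar>h\<bar> ^ 3"
proof -
  let ?Q = "{0..t} \<times> {x0 - 3 * r..x0 + 3 * r}"
  have Q: "compact ?Q"
    by (intro compact_Times) auto
  have cQ: "continuous_on ?Q (\<lambda>(s, x). gs s x)" "continuous_on ?Q (\<lambda>(s, x). gx s x)" "continuous_on ?Q (\<lambda>(s, x). gxx s x)"
    by (rule continuous_on_subset[OF cont(1)] continuous_on_subset[OF cont(2)] continuous_on_subset[OF cont(3)]
        Sigma_mono order_refl subset_UNIV)+
  have uc: "\<exists>\<kappa>>0. \<forall>p\<in>?Q. \<forall>q\<in>?Q. dist q p < \<kappa> \<longrightarrow> \<bar>f q - f p\<bar> < \<eta>"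
    if "continuous_on ?Q f" for f :: "real \<times> real \<Rightarrow> real"
    using compact_uniformly_continuous[OF that Q] \<eta> unfolding uniformly_continuous_on_def dist_real_def by simp
  obtain \<kappa>1 where \<kappa>1: "0 < \<kappa>1"
      "\<forall>p\<in>?Q. \<forall>q\<in>?Q. dist q p < \<kappa>1 \<longrightarrow> \<bar>(\<lambda>(s, x). gs s x) q - (\<lambda>(s, x). gs s x) p\<bar> < \<eta>"
    using uc[OF cQ(1)] by (elim exE conjE)
  obtain \<kappa>2 where \<kappa>2: "0 < \<kappa>2"
      "\<forall>p\<in>?Q. \<forall>q\<in>?Q. dist q p < \<kappa>2 \<longrightarrow> \<bar>(\<lambda>(s, x). gxx s x) q - (\<lambda>(s, x). gxx s x) p\<bar> < \<eta>"
    using uc[OF cQ(3)] by (elim exE conjE)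
  have bdd: "\<exists>B. \<forall>p\<in>?Q. \<bar>f p\<bar> \<le> B" if "continuous_on ?Q f" for f :: "real \<times> real \<Rightarrow> real"
    using compact_imp_bounded[OF compact_continuous_image[OF that Q]] unfolding bounded_iff by auto
  obtain B1 where B1: "\<forall>p\<in>?Q. \<bar>(\<lambda>(s, x). gs s x) p\<bar> \<le> B1"
    using bdd[OF cQ(1)] by (rule exE)
  obtain B2 where B2: "\<forall>p\<in>?Q. \<bar>(\<lambda>(s, x). gx s x) p\<bar> \<le> B2"
    using bdd[OF cQ(2)] by (rule exE)
  obtain B3 where B3: "\<forall>p\<in>?Q. \<bar>(\<lambda>(s, x). gxx s x) p\<bar> \<le> B3"
    using bdd[OF cQ(3)] by (rule exE)
  define B where "B = max 0 (max B1 (max B2 B3))"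
  have B: "\<bar>gs s x\<bar> \<le> B" "\<bar>gx s x\<bar> \<le> B" "\<bar>gxx s x\<bar> \<le> B" if "s \<in> {0..t}" "x \<in> {x0 - 3 * r..x0 + 3 * r}" for s x
  proof -
    have sx: "(s, x) \<in> ?Q" using that by (rule SigmaI)
    show "\<bar>gs s x\<bar> \<le> B" "\<bar>gx s x\<bar> \<le> B" "\<bar>gxx s x\<bar> \<le> B"
      using B1[rule_format, OF sx] B2[rule_format, OF sx] B3[rule_format, OF sx]
      by (simp_all add: B_def le_max_iff_disj)
  qed
  have B0: "0 \<le> B"
    by (simp add: B_def)
  \<comment> \<open>The bound by \<open>r\<close> keeps \<open>x + h\<close> in the box of radius
    \<open>3 * r\<close>; the thirds of \<open>\<kappa>1\<close> and \<open>\<kappa>2\<close> leave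
    room for moving by at most \<open>\<kappa>\<close> in time and in space.\<close>
  define \<kappa> where "\<kappa> = min 1 (min r (min (\<kappa>1 / 3) (\<kappa>2 / 3)))"
  have \<kappa>: "0 < \<kappa>" "\<kappa> \<le> 1" "\<kappa> \<le> r" "3 * \<kappa> \<le> \<kappa>1" "3 * \<kappa> \<le> \<kappa>2"
    using r \<kappa>1(1) \<kappa>2(1) by (auto simp: \<kappa>_def min_def)
  define C where "C = (2 + B) / \<kappa> ^ 3 + B / \<kappa>\<^sup>2 + B / \<kappa>"
  have C: "0 \<le> C"
    using B0 \<kappa>(1) by (simp add: C_def)
  show ?thesis
  proof (rule that[OF \<kappa>(1) C])
    fix s d x h assume s: "0 \<le> s" "0 < d" "d \<le> \<kappa>" "s + d \<le> t" and x: "\<bar>x - x0\<bar> \<le> 2 * r"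
    let ?R = "\<bar>g (s + d) (x + h) - g s x - gs s x * d - gx s x * h - gxx s x * h\<^sup>2 / 2\<bar>"
    have st: "s \<in> {0..t}" "s + d \<in> {0..t}" and xI: "x \<in> {x0 - 3 * r..x0 + 3 * r}"
      using s x r by (auto simp: abs_le_iff)
    have 1: "0 \<le> \<eta> * (d + h\<^sup>2)" "0 \<le> C * \<bar>h\<bar> ^ 3"
      using \<eta> s C by simp_all
    show "?R \<le> \<eta> * (d + h\<^sup>2) + C * \<bar>h\<bar> ^ 3"
    proof (cases "\<bar>h\<bar> \<le> \<kappa>")
      case True
      have xh: "x + h \<in> {x0 - 3 * r..x0 + 3 * r}"
        using x True \<kappa>(3) by (auto simp: abs_le_iff)
      have "\<exists>u\<in>{s<..<s + d}. g (s + d) (x + h) - g s (x + h) = gs u (x + h) * (s + d - s)"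
      proof (rule mvt_simple[of s "s + d" "\<lambda>u. g u (x + h)" "\<lambda>u. (*) (gs u (x + h))"])
        show "((\<lambda>u. g u (x + h)) has_derivative (*) (gs u (x + h))) (at u within {s..s + d})" if "s \<le> u" "u \<le> s + d" for u
          using ds[of u "x + h"] that st unfolding has_field_derivative_def
          by (auto intro: has_derivative_subset)
      qed (use s in auto)
      then obtain u where u: "s < u" "u < s + d" "g (s + d) (x + h) - g s (x + h) = d * gs u (x + h)"
        by (auto simp: mult.commute)
      have dist: "dist (u, x + h) (s, x) < 3 * \<kappa>" "\<bar>y - x\<bar> \<le> \<bar>h\<bar> \<Longrightarrow> dist (s, y) (s, x) < 3 * \<kappa>" for y
      proof -
        have "dist (u, x + h) (s, x) \<le> \<bar>u - s\<bar> + \<bar>x + h - x\<bar>"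
          unfolding dist_prod_def dist_real_def by (simp add: sqrt_sum_squares_le_sum_abs)
        then show "dist (u, x + h) (s, x) < 3 * \<kappa>"
          using u s True \<kappa>(1) by simp
        show "\<bar>y - x\<bar> \<le> \<bar>h\<bar> \<Longrightarrow> dist (s, y) (s, x) < 3 * \<kappa>"
          using True \<kappa>(1) by (simp add: dist_prod_def dist_real_def)
      qed
      have "\<bar>gs u (x + h) - gs s x\<bar> < \<eta>"
        using \<kappa>1(2)[rule_format, of "(s, x)" "(u, x + h)"] dist(1) \<kappa>(4) st xI xh u by simp
      then have "\<bar>d * gs u (x + h) - gs s x * d\<bar> \<le> \<eta> * d"
        using s(2) by (simp add: mult.commute[of d] left_diff_distrib[symmetric] abs_mult)
      moreover have "\<bar>g s (x + h) - g s x - gx s x * h - gxx s x * h\<^sup>2 / 2\<bar> \<le> \<eta> * h\<^sup>2"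
      proof (cases "h = 0")
        case False
        define f where "f m = (if m = 0 then g s else if m = 1 then gx s else gxx s)" for m :: nat
        have "\<exists>y. (if x + h < x then x + h < y \<and> y < x else x < y \<and> y < x + h) \<and>
          g s (x + h) = (\<Sum>m<2. f m x / fact m * (x + h - x) ^ m) + f 2 y / fact 2 * (x + h - x)\<^sup>2"
          by (rule Taylor[of 2 f "g s" "min x (x + h)" "max x (x + h)"])
            (use False st dx dxx in \<open>auto simp: f_def less_2_cases_iff\<close>)
        then obtain y where y: "(if x + h < x then x + h < y \<and> y < x else x < y \<and> y < x + h)"
            and eq: "g s (x + h) = (\<Sum>m<2. f m x / fact m * (x + h - x) ^ m) + f 2 y / fact 2 * (x + h - x)\<^sup>2"
          by blast
        have yx: "\<bar>y - x\<bar> \<le> \<bar>h\<bar>"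
          using y by (auto split: if_splits)
        have yI: "y \<in> {x0 - 3 * r..x0 + 3 * r}"
          using y xI xh by (auto split: if_splits)
        have "\<bar>gxx s y - gxx s x\<bar> < \<eta>"
          using \<kappa>2(2)[rule_format, of "(s, x)" "(s, y)"] dist(2)[OF yx] \<kappa>(5) st xI yI by simp
        then have "\<bar>gxx s y - gxx s x\<bar> * h\<^sup>2 \<le> \<eta> * h\<^sup>2"
          by (intro mult_right_mono) simp_all
        moreover have taylor: "g s (x + h) = g s x + gx s x * h + gxx s y * h\<^sup>2 / 2"
          using eq by (simp add: f_def numeral_2_eq_2)
        have rem: "g s (x + h) - g s x - gx s x * h - gxx s x * h\<^sup>2 / 2 = (gxx s y - gxx s x) * h\<^sup>2 / 2"
          unfolding taylor left_diff_distrib diff_divide_distrib by simp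
        have "\<bar>(gxx s y - gxx s x) * h\<^sup>2 / 2\<bar> \<le> \<bar>gxx s y - gxx s x\<bar> * h\<^sup>2"
          by (simp add: abs_mult)
        ultimately show ?thesis
          unfolding rem by linarith
      qed (use \<eta> in simp)
      ultimately have "?R \<le> \<eta> * d + \<eta> * h\<^sup>2"
        using u(3) by linarith
      then show ?thesis
        using 1(2) by (simp add: distrib_left)
    next
      case False
      then have q: "1 \<le> \<bar>h\<bar> / \<kappa>"
        using \<kappa>(1) by simp
      have h: "1 \<le> \<bar>h\<bar> ^ 3 / \<kappa> ^ 3" "\<bar>h\<bar> \<le> \<bar>h\<bar> ^ 3 / \<kappa>\<^sup>2" "h\<^sup>2 \<le> \<bar>h\<bar> ^ 3 / \<kappa>"
      proof -
        show "1 \<le> \<bar>h\<bar> ^ 3 / \<kappa> ^ 3"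
          using one_le_power[OF q, of 3] by (simp add: power_divide)
        have "\<bar>h\<bar> * 1 \<le> \<bar>h\<bar> * (\<bar>h\<bar> / \<kappa>)\<^sup>2"
          using one_le_power[OF q, of 2] by (intro mult_left_mono) auto
        then show "\<bar>h\<bar> \<le> \<bar>h\<bar> ^ 3 / \<kappa>\<^sup>2"
          by (simp add: power_divide power3_eq_cube power2_eq_square mult.assoc)
        have "h\<^sup>2 * 1 \<le> h\<^sup>2 * (\<bar>h\<bar> / \<kappa>)"
          using q by (intro mult_left_mono) auto
        then show "h\<^sup>2 \<le> \<bar>h\<bar> ^ 3 / \<kappa>"
          by (simp add: power3_eq_cube power2_eq_square)
      qed
      have gb: "\<bar>g (s + d) (x + h)\<bar> \<le> 1" "\<bar>g s x\<bar> \<le> 1"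
        using bound st by blast+
      have "\<bar>gs s x * d\<bar> \<le> B * 1"
        unfolding abs_mult using B(1)[OF st(1) xI] s \<kappa>(2) by (intro mult_mono) auto
      moreover have "\<bar>gx s x * h\<bar> \<le> B * \<bar>h\<bar>"
        unfolding abs_mult using B(2)[OF st(1) xI] by (intro mult_right_mono) auto
      moreover have "\<bar>gxx s x * h\<^sup>2 / 2\<bar> \<le> B * h\<^sup>2"
      proof -
        have "\<bar>gxx s x\<bar> * h\<^sup>2 \<le> B * h\<^sup>2"
          using B(3)[OF st(1) xI] by (intro mult_right_mono) auto
        moreover have "\<bar>gxx s x * h\<^sup>2 / 2\<bar> \<le> \<bar>gxx s x\<bar> * h\<^sup>2"
          by (simp add: abs_mult)
        ultimately show ?thesis by linarith
      qed
      ultimately have "?R \<le> (2 + B) + B * \<bar>h\<bar> + B * h\<^sup>2"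
        using gb by linarith
      also have "\<dots> \<le> (2 + B) * (\<bar>h\<bar> ^ 3 / \<kappa> ^ 3) + B * (\<bar>h\<bar> ^ 3 / \<kappa>\<^sup>2) + B * (\<bar>h\<bar> ^ 3 / \<kappa>)"
      proof (intro add_mono)
        show "2 + B \<le> (2 + B) * (\<bar>h\<bar> ^ 3 / \<kappa> ^ 3)"
          using mult_left_mono[OF h(1), of "2 + B"] B0 by simp
      qed (intro mult_left_mono h B0)+
      also have "\<dots> = C * \<bar>h\<bar> ^ 3"
        by (simp add: C_def distrib_right)
      finally show ?thesis
        using 1(1) by linarith
    qed
  qed
qed

section \<open>Freezing the scheme on leaving a neighbourhood of the starting point\<close>

context sde
begin

text \<open>Both processes are watched, because coefficients are evaluated at \<open>X\<close> and
  test functions at the scheme. The scheme gets the larger radius, so that when the two are close it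
  is \<open>X\<close> that leaves first.\<close>

definition inside :: "real \<Rightarrow> real \<Rightarrow> nat \<Rightarrow> nat \<Rightarrow> 'a \<Rightarrow> bool" where
  "inside t r n i \<omega> \<longleftrightarrow> (\<forall>j\<in>{..i}. \<bar>X (real j * t / real n) \<omega> - x0\<bar> \<le> r \<and> \<bar>euler t n j \<omega> - x0\<bar> \<le> 2 * r)"

definition stopped_coeff :: "(real \<Rightarrow> real \<Rightarrow> real) \<Rightarrow> real \<Rightarrow> real \<Rightarrow> nat \<Rightarrow> nat \<Rightarrow> 'a \<Rightarrow> real" where
  "stopped_coeff c t r n i \<omega> = (if inside t r n i \<omega> then c (X (real i * t / real n) \<omega>) (real i * t / real n) else 0)"

definition stopped_euler :: "real \<Rightarrow> real \<Rightarrow> nat \<Rightarrow> nat \<Rightarrow> 'a \<Rightarrow> real" where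
  "stopped_euler t r n m \<omega> = x0 + (\<Sum>i<m. stopped_coeff a t r n i \<omega> * (t / real n))
     + elementary_integral W m (\<lambda>i. real i * t / real n) (stopped_coeff b t r n) \<omega>"

text \<open>The time argument of a test function has to freeze together with the scheme; otherwise
  the test function would keep changing after the exit.\<close>

definition stopped_clock :: "real \<Rightarrow> real \<Rightarrow> nat \<Rightarrow> nat \<Rightarrow> 'a \<Rightarrow> real" where
  "stopped_clock t r n m \<omega> = (\<Sum>i<m. if inside t r n i \<omega> then t / real n else 0)"

lemma inside_antimono: "inside t r n j \<omega> \<Longrightarrow> i \<le> j \<Longrightarrow> inside t r n i \<omega>"
  by (auto simp: inside_def)

lemma insideD:
  assumes "inside t r n i \<omega>"
  shows "\<bar>X (real i * t / real n) \<omega> - x0\<bar> \<le> r" "\<bar>euler t n i \<omega> - x0\<bar> \<le> 2 * r"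
  using assms unfolding inside_def by simp_all

lemma stopped_clock_inside:
  assumes "\<And>k. k < m \<Longrightarrow> inside t r n k \<omega>"
  shows "stopped_clock t r n m \<omega> = real m * t / real n"
  unfolding stopped_clock_def using assms by simp

text \<open>Before the exit \<open>\<bar>X\<bar> \<le> \<bar>x0\<bar> + r\<close> at the grid
  points, so for such \<open>n\<close> the cutoff in \<open>euler_coeff\<close> is inactive.\<close>

lemma stopped_euler_inside:
  assumes "\<And>k. k < m \<Longrightarrow> inside t r n k \<omega>" and n: "\<bar>x0\<bar> + r \<le> real n"
  shows "stopped_euler t r n m \<omega> = euler t n m \<omega>"
proof -
  have "euler_coeff t n k \<omega> = stopped_coeff b t r n k \<omega>" if "k < m" for k
    using insideD(1)[OF assms(1)[OF that]] assms(1)[OF that] n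
    by (simp add: euler_coeff_def stopped_coeff_def)
  moreover have "a (X (real k * t / real n) \<omega>) (real k * t / real n) = stopped_coeff a t r n k \<omega>" if "k < m" for k
    using assms(1)[OF that] by (simp add: stopped_coeff_def)
  ultimately show ?thesis
    unfolding stopped_euler_def euler_def elementary_integral_def
    by (simp add: sum.distrib[symmetric] del: of_nat_Suc)
qed

lemma stopped_euler_outside:
  assumes "\<not> inside t r n j \<omega>" "j \<le> m"
  shows "stopped_euler t r n m \<omega> = stopped_euler t r n j \<omega>"
proof -
  have 0: "stopped_coeff c t r n i \<omega> = 0" if "i \<in> {..<m} - {..<j}" for i c
    using that assms(1) inside_antimono[of t r n i \<omega> j] by (auto simp: stopped_coeff_def)
  have "(\<Sum>i<j. f i * stopped_coeff c t r n i \<omega>) = (\<Sum>i<m. f i * stopped_coeff c t r n i \<omega>)" for f c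
    using assms(2) by (intro sum.mono_neutral_left) (auto simp: 0)
  note this[of "\<lambda>_. t / real n" a] this[of "\<lambda>i. W (real (Suc i) * t / real n) \<omega> - W (real i * t / real n) \<omega>" b]
  then show ?thesis
    unfolding stopped_euler_def elementary_integral_def by (simp add: mult.commute del: of_nat_Suc)
qed

end

locale local_sde = sde M F W T a b x0 X
  for M :: "'a measure" and F W T a b x0 X +
  fixes t r B :: real
  assumes t: "t \<in> time_range T" "0 < t" and t1: "t \<le> 1" and r: "0 < r" and B: "0 < B"
    and coeff_bound: "\<And>s x. s \<in> {0..t} \<Longrightarrow> \<bar>x - x0\<bar> \<le> r \<Longrightarrow> \<bar>a x s\<bar> \<le> B \<and> \<bar>b x s\<bar> \<le> B"
begin

lemma inside_measurable:
  assumes "i \<le> n"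
  shows "Measurable.pred (F (real i * t / real n)) (inside t r n i)"
proof -
  let ?s = "\<lambda>i. real i * t / real n"
  have [measurable]: "X (?s j) \<in> borel_measurable (F (?s i))" "euler t n j \<in> borel_measurable (F (?s i))" if "j \<in> {..i}" for j
  proof -
    have j: "j \<le> n" and ji: "?s j \<le> ?s i"
      using that assms grid_time_mono[OF t, of j i n] by simp_all
    show "X (?s j) \<in> borel_measurable (F (?s i))"
      by (rule measurable_F_mono[OF X_measurable_F[OF grid_time_in(2)[OF t j]] ji])
    show "euler t n j \<in> borel_measurable (F (?s i))"
      by (rule measurable_F_mono[OF euler_measurable_F[OF t j] ji])
  qed
  show ?thesis
    unfolding inside_def[abs_def] by measurable
qed

lemma stopped_coeff_measurable_F:
  assumes c: "continuous_on (UNIV \<times> time_range T) (\<lambda>(x, t). c x t)" and i: "i \<le> n"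
  shows "stopped_coeff c t r n i \<in> borel_measurable (F (real i * t / real n))"
proof -
  note [measurable] = inside_measurable[OF i] coefficient_measurable_F[OF c grid_time_in(2)[OF t i]]
  show ?thesis
    unfolding stopped_coeff_def[abs_def] by measurable
qed

lemma stopped_coeff_bound:
  assumes "i \<le> n"
  shows "\<bar>stopped_coeff a t r n i \<omega>\<bar> \<le> B" "\<bar>stopped_coeff b t r n i \<omega>\<bar> \<le> B"
  using coeff_bound[OF grid_time_in(1)[OF t assms]] insideD(1)[of t r n i \<omega>] B
  by (simp_all add: stopped_coeff_def)

lemma uniform_grid: "0 < n \<Longrightarrow> m \<le> n \<Longrightarrow> grid (\<lambda>i. real i * t / real n) m"
  using t(2) by (auto simp: grid_def divide_strict_right_mono)

lemma stopped_coeff_adapted: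
  assumes "m \<le> n"
  shows "bounded_adapted (\<lambda>i. real i * t / real n) m (stopped_coeff b t r n)"
  unfolding bounded_adapted_def
proof (intro allI impI conjI)
  fix i assume "i < m"
  then have i: "i \<le> n" using assms by simp
  show "stopped_coeff b t r n i \<in> borel_measurable (F (real i * t / real n))"
    by (rule stopped_coeff_measurable_F[OF b_continuous i])
  show "\<exists>C. \<forall>\<omega>\<in>space M. \<bar>stopped_coeff b t r n i \<omega>\<bar> \<le> C"
    using stopped_coeff_bound(2)[OF i] by (intro exI[of _ B]) simp
qed

lemma stopped_euler_measurable_F:
  assumes n: "0 < n" and m: "m \<le> n"
  shows "stopped_euler t r n m \<in> borel_measurable (F (real m * t / real n))"
  unfolding stopped_euler_def[abs_def]
proof (intro borel_measurable_add borel_measurable_const borel_measurable_sum borel_measurable_times)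
  show "elementary_integral W m (\<lambda>i. real i * t / real n) (stopped_coeff b t r n) \<in> borel_measurable (F (real m * t / real n))"
    by (rule elementary_integral_measurable_F[OF uniform_grid[OF n m] stopped_coeff_adapted[OF m]]) simp
  fix i assume "i \<in> {..<m}"
  then have i: "i \<le> n" "i \<le> m" using m by simp_all
  show "stopped_coeff a t r n i \<in> borel_measurable (F (real m * t / real n))"
    by (rule measurable_F_mono[OF stopped_coeff_measurable_F[OF a_continuous i(1)] grid_time_mono[OF t i(2)]])
qed

lemma stopped_clock_measurable_F:
  assumes m: "m \<le> n"
  shows "stopped_clock t r n m \<in> borel_measurable (F (real m * t / real n))"
  unfolding stopped_clock_def[abs_def]
proof (intro borel_measurable_sum)
  fix i assume "i \<in> {..<m}"
  then have i: "i \<le> n" "i \<le> m" using m by simp_all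
  note [measurable] = inside_measurable[OF i(1)]
  have "(\<lambda>\<omega>. if inside t r n i \<omega> then t / real n else 0) \<in> borel_measurable (F (real i * t / real n))"
    by measurable
  then show "(\<lambda>\<omega>. if inside t r n i \<omega> then t / real n else 0) \<in> borel_measurable (F (real m * t / real n))"
    by (rule measurable_F_mono[OF _ grid_time_mono[OF t i(2)]])
qed

lemma stopped_clock_range:
  assumes "m \<le> n"
  shows "stopped_clock t r n m \<omega> \<in> {0..t}"
proof -
  have "stopped_clock t r n m \<omega> \<le> (\<Sum>i<m. t / real n)"
    unfolding stopped_clock_def using t(2) by (intro sum_mono) auto
  also have "\<dots> = real m * t / real n"
    by simp
  also have "\<dots> \<le> t"
    using grid_time_in(1)[OF t assms] by simp
  finally show ?thesis
    using t(2) unfolding stopped_clock_def by (auto intro: sum_nonneg)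
qed

text \<open>The squared drift part is at most \<open>B\<^sup>2 * t\<^sup>2\<close>, hence at most
  \<open>B\<^sup>2 * t\<close> as \<open>t \<le> 1\<close>, and the isometry bounds the martingale
  part by \<open>B\<^sup>2 * t\<close>. The factor 4 arises from (p + q)^2 \<le> 2 p^2 + 2
  q^2.\<close>

lemma stopped_euler_second_moment:
  assumes n: "0 < n" and m: "m \<le> n"
  shows "integrable M (\<lambda>\<omega>. (stopped_euler t r n m \<omega> - x0)\<^sup>2)"
    and "expectation (\<lambda>\<omega>. (stopped_euler t r n m \<omega> - x0)\<^sup>2) \<le> 4 * B\<^sup>2 * t"
proof -
  let ?V = "stopped_euler t r n m"
  let ?I = "elementary_integral W m (\<lambda>i. real i * t / real n) (stopped_coeff b t r n)"
  let ?D = "\<lambda>\<omega>. \<Sum>i<m. stopped_coeff a t r n i \<omega> * (t / real n)"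
  have mt: "real m * (t / real n) \<le> t"
    using grid_time_in(1)[OF t m] by simp
  have D: "\<bar>?D \<omega>\<bar> \<le> B * t" for \<omega>
  proof -
    have "\<bar>?D \<omega>\<bar> \<le> (\<Sum>i<m. B * (t / real n))"
    proof (rule order_trans[OF sum_abs sum_mono])
      fix i assume "i \<in> {..<m}"
      then have "\<bar>stopped_coeff a t r n i \<omega>\<bar> \<le> B"
        using m by (intro stopped_coeff_bound) simp
      then show "\<bar>stopped_coeff a t r n i \<omega> * (t / real n)\<bar> \<le> B * (t / real n)"
        using t(2) unfolding abs_mult by (intro mult_mono) auto
    qed
    also have "\<dots> = B * (real m * (t / real n))"
      by simp
    also have "\<dots> \<le> B * t"
      using mt B by (intro mult_left_mono) auto
    finally show ?thesis .
  qed
  have iso: "integrable M (\<lambda>\<omega>. (?I \<omega>)\<^sup>2)" "expectation (\<lambda>\<omega>. (?I \<omega>)\<^sup>2)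
      = (\<Sum>l<m. (real (Suc l) * t / real n - real l * t / real n) * expectation (\<lambda>\<omega>. (stopped_coeff b t r n l \<omega>)\<^sup>2))"
    using elementary_isometry[OF uniform_grid[OF n m] stopped_coeff_adapted[OF m]] by blast+
  have "expectation (\<lambda>\<omega>. (?I \<omega>)\<^sup>2) \<le> (\<Sum>l<m. (t / real n) * B\<^sup>2)"
    unfolding iso(2)
  proof (rule sum_mono)
    fix l assume "l \<in> {..<m}"
    then have l: "l \<le> n" using m by simp
    note bd = stopped_coeff_bound(2)[OF l]
    have "expectation (\<lambda>\<omega>. (stopped_coeff b t r n l \<omega>)\<^sup>2) \<le> expectation (\<lambda>\<omega>. B\<^sup>2)"
    proof (rule integral_mono)
      show "integrable M (\<lambda>\<omega>. (stopped_coeff b t r n l \<omega>)\<^sup>2)"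
        by (rule bounded_square_integrable[OF measurable_F_M[OF stopped_coeff_measurable_F[OF b_continuous l]] bd])
      show "(stopped_coeff b t r n l \<omega>)\<^sup>2 \<le> B\<^sup>2" for \<omega>
        using power_mono[OF bd[of \<omega>] abs_ge_zero, of 2] by simp
    qed simp
    then have "(t / real n) * expectation (\<lambda>\<omega>. (stopped_coeff b t r n l \<omega>)\<^sup>2) \<le> (t / real n) * B\<^sup>2"
      using t(2) by (intro mult_left_mono) (auto simp: prob_space)
    moreover have "real (Suc l) * t / real n - real l * t / real n = t / real n"
      by (simp add: add_divide_distrib distrib_right)
    ultimately show "(real (Suc l) * t / real n - real l * t / real n) * expectation (\<lambda>\<omega>. (stopped_coeff b t r n l \<omega>)\<^sup>2)
        \<le> (t / real n) * B\<^sup>2"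
      by simp
  qed
  also have "\<dots> = real m * (t / real n) * B\<^sup>2"
    by simp
  also have "\<dots> \<le> t * B\<^sup>2"
    using mt by (intro mult_right_mono) auto
  finally have I2: "expectation (\<lambda>\<omega>. (?I \<omega>)\<^sup>2) \<le> t * B\<^sup>2" .
  have sq: "(?V \<omega> - x0)\<^sup>2 \<le> 2 * (B\<^sup>2 * t) + 2 * (?I \<omega>)\<^sup>2" for \<omega>
  proof -
    have "(?V \<omega> - x0)\<^sup>2 = (?D \<omega> + ?I \<omega>)\<^sup>2"
      by (simp add: stopped_euler_def)
    also have "\<dots> \<le> 2 * (?D \<omega>)\<^sup>2 + 2 * (?I \<omega>)\<^sup>2"
      using sum_squares_bound[of "?D \<omega>" "?I \<omega>"] by (simp add: power2_sum)
    also have "(?D \<omega>)\<^sup>2 \<le> (B * t)\<^sup>2"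
      using power_mono[OF D[of \<omega>] abs_ge_zero, of 2] by simp
    also have "(B * t)\<^sup>2 \<le> B\<^sup>2 * t"
      using t t1 mult_left_mono[of "t * t" t "B\<^sup>2"] mult_left_le[of t t]
      by (simp add: power2_eq_square mult.assoc mult.left_commute[of t])
    finally show ?thesis by simp
  qed
  have int: "integrable M (\<lambda>\<omega>. 2 * (B\<^sup>2 * t) + 2 * (?I \<omega>)\<^sup>2)"
    using iso(1) by (intro Bochner_Integration.integrable_add) auto
  have Vm: "?V \<in> borel_measurable M"
    by (rule measurable_F_M[OF stopped_euler_measurable_F[OF n m]])
  show *: "integrable M (\<lambda>\<omega>. (?V \<omega> - x0)\<^sup>2)"
  proof (rule Bochner_Integration.integrable_bound[OF int])
    show "(\<lambda>\<omega>. (?V \<omega> - x0)\<^sup>2) \<in> borel_measurable M"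
      using Vm by measurable
    show "AE \<omega> in M. norm ((?V \<omega> - x0)\<^sup>2) \<le> norm (2 * (B\<^sup>2 * t) + 2 * (?I \<omega>)\<^sup>2)"
    proof (rule AE_I2)
      fix \<omega>
      show "norm ((?V \<omega> - x0)\<^sup>2) \<le> norm (2 * (B\<^sup>2 * t) + 2 * (?I \<omega>)\<^sup>2)"
        using sq[of \<omega>] by simp
    qed
  qed
  have "expectation (\<lambda>\<omega>. (?V \<omega> - x0)\<^sup>2) \<le> expectation (\<lambda>\<omega>. 2 * (B\<^sup>2 * t) + 2 * (?I \<omega>)\<^sup>2)"
    by (rule integral_mono[OF * int sq])
  also have "\<dots> = 2 * (B\<^sup>2 * t) + 2 * expectation (\<lambda>\<omega>. (?I \<omega>)\<^sup>2)"
    using iso(1) by (simp add: prob_space)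
  also have "\<dots> \<le> 4 * B\<^sup>2 * t"
    using I2 by (simp add: mult.commute)
  finally show "expectation (\<lambda>\<omega>. (?V \<omega> - x0)\<^sup>2) \<le> 4 * B\<^sup>2 * t" .
qed

lemma stopped_euler_first_moment:
  assumes n: "0 < n" and m: "m \<le> n"
  shows "integrable M (\<lambda>\<omega>. \<bar>stopped_euler t r n m \<omega> - x0\<bar>)"
    and "expectation (\<lambda>\<omega>. \<bar>stopped_euler t r n m \<omega> - x0\<bar>) \<le> 2 * B * sqrt t"
proof -
  let ?V = "stopped_euler t r n m"
  note S = stopped_euler_second_moment[OF n m]
  have Vm: "(\<lambda>\<omega>. ?V \<omega> - x0) \<in> borel_measurable M"
    by (intro borel_measurable_diff measurable_F_M[OF stopped_euler_measurable_F[OF n m]]) simp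
  show *: "integrable M (\<lambda>\<omega>. \<bar>?V \<omega> - x0\<bar>)"
    using square_integrable_imp_integrable[OF Vm S(1)] by simp
  \<comment> \<open>The bound aimed at is inserted as the weight in \<bar>v\<bar> \<le> (v^2 / c +
    c) / 2, so that both summands have expectation at most \<open>c\<close>.\<close>
  define c where "c = 2 * B * sqrt t"
  have c: "0 < c" "c\<^sup>2 = 4 * B\<^sup>2 * t"
    using B t by (simp_all add: c_def power_mult_distrib)
  have amgm: "\<bar>v\<bar> \<le> (v\<^sup>2 / c + c) / 2" for v :: real
    using sum_squares_bound[of "\<bar>v\<bar>" c] c(1) by (simp add: field_simps power2_eq_square)
  have "expectation (\<lambda>\<omega>. \<bar>?V \<omega> - x0\<bar>) \<le> expectation (\<lambda>\<omega>. ((?V \<omega> - x0)\<^sup>2 / c + c) / 2)"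
    using S(1) by (intro integral_mono * amgm) auto
  also have "\<dots> = (expectation (\<lambda>\<omega>. (?V \<omega> - x0)\<^sup>2) / c + c) / 2"
    using S(1) by (simp add: prob_space)
  also have "\<dots> \<le> (c\<^sup>2 / c + c) / 2"
    using S(2) c by (intro divide_right_mono add_right_mono) auto
  also have "\<dots> = c"
    using c(1) by (simp add: power2_eq_square)
  finally show "expectation (\<lambda>\<omega>. \<bar>?V \<omega> - x0\<bar>) \<le> 2 * B * sqrt t"
    by (simp add: c_def)
qed

text \<open>Chebyshev's inequality at the terminal time alone. Because the scheme is frozen on exit,
  its terminal position reveals an earlier exit, and no maximal inequality enters here.\<close>

lemma stopped_euler_exit_prob:
  assumes n: "0 < n"
  shows "prob {\<omega>\<in>space M. r / 2 \<le> \<bar>stopped_euler t r n n \<omega> - x0\<bar>} \<le> 16 * B\<^sup>2 / r\<^sup>2 * t"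
proof -
  let ?V = "stopped_euler t r n n"
  have Vm: "(\<lambda>\<omega>. ?V \<omega> - x0) \<in> borel_measurable M"
    by (intro borel_measurable_diff measurable_F_M[OF stopped_euler_measurable_F[OF n order_refl]]) simp
  have "prob {\<omega>\<in>space M. r / 2 \<le> \<bar>?V \<omega> - x0\<bar>} \<le> expectation (\<lambda>\<omega>. (?V \<omega> - x0)\<^sup>2) / (r / 2)\<^sup>2"
    using r by (intro second_moment_method Vm stopped_euler_second_moment[OF n order_refl]) simp
  also have "\<dots> \<le> (4 * B\<^sup>2 * t) / (r / 2)\<^sup>2"
    by (intro divide_right_mono stopped_euler_second_moment[OF n order_refl]) simp
  also have "\<dots> = 16 * B\<^sup>2 / r\<^sup>2 * t"
    by (simp add: power_divide)
  finally show ?thesis .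
qed

end

section \<open>Test functions along the stopped scheme\<close>

lemma sum_inverse_sqrt_le: "(\<Sum>j<n. 1 / sqrt (real (Suc j))) \<le> 2 * sqrt (real n)"
proof (induction n)
  case (Suc n)
  have "1 \<le> 2 * sqrt (real (Suc n)) * (sqrt (real (Suc n)) - sqrt (real n))"
  proof -
    have "2 * sqrt (real (Suc n)) * (sqrt (real (Suc n)) - sqrt (real n))
      = (sqrt (real (Suc n)) - sqrt (real n))\<^sup>2 + ((sqrt (real (Suc n)))\<^sup>2 - (sqrt (real n))\<^sup>2)"
      by (simp only: power2_eq_square algebra_simps)
    then show ?thesis by simp
  qed
  then have "1 / sqrt (real (Suc n)) \<le> 2 * (sqrt (real (Suc n)) - sqrt (real n))"
    by (simp add: field_simps del: of_nat_Suc)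
  with Suc show ?case
    by (simp del: of_nat_Suc)
qed simp

text \<open>The discrete counterpart of the integral of 1 / sqrt (t - s) over [0, t], which equals 2
  sqrt t. Left end points are used, so the singularity at s = t is never met.\<close>

lemma grid_singular_sum_le:
  assumes t: "0 < t" and n: "0 < n"
  shows "(\<Sum>i<n. t / real n * (1 / sqrt (t - real i * t / real n))) \<le> 2 * sqrt t"
proof -
  let ?d = "t / real n"
  have d: "0 < ?d" using t n by simp
  have "(\<Sum>i<n. ?d * (1 / sqrt (t - real i * t / real n))) = (\<Sum>j<n. ?d * (1 / sqrt (t - real (n - Suc j) * t / real n)))"
    by (rule sum.nat_diff_reindex[symmetric])
  also have "\<dots> = (\<Sum>j<n. sqrt ?d * (1 / sqrt (real (Suc j))))"
  proof (rule sum.cong)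
    fix j assume "j \<in> {..<n}"
    then have "real (n - Suc j) = real n - real (Suc j)"
      by (intro of_nat_diff) simp
    then have "t - real (n - Suc j) * t / real n = real (Suc j) * ?d"
      using n by (simp add: field_simps)
    moreover have "?d * (1 / sqrt (x * ?d)) = sqrt ?d * (1 / sqrt x)" for x
    proof -
      have "?d * (1 / sqrt (x * ?d)) = (sqrt ?d * sqrt ?d) * (1 / (sqrt x * sqrt ?d))"
        using d by (simp only: real_sqrt_mult real_sqrt_mult_self abs_of_pos)
      also have "\<dots> = sqrt ?d * (1 / sqrt x)"
      proof -
        have "q * q * (1 / (y * q)) = q * (1 / y)" if "0 < q" for q y :: real
          using that by simp
        then show ?thesis
          using d by (simp only: real_sqrt_gt_0_iff)
      qed
      finally show ?thesis .
    qed
    ultimately show "?d * (1 / sqrt (t - real (n - Suc j) * t / real n)) = sqrt ?d * (1 / sqrt (real (Suc j)))"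
      by (simp only:)
  qed simp
  also have "\<dots> \<le> sqrt ?d * (2 * sqrt (real n))"
    unfolding sum_distrib_left[symmetric] using d by (intro mult_left_mono sum_inverse_sqrt_le) auto
  also have "\<dots> = 2 * sqrt t"
    using n by (simp add: real_sqrt_divide)
  finally show ?thesis .
qed

text \<open>Only \<open>B\<close>, \<open>r\<close>, \<open>C\<close> and \<open>t\<close> appear in
  the estimate proved for such \<open>g\<close>. Bounds on the separate derivatives, which
  degenerate as the smoothing tends to 0, enter only error terms that vanish in the limit of fine
  grids.\<close>

locale smooth_test_function = local_sde M F W T a b x0 X t r B
  for M :: "'a measure" and F W T a b x0 X t r B +
  fixes g gs gx gxx :: "real \<Rightarrow> real \<Rightarrow> real" and C :: real
  assumes g_cont: "continuous_on ({0..t} \<times> UNIV) (\<lambda>(s, x). g s x)"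
    and gs_cont: "continuous_on ({0..t} \<times> UNIV) (\<lambda>(s, x). gs s x)"
    and gx_cont: "continuous_on ({0..t} \<times> UNIV) (\<lambda>(s, x). gx s x)"
    and gxx_cont: "continuous_on ({0..t} \<times> UNIV) (\<lambda>(s, x). gxx s x)"
    and g_ds: "\<And>s x. s \<in> {0..t} \<Longrightarrow> ((\<lambda>s. g s x) has_real_derivative gs s x) (at s within {0..t})"
    and g_dx: "\<And>s x. s \<in> {0..t} \<Longrightarrow> (g s has_real_derivative gx s x) (at x)"
    and g_dxx: "\<And>s x. s \<in> {0..t} \<Longrightarrow> (gx s has_real_derivative gxx s x) (at x)"
    and g_bound: "\<And>s x. s \<in> {0..t} \<Longrightarrow> \<bar>g s x\<bar> \<le> 1"
    and C: "0 \<le> C"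
    and generator_bound: "\<And>s x. 0 \<le> s \<Longrightarrow> s < t \<Longrightarrow> \<bar>x - x0\<bar> \<le> r \<Longrightarrow>
      \<bar>gs s x + a x s * gx s x + (b x s)\<^sup>2 / 2 * gxx s x\<bar> \<le> C * (\<bar>x - x0\<bar> + s) / sqrt (t - s)"
begin

text \<open>The backward operator with derivatives taken at \<open>v\<close> and coefficients at
  \<open>x\<close>: the scheme, placed at \<open>v\<close>, moves with the coefficients of the
  solution at \<open>x\<close>. On the diagonal it is the quantity in
  \<open>generator_bound\<close>.\<close>

definition generator :: "real \<Rightarrow> real \<Rightarrow> real \<Rightarrow> real" where
  "generator s v x = gs s v + a x s * gx s v + (b x s)\<^sup>2 / 2 * gxx s v"

definition stopped_generator :: "nat \<Rightarrow> nat \<Rightarrow> 'a \<Rightarrow> real" where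
  "stopped_generator n i \<omega> = (if inside t r n i \<omega> then
     generator (real i * t / real n) (stopped_euler t r n i \<omega>) (X (real i * t / real n) \<omega>) else 0)"

abbreviation time where "time n i \<equiv> real i * t / real n"
abbreviation V where "V n i \<equiv> stopped_euler t r n i"
abbreviation S where "S n i \<equiv> stopped_clock t r n i"

definition close :: "nat \<Rightarrow> real \<Rightarrow> 'a \<Rightarrow> bool" where
  "close n \<epsilon> \<omega> \<longleftrightarrow> (\<forall>j\<in>{..n}. \<bar>X (time n j) \<omega> - euler t n j \<omega>\<bar> \<le> \<epsilon>)"

lemma derivative_bounds:
  obtains K where "0 \<le> K" "\<And>s x. s \<in> {0..t} \<Longrightarrow> \<bar>x - x0\<bar> \<le> 2 * r \<Longrightarrow> \<bar>gs s x\<bar> \<le> K \<and> \<bar>gx s x\<bar> \<le> K \<and> \<bar>gxx s x\<bar> \<le> K"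
proof -
  let ?Q = "{0..t} \<times> {x0 - 2 * r..x0 + 2 * r}"
  have bdd: "\<exists>B. \<forall>p\<in>?Q. \<bar>f p\<bar> \<le> B" if "continuous_on ({0..t} \<times> UNIV) f" for f :: "real \<times> real \<Rightarrow> real"
  proof -
    have "continuous_on ?Q f"
      by (rule continuous_on_subset[OF that Sigma_mono[OF order_refl subset_UNIV]])
    then have "bounded (f ` ?Q)"
      by (intro compact_imp_bounded compact_continuous_image compact_Times) auto
    then show ?thesis
      unfolding bounded_iff by auto
  qed
  obtain B1 where B1: "\<forall>p\<in>?Q. \<bar>(\<lambda>(s, x). gs s x) p\<bar> \<le> B1"
    using bdd[OF gs_cont] by (rule exE)
  obtain B2 where B2: "\<forall>p\<in>?Q. \<bar>(\<lambda>(s, x). gx s x) p\<bar> \<le> B2"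
    using bdd[OF gx_cont] by (rule exE)
  obtain B3 where B3: "\<forall>p\<in>?Q. \<bar>(\<lambda>(s, x). gxx s x) p\<bar> \<le> B3"
    using bdd[OF gxx_cont] by (rule exE)
  show ?thesis
  proof (rule that[of "max 0 (max B1 (max B2 B3))"])
    fix s x assume "s \<in> {0..t}" "\<bar>x - x0\<bar> \<le> 2 * r"
    then have sx: "(s, x) \<in> ?Q" by (auto simp: abs_le_iff)
    show "\<bar>gs s x\<bar> \<le> max 0 (max B1 (max B2 B3)) \<and> \<bar>gx s x\<bar> \<le> max 0 (max B1 (max B2 B3)) \<and> \<bar>gxx s x\<bar> \<le> max 0 (max B1 (max B2 B3))"
      using B1[rule_format, OF sx] B2[rule_format, OF sx] B3[rule_format, OF sx]
      by (simp add: le_max_iff_disj)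
  qed simp
qed

lemma V_inside:
  assumes "inside t r n i \<omega>" "\<bar>x0\<bar> + r \<le> real n"
  shows "V n i \<omega> = euler t n i \<omega>" "\<bar>V n i \<omega> - x0\<bar> \<le> 2 * r" "S n i \<omega> = time n i"
proof -
  have in': "inside t r n k \<omega>" if "k < i" for k
    using inside_antimono[OF assms(1)] that by simp
  show "V n i \<omega> = euler t n i \<omega>"
    using in' assms(2) by (rule stopped_euler_inside)
  then show "\<bar>V n i \<omega> - x0\<bar> \<le> 2 * r"
    using insideD(2)[OF assms(1)] by simp
  show "S n i \<omega> = time n i"
    using in' by (rule stopped_clock_inside)
qed

lemma measurable_at_V:
  assumes c: "continuous_on ({0..t} \<times> UNIV) (\<lambda>(s, x). f s x)" and i: "i \<le> n" "0 < n"
  shows "(\<lambda>\<omega>. f (time n i) (V n i \<omega>)) \<in> borel_measurable (F (time n i))"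
proof (rule measurable_compose[OF stopped_euler_measurable_F[OF i(2,1)]])
  have "continuous_on UNIV (\<lambda>x. (\<lambda>(s, x). f s x) (time n i, x))"
    using grid_time_in(1)[OF t i(1)] by (intro continuous_on_compose2[OF c] continuous_intros) auto
  then show "f (time n i) \<in> borel_measurable borel"
    by (intro borel_measurable_continuous_onI) simp
qed

lemma measurable_at_stopped:
  assumes i: "i \<le> n" "0 < n"
  shows "(\<lambda>\<omega>. g (S n i \<omega>) (V n i \<omega>)) \<in> borel_measurable M"
proof -
  have "(\<lambda>\<omega>. (S n i \<omega>, V n i \<omega>)) \<in> borel_measurable M"
    by (intro borel_measurable_Pair measurable_F_M[OF stopped_euler_measurable_F[OF i(2,1)]]
        measurable_F_M[OF stopped_clock_measurable_F[OF i(1)]])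
  then have "(\<lambda>\<omega>. (S n i \<omega>, V n i \<omega>)) \<in> measurable M (restrict_space borel ({0..t} \<times> UNIV))"
    using stopped_clock_range[OF i(1)] by (intro measurable_restrict_space2) auto
  from measurable_compose[OF this borel_measurable_continuous_on_restrict[OF g_cont]]
  show ?thesis by simp
qed

lemma stopped_g_integrable:
  assumes "i \<le> n" "0 < n"
  shows "integrable M (\<lambda>\<omega>. g (S n i \<omega>) (V n i \<omega>))"
  using g_bound stopped_clock_range[OF assms(1)]
  by (intro bounded_integrable[of _ 1] measurable_at_stopped assms) blast

lemma stopped_generator_measurable_F:
  assumes i: "i \<le> n" "0 < n"
  shows "stopped_generator n i \<in> borel_measurable (F (time n i))"
proof -
  note [measurable] = inside_measurable[OF i(1)] measurable_at_V[OF gs_cont i] measurable_at_V[OF gx_cont i]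
    measurable_at_V[OF gxx_cont i] coefficient_measurable_F[OF a_continuous grid_time_in(2)[OF t i(1)]]
    coefficient_measurable_F[OF b_continuous grid_time_in(2)[OF t i(1)]]
  show ?thesis
    unfolding stopped_generator_def[abs_def] generator_def by measurable
qed

lemma stopped_generator_bound:
  assumes i: "i \<le> n" and n: "\<bar>x0\<bar> + r \<le> real n"
    and K: "0 \<le> K" "\<And>s x. s \<in> {0..t} \<Longrightarrow> \<bar>x - x0\<bar> \<le> 2 * r \<Longrightarrow> \<bar>gs s x\<bar> \<le> K \<and> \<bar>gx s x\<bar> \<le> K \<and> \<bar>gxx s x\<bar> \<le> K"
  shows "\<bar>stopped_generator n i \<omega>\<bar> \<le> K + B * K + B\<^sup>2 * K"
proof (cases "inside t r n i \<omega>")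
  case True
  define s x v where "s = time n i" and "x = X (time n i) \<omega>" and "v = V n i \<omega>"
  have st: "s \<in> {0..t}"
    unfolding s_def by (rule grid_time_in(1)[OF t i])
  have ab: "\<bar>a x s\<bar> \<le> B" "\<bar>b x s\<bar> \<le> B"
    using coeff_bound[OF st, of x] insideD(1)[OF True] unfolding x_def s_def by blast+
  have Kb: "\<bar>gs s v\<bar> \<le> K" "\<bar>gx s v\<bar> \<le> K" "\<bar>gxx s v\<bar> \<le> K"
    using K(2)[OF st, of v] V_inside(2)[OF True n] unfolding v_def by blast+
  have "\<bar>a x s * gx s v\<bar> \<le> B * K"
    unfolding abs_mult using ab Kb B by (intro mult_mono) auto
  moreover have "\<bar>(b x s)\<^sup>2 / 2 * gxx s v\<bar> \<le> B\<^sup>2 * K"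
  proof -
    have "(b x s)\<^sup>2 \<le> B\<^sup>2"
      using power_mono[OF ab(2) abs_ge_zero, of 2] by simp
    then have "\<bar>(b x s)\<^sup>2 / 2\<bar> \<le> B\<^sup>2"
      using zero_le_power2[of "b x s"] by linarith
    then show ?thesis
      unfolding abs_mult[of "(b x s)\<^sup>2 / 2"] using Kb by (intro mult_mono) auto
  qed
  moreover have "stopped_generator n i \<omega> = gs s v + a x s * gx s v + (b x s)\<^sup>2 / 2 * gxx s v"
    using True by (simp add: stopped_generator_def generator_def s_def x_def v_def)
  ultimately show ?thesis
    using Kb(1) by linarith
qed (use K(1) B in \<open>simp add: stopped_generator_def\<close>)

text \<open>This is one step of Ito's formula in expectation. In the Taylor expansion the terms
  linear in the Brownian increment and the deviation of its square from the step length have mean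
  zero. What remains is the generator and an error of size \<eta> times the step plus order 3/2,
  small enough to be summed over the grid.\<close>

lemma step_expectation:
  assumes n: "0 < n" "\<bar>x0\<bar> + r \<le> real n" and i: "i < n" and d: "t / real n \<le> \<kappa>"
    and K: "0 \<le> K" "\<And>s x. s \<in> {0..t} \<Longrightarrow> \<bar>x - x0\<bar> \<le> 2 * r \<Longrightarrow> \<bar>gs s x\<bar> \<le> K \<and> \<bar>gx s x\<bar> \<le> K \<and> \<bar>gxx s x\<bar> \<le> K"
    and \<eta>: "0 \<le> \<eta>" and C': "0 \<le> C'"
    and taylor: "\<And>s d x h. 0 \<le> s \<Longrightarrow> 0 < d \<Longrightarrow> d \<le> \<kappa> \<Longrightarrow> s + d \<le> t \<Longrightarrow> \<bar>x - x0\<bar> \<le> 2 * r \<Longrightarrow>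
      \<bar>g (s + d) (x + h) - g s x - gs s x * d - gx s x * h - gxx s x * h\<^sup>2 / 2\<bar> \<le> \<eta> * (d + h\<^sup>2) + C' * \<bar>h\<bar> ^ 3"
  shows "integrable M (\<lambda>\<omega>. \<bar>stopped_generator n i \<omega>\<bar>)"
    and "\<bar>expectation (\<lambda>\<omega>. g (S n (Suc i) \<omega>) (V n (Suc i) \<omega>)) - expectation (\<lambda>\<omega>. g (S n i \<omega>) (V n i \<omega>))\<bar>
      \<le> t / real n * expectation (\<lambda>\<omega>. \<bar>stopped_generator n i \<omega>\<bar>)
        + (\<eta> * (1 + 4 * B\<^sup>2) * (t / real n) + 4 * C' * B ^ 3 * ((t / real n) ^ 3 + 2 * sqrt (t / real n) ^ 3)
           + K * B\<^sup>2 * (t / real n)\<^sup>2)"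
proof -
  define \<Delta> where "\<Delta> = t / real n"
  define s where "s = time n i"
  have s': "time n (Suc i) = s + \<Delta>"
    by (simp add: s_def \<Delta>_def add_divide_distrib distrib_right)
  have \<Delta>: "0 < \<Delta>" "\<Delta> \<le> 1" "\<Delta> \<le> \<kappa>"
    using t t1 n d by (auto simp: \<Delta>_def field_simps order_trans[of t 1 "real n"])
  have i': "i \<le> n" "Suc i \<le> n" using i by simp_all
  have st: "s \<in> {0..t}" "s + \<Delta> \<le> t" "0 \<le> s" "s < s + \<Delta>"
    using grid_time_in(1)[OF t i'(1)] grid_time_in(1)[OF t i'(2)] \<Delta>(1) unfolding s' s_def[symmetric] by auto
  define P where "P \<omega> \<longleftrightarrow> inside t r n i \<omega>" for \<omega>
  define A where "A = stopped_coeff a t r n i"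
  define D where "D = stopped_coeff b t r n i"
  define w where "w \<omega> = W (s + \<Delta>) \<omega> - W s \<omega>" for \<omega>
  define G where "G = stopped_generator n i"
  have S': "S n (Suc i) \<omega> = S n i \<omega> + (if P \<omega> then \<Delta> else 0)" for \<omega>
    by (simp add: stopped_clock_def P_def \<Delta>_def)
  have V': "V n (Suc i) \<omega> = V n i \<omega> + (A \<omega> * \<Delta> + D \<omega> * w \<omega>)" for \<omega>
    using s' by (simp add: stopped_euler_def elementary_integral_def A_def D_def \<Delta>_def w_def s_def del: of_nat_Suc)
  have AD: "\<bar>A \<omega>\<bar> \<le> B" "\<bar>D \<omega>\<bar> \<le> B" for \<omega>
    unfolding A_def D_def by (rule stopped_coeff_bound[OF i'(1)])+
  have AD0: "A \<omega> = 0" "D \<omega> = 0" "G \<omega> = 0" if "\<not> P \<omega>" for \<omega>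
    using that by (simp_all add: A_def D_def G_def P_def stopped_coeff_def stopped_generator_def)
  have PV: "\<bar>V n i \<omega> - x0\<bar> \<le> 2 * r" "S n i \<omega> = s" if "P \<omega>" for \<omega>
    using V_inside[OF _ n(2)] that unfolding P_def s_def by auto
  have Geq: "G \<omega> = gs s (V n i \<omega>) + A \<omega> * gx s (V n i \<omega>) + (D \<omega>)\<^sup>2 / 2 * gxx s (V n i \<omega>)" if "P \<omega>" for \<omega>
    using that by (simp add: G_def A_def D_def P_def stopped_coeff_def stopped_generator_def generator_def s_def)
  \<comment> \<open>\<open>Z1\<close> and \<open>Z2\<close> are the coefficients of \<open>w\<close>
    and of its square after inserting the increment \<open>A * \<Delta> + D * w\<close>. The second
    summand of \<open>Z1\<close> is the mixed term of the squared increment; its pure drift part, of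
    order \<open>\<Delta>\<^sup>2\<close>, is left to the error.\<close>
  define Z1 where "Z1 \<omega> = gx s (V n i \<omega>) * D \<omega> + gxx s (V n i \<omega>) * A \<omega> * D \<omega> * \<Delta>" for \<omega>
  define Z2 where "Z2 \<omega> = gxx s (V n i \<omega>) * (D \<omega>)\<^sup>2 / 2" for \<omega>
  note mF [measurable] = inside_measurable[OF i'(1), folded P_def[abs_def] s_def]
    measurable_at_V[OF gs_cont i'(1) n(1), folded s_def]
    measurable_at_V[OF gx_cont i'(1) n(1), folded s_def] measurable_at_V[OF gxx_cont i'(1) n(1), folded s_def]
    stopped_coeff_measurable_F[OF a_continuous i'(1), folded s_def A_def]
    stopped_coeff_measurable_F[OF b_continuous i'(1), folded s_def D_def]
  have Z_meas: "Z1 \<in> borel_measurable (F s)" "Z2 \<in> borel_measurable (F s)"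
    unfolding Z1_def[abs_def] Z2_def[abs_def] by measurable
  have G_meas: "G \<in> borel_measurable (F s)"
    using stopped_generator_measurable_F[OF i'(1) n(1)] unfolding G_def s_def .
  have Kb: "\<bar>gs s (V n i \<omega>)\<bar> \<le> K" "\<bar>gx s (V n i \<omega>)\<bar> \<le> K" "\<bar>gxx s (V n i \<omega>)\<bar> \<le> K" if "P \<omega>" for \<omega>
    using K(2)[OF st(1) PV(1)[OF that]] by blast+
  have G_bd: "\<bar>G \<omega>\<bar> \<le> K + B * K + B\<^sup>2 * K" for \<omega>
    unfolding G_def by (rule stopped_generator_bound[OF i'(1) n(2) K])
  have G_int: "integrable M G"
    by (rule bounded_integrable[OF measurable_F_M[OF G_meas] G_bd])
  then show "integrable M (\<lambda>\<omega>. \<bar>stopped_generator n i \<omega>\<bar>)"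
    unfolding G_def by simp
  have Z1_int: "integrable M Z1"
  proof (rule bounded_integrable[OF measurable_F_M[OF Z_meas(1)]])
    fix \<omega>
    show "\<bar>Z1 \<omega>\<bar> \<le> K * B + K * B * B * \<Delta>"
    proof (cases "P \<omega>")
      case True
      have "\<bar>gx s (V n i \<omega>) * D \<omega>\<bar> \<le> K * B" "\<bar>gxx s (V n i \<omega>) * A \<omega> * D \<omega> * \<Delta>\<bar> \<le> K * B * B * \<Delta>"
        unfolding abs_mult using AD Kb[OF True] K(1) B \<Delta> by (auto intro!: mult_mono)
      then show ?thesis
        unfolding Z1_def by linarith
    qed (use AD0 K(1) B \<Delta> in \<open>simp add: Z1_def\<close>)
  qed
  have Z2_int: "integrable M Z2"
  proof (rule bounded_integrable[OF measurable_F_M[OF Z_meas(2)]])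
    fix \<omega>
    show "\<bar>Z2 \<omega>\<bar> \<le> K * B\<^sup>2"
    proof (cases "P \<omega>")
      case True
      have "(D \<omega>)\<^sup>2 \<le> B\<^sup>2"
        using power_mono[OF AD(2)[of \<omega>] abs_ge_zero, of 2] by simp
      then have "\<bar>gxx s (V n i \<omega>) * (D \<omega>)\<^sup>2\<bar> \<le> K * B\<^sup>2"
        unfolding abs_mult using Kb[OF True] K(1) by (intro mult_mono) auto
      then show ?thesis
        unfolding Z2_def by linarith
    qed (use AD0 K(1) B in \<open>simp add: Z2_def\<close>)
  qed
  note w1 = integrable_mult_increment[OF st(3,4) Z_meas(1) Z1_int, folded w_def]
    expectation_mult_increment[OF st(3,4) Z_meas(1) Z1_int, folded w_def]
  note w2 = integrable_mult_increment_square[OF st(3,4) Z_meas(2) Z2_int, folded w_def]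
    expectation_mult_increment_square[OF st(3,4) Z_meas(2) Z2_int, folded w_def]
  \<comment> \<open>What is subtracted besides the generator is \<open>Z1 * w\<close> and
    \<open>Z2 * (w\<^sup>2 - \<Delta>)\<close>, both of mean zero, so that \<open>Y\<close> has the
    desired expectation and is small pointwise. After the exit everything is frozen and
    \<open>Y\<close> is 0.\<close>
  define Y where "Y \<omega> = g (S n (Suc i) \<omega>) (V n (Suc i) \<omega>) - g (S n i \<omega>) (V n i \<omega>) - \<Delta> * G \<omega>
     - Z1 \<omega> * w \<omega> - Z2 \<omega> * (w \<omega>)\<^sup>2 + \<Delta> * Z2 \<omega>" for \<omega>
  note gi = stopped_g_integrable[OF i'(2) n(1)] stopped_g_integrable[OF i'(1) n(1)]
  have Y_int: "integrable M Y"
    unfolding Y_def[abs_def] using gi G_int w1(1) w2(1) Z2_int by simp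
  have EY: "expectation Y = expectation (\<lambda>\<omega>. g (S n (Suc i) \<omega>) (V n (Suc i) \<omega>)) - expectation (\<lambda>\<omega>. g (S n i \<omega>) (V n i \<omega>))
      - \<Delta> * expectation G"
    unfolding Y_def[abs_def] using gi G_int w1 w2 Z2_int by simp
  \<comment> \<open>The spatial increment is at most \<open>B * (\<Delta> + \<bar>w\<bar>)\<close>;
    the factors 2 and 4 come from separating the two summands in its square and its cube.\<close>
  define R where "R \<omega> = (\<eta> * (\<Delta> + 2 * B\<^sup>2 * \<Delta>\<^sup>2) + 4 * C' * B ^ 3 * \<Delta> ^ 3 + K * B\<^sup>2 * \<Delta>\<^sup>2)
     + (2 * \<eta> * B\<^sup>2) * (w \<omega>)\<^sup>2 + (4 * C' * B ^ 3) * \<bar>w \<omega>\<bar> ^ 3" for \<omega>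
  have "\<bar>Y \<omega>\<bar> \<le> R \<omega>" for \<omega>
  proof (cases "P \<omega>")
    case False
    then have "Y \<omega> = 0"
      using AD0[OF False] S'[of \<omega>] V'[of \<omega>] by (simp add: Y_def Z1_def Z2_def)
    moreover have "0 \<le> R \<omega>"
      unfolding R_def using \<eta> C' B K(1) \<Delta> by (intro add_nonneg_nonneg mult_nonneg_nonneg) auto
    ultimately show ?thesis by simp
  next
    case True
    define v where "v = V n i \<omega>"
    define h where "h = A \<omega> * \<Delta> + D \<omega> * w \<omega>"
    have T: "\<bar>g (s + \<Delta>) (v + h) - g s v - gs s v * \<Delta> - gx s v * h - gxx s v * h\<^sup>2 / 2\<bar> \<le> \<eta> * (\<Delta> + h\<^sup>2) + C' * \<bar>h\<bar> ^ 3"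
      using PV(1)[OF True] \<Delta> st unfolding v_def by (intro taylor) auto
    have Yeq: "Y \<omega> = (g (s + \<Delta>) (v + h) - g s v - gs s v * \<Delta> - gx s v * h - gxx s v * h\<^sup>2 / 2)
        + gxx s v * (A \<omega>)\<^sup>2 * \<Delta>\<^sup>2 / 2"
      unfolding Y_def S' V' PV(2)[OF True] Geq[OF True] Z1_def Z2_def v_def[symmetric] h_def[symmetric]
      using True by (simp add: h_def power2_eq_square algebra_simps)
    have h: "\<bar>h\<bar> \<le> B * \<Delta> + B * \<bar>w \<omega>\<bar>"
    proof -
      have "\<bar>A \<omega> * \<Delta>\<bar> \<le> B * \<Delta>" "\<bar>D \<omega> * w \<omega>\<bar> \<le> B * \<bar>w \<omega>\<bar>"
        unfolding abs_mult using AD \<Delta> B by (auto intro!: mult_mono)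
      then show ?thesis
        unfolding h_def by linarith
    qed
    have h2: "h\<^sup>2 \<le> 2 * B\<^sup>2 * \<Delta>\<^sup>2 + 2 * B\<^sup>2 * (w \<omega>)\<^sup>2"
    proof -
      have "h\<^sup>2 \<le> (B * \<Delta> + B * \<bar>w \<omega>\<bar>)\<^sup>2"
        using power_mono[OF h abs_ge_zero, of 2] by simp
      also have "\<dots> \<le> 2 * (B * \<Delta>)\<^sup>2 + 2 * (B * \<bar>w \<omega>\<bar>)\<^sup>2"
        using sum_squares_bound[of "B * \<Delta>" "B * \<bar>w \<omega>\<bar>"] by (simp add: power2_sum)
      finally show ?thesis
        by (simp add: power_mult_distrib)
    qed
    have cube: "(x + y) ^ 3 \<le> 4 * (x ^ 3 + y ^ 3)" if "0 \<le> x" "0 \<le> y" for x y :: real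
    proof -
      have "4 * (x ^ 3 + y ^ 3) - (x + y) ^ 3 = 3 * (x + y) * (x - y)\<^sup>2"
        by (simp add: power2_eq_square power3_eq_cube algebra_simps)
      moreover have "0 \<le> 3 * (x + y) * (x - y)\<^sup>2"
        using that by simp
      ultimately show ?thesis by linarith
    qed
    have h3: "\<bar>h\<bar> ^ 3 \<le> 4 * B ^ 3 * \<Delta> ^ 3 + 4 * B ^ 3 * \<bar>w \<omega>\<bar> ^ 3"
    proof -
      have "\<bar>h\<bar> ^ 3 \<le> (B * \<Delta> + B * \<bar>w \<omega>\<bar>) ^ 3"
        by (rule power_mono[OF h abs_ge_zero])
      also have "\<dots> \<le> 4 * ((B * \<Delta>) ^ 3 + (B * \<bar>w \<omega>\<bar>) ^ 3)"
        using B \<Delta> by (intro cube) auto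
      finally show ?thesis
        by (simp add: power_mult_distrib distrib_left)
    qed
    have "\<bar>gxx s v * (A \<omega>)\<^sup>2 * \<Delta>\<^sup>2 / 2\<bar> \<le> K * B\<^sup>2 * \<Delta>\<^sup>2"
    proof -
      have "(A \<omega>)\<^sup>2 \<le> B\<^sup>2"
        using power_mono[OF AD(1)[of \<omega>] abs_ge_zero, of 2] by simp
      then have "\<bar>gxx s v * (A \<omega>)\<^sup>2 * \<Delta>\<^sup>2\<bar> \<le> K * B\<^sup>2 * \<Delta>\<^sup>2"
        unfolding abs_mult v_def using Kb(3)[OF True] K(1) by (intro mult_mono) auto
      then show ?thesis by linarith
    qed
    then have "\<bar>Y \<omega>\<bar> \<le> \<eta> * (\<Delta> + h\<^sup>2) + C' * \<bar>h\<bar> ^ 3 + K * B\<^sup>2 * \<Delta>\<^sup>2"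
      unfolding Yeq using T by linarith
    also have "\<dots> \<le> \<eta> * (\<Delta> + (2 * B\<^sup>2 * \<Delta>\<^sup>2 + 2 * B\<^sup>2 * (w \<omega>)\<^sup>2)) + C' * (4 * B ^ 3 * \<Delta> ^ 3 + 4 * B ^ 3 * \<bar>w \<omega>\<bar> ^ 3) + K * B\<^sup>2 * \<Delta>\<^sup>2"
      using h2 h3 \<eta> C' by (intro add_mono mult_left_mono order_refl)
    also have "\<dots> = R \<omega>"
      unfolding R_def by (simp add: algebra_simps)
    finally show ?thesis .
  qed
  note YR = this
  note p2 = increment_power[OF st(3,4), of 2, folded w_def] and p3 = increment_power_abs[OF st(3,4), of 3, folded w_def]
  have "\<bar>expectation Y\<bar> \<le> expectation (\<lambda>\<omega>. \<bar>Y \<omega>\<bar>)"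
    by (rule integral_abs_bound)
  also have "\<dots> \<le> expectation R"
    using Y_int p2 p3 YR unfolding R_def[abs_def] by (intro integral_mono) auto
  also have "\<dots> = (\<eta> * (\<Delta> + 2 * B\<^sup>2 * \<Delta>\<^sup>2) + 4 * C' * B ^ 3 * \<Delta> ^ 3 + K * B\<^sup>2 * \<Delta>\<^sup>2)
     + (2 * \<eta> * B\<^sup>2) * expectation (\<lambda>\<omega>. (w \<omega>)\<^sup>2) + (4 * C' * B ^ 3) * expectation (\<lambda>\<omega>. \<bar>w \<omega>\<bar> ^ 3)"
    unfolding R_def[abs_def] using p2 p3 by (simp add: prob_space)
  also have "\<dots> \<le> (\<eta> * (\<Delta> + 2 * B\<^sup>2 * \<Delta>) + 4 * C' * B ^ 3 * \<Delta> ^ 3 + K * B\<^sup>2 * \<Delta>\<^sup>2)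
     + (2 * \<eta> * B\<^sup>2) * \<Delta> + (4 * C' * B ^ 3) * (2 * sqrt \<Delta> ^ 3)"
  proof (intro add_mono mult_left_mono order_refl)
    show "\<Delta>\<^sup>2 \<le> \<Delta>"
      using \<Delta> mult_left_le[of \<Delta> \<Delta>] by (simp add: power2_eq_square)
    show "expectation (\<lambda>\<omega>. (w \<omega>)\<^sup>2) \<le> \<Delta>"
      using expectation_increment_square[OF st(3,4), folded w_def] by simp
    show "expectation (\<lambda>\<omega>. \<bar>w \<omega>\<bar> ^ 3) \<le> 2 * sqrt \<Delta> ^ 3"
      using expectation_increment_cube[OF st(3,4), folded w_def] by simp
  qed (use \<eta> B C' K(1) in auto)
  also have "\<dots> = \<eta> * (1 + 4 * B\<^sup>2) * \<Delta> + 4 * C' * B ^ 3 * (\<Delta> ^ 3 + 2 * sqrt \<Delta> ^ 3) + K * B\<^sup>2 * \<Delta>\<^sup>2"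
    by (simp add: algebra_simps)
  finally have EYle: "\<bar>expectation Y\<bar> \<le> \<eta> * (1 + 4 * B\<^sup>2) * \<Delta> + 4 * C' * B ^ 3 * (\<Delta> ^ 3 + 2 * sqrt \<Delta> ^ 3) + K * B\<^sup>2 * \<Delta>\<^sup>2" .
  have "\<bar>\<Delta> * expectation G\<bar> \<le> \<Delta> * expectation (\<lambda>\<omega>. \<bar>G \<omega>\<bar>)"
    unfolding abs_mult using \<Delta> by (simp add: integral_abs_bound)
  then have "\<bar>expectation (\<lambda>\<omega>. g (S n (Suc i) \<omega>) (V n (Suc i) \<omega>)) - expectation (\<lambda>\<omega>. g (S n i \<omega>) (V n i \<omega>))\<bar>
    \<le> \<Delta> * expectation (\<lambda>\<omega>. \<bar>G \<omega>\<bar>) + (\<eta> * (1 + 4 * B\<^sup>2) * \<Delta> + 4 * C' * B ^ 3 * (\<Delta> ^ 3 + 2 * sqrt \<Delta> ^ 3) + K * B\<^sup>2 * \<Delta>\<^sup>2)"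
    using EYle unfolding EY by linarith
  then show "\<bar>expectation (\<lambda>\<omega>. g (S n (Suc i) \<omega>) (V n (Suc i) \<omega>)) - expectation (\<lambda>\<omega>. g (S n i \<omega>) (V n i \<omega>))\<bar>
      \<le> t / real n * expectation (\<lambda>\<omega>. \<bar>stopped_generator n i \<omega>\<bar>)
        + (\<eta> * (1 + 4 * B\<^sup>2) * (t / real n) + 4 * C' * B ^ 3 * ((t / real n) ^ 3 + 2 * sqrt (t / real n) ^ 3)
           + K * B\<^sup>2 * (t / real n)\<^sup>2)"
    unfolding \<Delta>_def G_def .
qed

section \<open>From the stopped scheme to the solution\<close>

definition bad_prob :: "nat \<Rightarrow> real \<Rightarrow> real" where
  "bad_prob n \<epsilon> = prob {\<omega>\<in>space M. \<not> close n \<epsilon> \<omega>}"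

lemma close_iff: "\<not> close n \<epsilon> \<omega> \<longleftrightarrow> (\<exists>j\<in>{..n}. \<epsilon> < \<bar>X (time n j) \<omega> - euler t n j \<omega>\<bar>)"
  by (simp add: close_def not_le)

lemma close_event: "{\<omega>\<in>space M. \<not> close n \<epsilon> \<omega>} \<in> events"
  unfolding close_iff
proof (rule sets.sets_Collect_finite_Ex)
  fix j assume "j \<in> {..n}"
  then have j: "j \<le> n" by simp
  note [measurable] = X_grid_measurable[OF t j] euler_measurable[OF t j]
  show "{\<omega>\<in>space M. \<epsilon> < \<bar>X (time n j) \<omega> - euler t n j \<omega>\<bar>} \<in> events"
    by measurable
qed simp

lemma bad_prob_tendsto: "0 < \<epsilon> \<Longrightarrow> (\<lambda>n. bad_prob n \<epsilon>) \<longlonglongrightarrow> 0"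
  unfolding bad_prob_def close_iff by (rule euler_convergence[OF t])

text \<open>Uniform continuity on a compact box. It allows the scheme's position \<open>v\<close> to
  be replaced by that of \<open>X\<close>, where the generator is under control, whenever the two
  are close.\<close>

lemma uniform_closeness:
  assumes \<eta>: "0 < \<eta>"
  obtains \<epsilon> where "0 < \<epsilon>" "\<epsilon> \<le> \<eta>" "\<epsilon> \<le> r / 2"
    "\<And>s v x. s \<in> {0..t} \<Longrightarrow> \<bar>v - x0\<bar> \<le> 2 * r \<Longrightarrow> \<bar>x - x0\<bar> \<le> r \<Longrightarrow> \<bar>v - x\<bar> \<le> \<epsilon> \<Longrightarrow>
      \<bar>generator s v x - generator s x x\<bar> \<le> \<eta> \<and> \<bar>g t v - g t x\<bar> \<le> \<eta>"
proof -
  let ?Q = "{0..t} \<times> {x0 - 2 * r..x0 + 2 * r} \<times> {x0 - r..x0 + r}"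
  have Q: "compact ?Q"
    by (intro compact_Times) auto
  have tt: "{0..t} \<subseteq> time_range T"
    by (rule time_range_subset[OF t(1)])
  have c1: "continuous_on ?Q (\<lambda>p. f (fst p) (fst (snd p)))" if f: "continuous_on ({0..t} \<times> UNIV) (\<lambda>(s, x). f s x)" for f :: "real \<Rightarrow> real \<Rightarrow> real"
  proof -
    have "continuous_on ?Q (\<lambda>p. (\<lambda>(s, x). f s x) (fst p, fst (snd p)))"
      by (intro continuous_on_compose2[OF f] continuous_intros) auto
    then show ?thesis by simp
  qed
  have c2: "continuous_on ?Q (\<lambda>p. f (snd (snd p)) (fst p))" if f: "continuous_on (UNIV \<times> time_range T) (\<lambda>(x, t). f x t)" for f :: "real \<Rightarrow> real \<Rightarrow> real"
  proof -
    have "continuous_on ?Q (\<lambda>p. (\<lambda>(x, t). f x t) (snd (snd p), fst p))"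
      using tt by (intro continuous_on_compose2[OF f] continuous_intros) auto
    then show ?thesis by simp
  qed
  have "continuous_on ?Q (\<lambda>p. generator (fst p) (fst (snd p)) (snd (snd p)))"
    unfolding generator_def
    by (intro continuous_intros c1 c2 gs_cont gx_cont gxx_cont a_continuous b_continuous) auto
  from compact_uniformly_continuous[OF this Q] \<eta>
  have "\<exists>\<epsilon>>0. \<forall>p\<in>?Q. \<forall>q\<in>?Q. dist q p < \<epsilon> \<longrightarrow>
      \<bar>generator (fst q) (fst (snd q)) (snd (snd q)) - generator (fst p) (fst (snd p)) (snd (snd p))\<bar> < \<eta>"
    unfolding uniformly_continuous_on_def dist_real_def by simp
  then obtain \<epsilon>1 where \<epsilon>1: "0 < \<epsilon>1" "\<forall>p\<in>?Q. \<forall>q\<in>?Q. dist q p < \<epsilon>1 \<longrightarrow>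
      \<bar>generator (fst q) (fst (snd q)) (snd (snd q)) - generator (fst p) (fst (snd p)) (snd (snd p))\<bar> < \<eta>"
    by (elim exE conjE)
  have gc: "continuous_on UNIV (g t)"
    using g_dx[of t] t(2) by (intro continuous_at_imp_continuous_on ballI DERIV_isCont) auto
  have "\<exists>\<epsilon>>0. \<forall>p\<in>{x0 - 2 * r..x0 + 2 * r}. \<forall>q\<in>{x0 - 2 * r..x0 + 2 * r}. dist q p < \<epsilon> \<longrightarrow> \<bar>g t q - g t p\<bar> < \<eta>"
    using compact_uniformly_continuous[OF continuous_on_subset[OF gc subset_UNIV], of "{x0 - 2 * r..x0 + 2 * r}"] \<eta>
    unfolding uniformly_continuous_on_def dist_real_def by simp
  then obtain \<epsilon>2 where \<epsilon>2: "0 < \<epsilon>2" "\<forall>p\<in>{x0 - 2 * r..x0 + 2 * r}. \<forall>q\<in>{x0 - 2 * r..x0 + 2 * r}. dist q p < \<epsilon>2 \<longrightarrow> \<bar>g t q - g t p\<bar> < \<eta>"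
    by (elim exE conjE)
  define \<epsilon> where "\<epsilon> = min (min \<eta> (r / 2)) (min (\<epsilon>1 / 2) (\<epsilon>2 / 2))"
  have \<epsilon>: "0 < \<epsilon>" "\<epsilon> \<le> \<eta>" "\<epsilon> \<le> r / 2" "\<epsilon> < \<epsilon>1" "\<epsilon> < \<epsilon>2"
    using \<eta> r \<epsilon>1(1) \<epsilon>2(1) by (auto simp: \<epsilon>_def min_def)
  show ?thesis
  proof (rule that[OF \<epsilon>(1-3)])
    fix s v x assume *: "s \<in> {0..t}" "\<bar>v - x0\<bar> \<le> 2 * r" "\<bar>x - x0\<bar> \<le> r" "\<bar>v - x\<bar> \<le> \<epsilon>"
    have v: "v \<in> {x0 - 2 * r..x0 + 2 * r}" and x: "x \<in> {x0 - 2 * r..x0 + 2 * r}" "x \<in> {x0 - r..x0 + r}"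
      using *(2,3) r by (auto simp: abs_le_iff)
    have "dist (s, v, x) (s, x, x) < \<epsilon>1" "dist v x < \<epsilon>2"
      using *(4) \<epsilon>(4,5) by (simp_all add: dist_prod_def dist_real_def)
    moreover have "(s, v, x) \<in> ?Q" "(s, x, x) \<in> ?Q"
      using *(1) v x by simp_all
    ultimately show "\<bar>generator s v x - generator s x x\<bar> \<le> \<eta> \<and> \<bar>g t v - g t x\<bar> \<le> \<eta>"
      using \<epsilon>1(2)[rule_format, of "(s, x, x)" "(s, v, x)"] \<epsilon>2(2)[rule_format, of x v] v x by simp
  qed
qed

text \<open>When scheme and solution are close, the generator is within \<open>\<eta>\<close> of its
  diagonal value, and \<open>\<bar>x - x0\<bar> \<le> \<bar>v - x0\<bar> + \<epsilon>\<close>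
  transfers its bound to the scheme, whose first moment is at most \<open>2 * B * sqrt t\<close>. On
  the bad event the crude bound by the derivatives suffices.\<close>

lemma expectation_generator_le:
  assumes n: "0 < n" "\<bar>x0\<bar> + r \<le> real n" and i: "i < n"
    and K: "0 \<le> K" "\<And>s x. s \<in> {0..t} \<Longrightarrow> \<bar>x - x0\<bar> \<le> 2 * r \<Longrightarrow> \<bar>gs s x\<bar> \<le> K \<and> \<bar>gx s x\<bar> \<le> K \<and> \<bar>gxx s x\<bar> \<le> K"
    and \<epsilon>: "0 < \<epsilon>" "\<And>s v x. s \<in> {0..t} \<Longrightarrow> \<bar>v - x0\<bar> \<le> 2 * r \<Longrightarrow> \<bar>x - x0\<bar> \<le> r \<Longrightarrow> \<bar>v - x\<bar> \<le> \<epsilon> \<Longrightarrow>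
      \<bar>generator s v x - generator s x x\<bar> \<le> \<eta>" and \<eta>: "0 < \<eta>"
  shows "expectation (\<lambda>\<omega>. \<bar>stopped_generator n i \<omega>\<bar>)
    \<le> \<eta> + (K + B * K + B\<^sup>2 * K) * bad_prob n \<epsilon> + C * (2 * B * sqrt t + \<epsilon> + t) * (1 / sqrt (t - time n i))"
proof -
  have i': "i \<le> n" using i by simp
  define s where "s = time n i"
  have "time n i < time n n"
    using i t(2) n(1) by (intro divide_strict_right_mono mult_strict_right_mono) auto
  then have s: "s \<in> {0..t}" "s < t"
    using grid_time_in(1)[OF t i'] n(1) by (simp_all add: s_def)
  define q where "q = 1 / sqrt (t - s)"
  have q: "0 \<le> q" using s by (simp add: q_def)
  define K' where "K' = K + B * K + B\<^sup>2 * K"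
  have K': "0 \<le> K'" using K(1) B by (simp add: K'_def)
  let ?bad = "{\<omega>\<in>space M. \<not> close n \<epsilon> \<omega>}"
  define R where "R \<omega> = \<eta> + K' * indicator ?bad \<omega> + C * q * (\<bar>V n i \<omega> - x0\<bar> + \<epsilon> + t)" for \<omega>
  have le: "\<bar>stopped_generator n i \<omega>\<bar> \<le> R \<omega>" if \<omega>: "\<omega> \<in> space M" for \<omega>
  proof -
    have pos: "0 \<le> C * q * (\<bar>V n i \<omega> - x0\<bar> + \<epsilon> + t)"
      using C q \<epsilon>(1) t(2) by simp
    show ?thesis
    proof (cases "close n \<epsilon> \<omega>")
      case False
      then have "R \<omega> = \<eta> + K' + C * q * (\<bar>V n i \<omega> - x0\<bar> + \<epsilon> + t)"
        using \<omega> by (simp add: R_def)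
      then show ?thesis
        using stopped_generator_bound[OF i' n(2) K, of \<omega>] pos \<eta> unfolding K'_def by linarith
    next
      case True
      then have R: "R \<omega> = \<eta> + C * q * (\<bar>V n i \<omega> - x0\<bar> + \<epsilon> + t)"
        by (simp add: R_def)
      show ?thesis
      proof (cases "inside t r n i \<omega>")
        case False
        then show ?thesis
          using pos \<eta> by (simp add: stopped_generator_def R)
      next
        case ins: True
        define x v where "x = X (time n i) \<omega>" and "v = V n i \<omega>"
        have vx: "\<bar>v - x\<bar> \<le> \<epsilon>"
          using True i' V_inside(1)[OF ins n(2)] unfolding close_def x_def v_def by (simp add: abs_minus_commute)
        have v: "\<bar>v - x0\<bar> \<le> 2 * r"
          unfolding v_def by (rule V_inside(2)[OF ins n(2)])
        have x: "\<bar>x - x0\<bar> \<le> r"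
          unfolding x_def by (rule insideD(1)[OF ins])
        have "\<bar>generator s v x - generator s x x\<bar> \<le> \<eta>"
          by (rule \<epsilon>(2)[OF s(1) v x vx])
        moreover have "\<bar>generator s x x\<bar> \<le> C * (\<bar>x - x0\<bar> + s) * q"
          using generator_bound[of s x] s x unfolding generator_def q_def by simp
        moreover have "C * (\<bar>x - x0\<bar> + s) * q \<le> C * (\<bar>v - x0\<bar> + \<epsilon> + t) * q"
          using vx s C q by (intro mult_right_mono mult_left_mono) auto
        moreover have "stopped_generator n i \<omega> = generator s v x"
          using ins by (simp add: stopped_generator_def s_def v_def x_def)
        ultimately show ?thesis
          unfolding R v_def by (simp add: mult_ac)
      qed
    qed
  qed
  note V1 = stopped_euler_first_moment[OF n(1) i']
  have G_int: "integrable M (\<lambda>\<omega>. \<bar>stopped_generator n i \<omega>\<bar>)"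
    using stopped_generator_bound[OF i' n(2) K]
    by (intro integrable_abs bounded_integrable[OF measurable_F_M[OF stopped_generator_measurable_F[OF i' n(1)]]]) blast
  have ib: "integrable M (indicator ?bad :: 'a \<Rightarrow> real)"
    by (rule integrable_real_indicator[OF close_event]) (simp add: emeasure_eq_measure)
  have "expectation (\<lambda>\<omega>. \<bar>stopped_generator n i \<omega>\<bar>) \<le> expectation R"
    unfolding R_def[abs_def] using V1(1) ib le by (intro integral_mono G_int) (auto simp: R_def)
  also have "\<dots> = \<eta> + K' * bad_prob n \<epsilon> + C * q * (expectation (\<lambda>\<omega>. \<bar>V n i \<omega> - x0\<bar>) + \<epsilon> + t)"
    unfolding R_def[abs_def] bad_prob_def using V1(1) ib close_event by (simp add: prob_space)
  also have "\<dots> \<le> \<eta> + K' * bad_prob n \<epsilon> + C * q * (2 * B * sqrt t + \<epsilon> + t)"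
    using V1(2) C q by (intro add_left_mono mult_left_mono add_right_mono) auto
  finally show ?thesis
    by (simp add: K'_def q_def s_def mult_ac)
qed

text \<open>The two values never differ by more than 2. They are within \<open>\<eta>\<close> once
  the scheme is close to \<open>X\<close> and ends within \<open>r / 2\<close> of \<open>x0\<close>,
  because then it has never been frozen; the complement is paid for by the bad probability and the
  exit probability.\<close>

lemma terminal_comparison:
  assumes n: "0 < n" "\<bar>x0\<bar> + r \<le> real n"
    and \<epsilon>: "0 < \<epsilon>" "\<epsilon> \<le> r / 2" "\<And>v x. \<bar>v - x0\<bar> \<le> 2 * r \<Longrightarrow> \<bar>x - x0\<bar> \<le> r \<Longrightarrow> \<bar>v - x\<bar> \<le> \<epsilon> \<Longrightarrow>
      \<bar>g t v - g t x\<bar> \<le> \<eta>" and \<eta>: "0 < \<eta>"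
  shows "\<bar>expectation (\<lambda>\<omega>. g t (X t \<omega>)) - expectation (\<lambda>\<omega>. g (S n n \<omega>) (V n n \<omega>))\<bar>
    \<le> \<eta> + 2 * bad_prob n \<epsilon> + 2 * (16 * B\<^sup>2 / r\<^sup>2 * t)"
proof -
  let ?bad = "{\<omega>\<in>space M. \<not> close n \<epsilon> \<omega>}" and ?exit = "{\<omega>\<in>space M. r / 2 \<le> \<bar>V n n \<omega> - x0\<bar>}"
  have [measurable]: "V n n \<in> borel_measurable M"
    by (rule measurable_F_M[OF stopped_euler_measurable_F[OF n(1) order_refl]])
  have ex: "?exit \<in> events"
    by measurable
  have tn: "time n n = t"
    using n(1) by simp
  have le: "\<bar>g t (X t \<omega>) - g (S n n \<omega>) (V n n \<omega>)\<bar> \<le> \<eta> + 2 * indicator ?bad \<omega> + 2 * indicator ?exit \<omega>"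
    if \<omega>: "\<omega> \<in> space M" for \<omega>
  proof (cases "close n \<epsilon> \<omega> \<and> \<bar>V n n \<omega> - x0\<bar> < r / 2")
    case False
    have "\<bar>g t (X t \<omega>)\<bar> \<le> 1" "\<bar>g (S n n \<omega>) (V n n \<omega>)\<bar> \<le> 1"
      using g_bound t(2) stopped_clock_range[of n n \<omega>] by auto
    moreover have "1 \<le> (indicator ?bad \<omega> + indicator ?exit \<omega> :: real)"
      using False \<omega> by (auto simp: indicator_def)
    ultimately show ?thesis
      using \<eta> by linarith
  next
    case True
    have ins: "inside t r n n \<omega>"
    proof (rule ccontr)
      assume "\<not> inside t r n n \<omega>"
      then have exj: "\<exists>j. j \<le> n \<and> \<not> inside t r n j \<omega>" by blast
      define j where "j = (LEAST j. j \<le> n \<and> \<not> inside t r n j \<omega>)"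
      have j: "j \<le> n" "\<not> inside t r n j \<omega>"
        using LeastI_ex[OF exj] unfolding j_def by blast+
      have before: "inside t r n k \<omega>" if "k < j" for k
        using not_less_Least[of k "\<lambda>j. j \<le> n \<and> \<not> inside t r n j \<omega>"] that j(1) unfolding j_def by force
      have V: "V n n \<omega> = euler t n j \<omega>"
        using stopped_euler_outside[OF j(2,1)] stopped_euler_inside[OF before n(2)] by simp
      have cl: "\<bar>X (time n j) \<omega> - euler t n j \<omega>\<bar> \<le> \<epsilon>"
        using True j(1) by (auto simp: close_def)
      have out: "\<not> (\<bar>X (time n j) \<omega> - x0\<bar> \<le> r \<and> \<bar>euler t n j \<omega> - x0\<bar> \<le> 2 * r)"
      proof
        assume *: "\<bar>X (time n j) \<omega> - x0\<bar> \<le> r \<and> \<bar>euler t n j \<omega> - x0\<bar> \<le> 2 * r"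
        have "inside t r n j \<omega>"
          unfolding inside_def
        proof
          fix k assume "k \<in> {..j}"
          then show "\<bar>X (time n k) \<omega> - x0\<bar> \<le> r \<and> \<bar>euler t n k \<omega> - x0\<bar> \<le> 2 * r"
            using * insideD[OF before[of k]] by (cases "k = j") auto
        qed
        then show False using j(2) by blast
      qed
      have "\<bar>euler t n j \<omega> - x0\<bar> < r / 2"
        using True V by simp
      then show False
        using out cl \<epsilon>(2) r by linarith
    qed
    have "\<bar>V n n \<omega> - X t \<omega>\<bar> \<le> \<epsilon>"
      using True V_inside(1)[OF ins n(2)] tn unfolding close_def by (auto simp: abs_minus_commute dest!: bspec[of _ _ n])
    moreover have "\<bar>X t \<omega> - x0\<bar> \<le> r"
      using insideD(1)[OF ins] tn by simp
    ultimately have "\<bar>g t (V n n \<omega>) - g t (X t \<omega>)\<bar> \<le> \<eta>"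
      using V_inside(2)[OF ins n(2)] by (intro \<epsilon>(3))
    moreover have "S n n \<omega> = t"
      using V_inside(3)[OF ins n(2)] tn by simp
    ultimately show ?thesis
      by (simp add: abs_minus_commute indicator_def)
  qed
  have gt: "continuous_on UNIV (g t)"
    using g_dx[of t] t(2) by (intro continuous_at_imp_continuous_on ballI DERIV_isCont) auto
  have i1: "integrable M (\<lambda>\<omega>. g t (X t \<omega>))"
  proof (rule bounded_integrable)
    show "(\<lambda>\<omega>. g t (X t \<omega>)) \<in> borel_measurable M"
      by (rule measurable_compose[OF X_measurable[OF t(1)] borel_measurable_continuous_onI[OF gt]])
    show "\<bar>g t (X t \<omega>)\<bar> \<le> 1" for \<omega>
      using g_bound[of t] t(2) by simp
  qed
  note i2 = stopped_g_integrable[OF order_refl n(1)]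
  have ib: "integrable M (indicator ?bad :: 'a \<Rightarrow> real)" "integrable M (indicator ?exit :: 'a \<Rightarrow> real)"
    by (rule integrable_real_indicator[OF close_event] integrable_real_indicator[OF ex], simp add: emeasure_eq_measure)+
  have "\<bar>expectation (\<lambda>\<omega>. g t (X t \<omega>)) - expectation (\<lambda>\<omega>. g (S n n \<omega>) (V n n \<omega>))\<bar>
    = \<bar>expectation (\<lambda>\<omega>. g t (X t \<omega>) - g (S n n \<omega>) (V n n \<omega>))\<bar>"
    using i1 i2 by simp
  also have "\<dots> \<le> expectation (\<lambda>\<omega>. \<bar>g t (X t \<omega>) - g (S n n \<omega>) (V n n \<omega>)\<bar>)"
    by (rule integral_abs_bound)
  also have "\<dots> \<le> expectation (\<lambda>\<omega>. \<eta> + 2 * indicator ?bad \<omega> + 2 * indicator ?exit \<omega>)"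
    using i1 i2 ib le by (intro integral_mono) auto
  also have "\<dots> = \<eta> + 2 * bad_prob n \<epsilon> + 2 * prob ?exit"
    using ib close_event ex by (simp add: prob_space bad_prob_def)
  also have "\<dots> \<le> \<eta> + 2 * bad_prob n \<epsilon> + 2 * (16 * B\<^sup>2 / r\<^sup>2 * t)"
    using stopped_euler_exit_prob[OF n(1)] by (intro add_left_mono mult_left_mono) auto
  finally show ?thesis .
qed

end

context smooth_test_function
begin

text \<open>The one-step estimates are summed. The first moment, of order sqrt t, meets the singular
  sum, also of order sqrt t, which gives order t; the exit probability gives the other term. First
  the mesh tends to 0 for fixed \<open>\<eta>\<close>, then \<open>\<eta>\<close> tends to
  0.\<close>

lemma dynkin_estimate:
  "\<bar>expectation (\<lambda>\<omega>. g t (X t \<omega>)) - g 0 x0\<bar> \<le> (32 * B\<^sup>2 / r\<^sup>2 + 2 * C * (2 * B + 1)) * t"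
proof -
  define L where "L = \<bar>expectation (\<lambda>\<omega>. g t (X t \<omega>)) - g 0 x0\<bar>"
  define c where "c = (32 * B\<^sup>2 / r\<^sup>2 + 2 * C * (2 * B + 1)) * t"
  \<comment> \<open>\<open>Q\<close> collects the coefficients of \<open>\<eta>\<close> in the sum
    below; \<open>\<epsilon>\<close> is estimated by \<open>\<eta>\<close> there.\<close>
  define Q where "Q = t + 2 * C * sqrt t + (1 + 4 * B\<^sup>2) * t + 1"
  have Q: "0 < Q"
    using t(2) C by (simp add: Q_def add_nonneg_pos)
  obtain K where K: "0 \<le> K" "\<And>s x. s \<in> {0..t} \<Longrightarrow> \<bar>x - x0\<bar> \<le> 2 * r \<Longrightarrow> \<bar>gs s x\<bar> \<le> K \<and> \<bar>gx s x\<bar> \<le> K \<and> \<bar>gxx s x\<bar> \<le> K"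
    using derivative_bounds by blast
  have main: "L \<le> c + Q * \<eta>" if \<eta>: "0 < \<eta>" for \<eta>
  proof -
    obtain \<epsilon> where \<epsilon>: "0 < \<epsilon>" "\<epsilon> \<le> \<eta>" "\<epsilon> \<le> r / 2"
      and cl: "\<And>s v x. s \<in> {0..t} \<Longrightarrow> \<bar>v - x0\<bar> \<le> 2 * r \<Longrightarrow> \<bar>x - x0\<bar> \<le> r \<Longrightarrow> \<bar>v - x\<bar> \<le> \<epsilon> \<Longrightarrow>
        \<bar>generator s v x - generator s x x\<bar> \<le> \<eta> \<and> \<bar>g t v - g t x\<bar> \<le> \<eta>"
      using uniform_closeness[OF \<eta>] by blast
    obtain \<kappa> C' where \<kappa>: "0 < \<kappa>" and C': "0 \<le> C'" and taylor:
      "\<And>s d x h. 0 \<le> s \<Longrightarrow> 0 < d \<Longrightarrow> d \<le> \<kappa> \<Longrightarrow> s + d \<le> t \<Longrightarrow> \<bar>x - x0\<bar> \<le> 2 * r \<Longrightarrow>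
      \<bar>g (s + d) (x + h) - g s x - gs s x * d - gx s x * h - gxx s x * h\<^sup>2 / 2\<bar> \<le> \<eta> * (d + h\<^sup>2) + C' * \<bar>h\<bar> ^ 3"
      using taylor_remainder[OF r gs_cont gx_cont gxx_cont g_ds g_dx g_dxx g_bound \<eta>] by blast
    define K' where "K' = K + B * K + B\<^sup>2 * K"
    \<comment> \<open>This is \<open>n\<close> times the part of the one-step error that does not
      carry \<open>\<eta>\<close>; being of order 3/2 in the step, it sums to something that tends
      to 0.\<close>
    define e where "e n = t * (4 * C' * B ^ 3 * ((t / real n)\<^sup>2 + 2 * sqrt (t / real n)) + K * B\<^sup>2 * (t / real n))" for n :: nat
    define p where "p n = bad_prob n \<epsilon>" for n
    define main where "main = t * \<eta> + C * (2 * B * sqrt t + \<epsilon> + t) * (2 * sqrt t) + \<eta> * (1 + 4 * B\<^sup>2) * t + \<eta> + 2 * (16 * B\<^sup>2 / r\<^sup>2 * t)"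
    have bound: "L \<le> main + (t * K' * p n + e n + 2 * p n)" if n: "0 < n" "\<bar>x0\<bar> + r \<le> real n" "t / real n \<le> \<kappa>" for n
    proof -
      define \<Delta> where "\<Delta> = t / real n"
      have \<Delta>: "0 < \<Delta>" "real n * \<Delta> = t"
        using t(2) n(1) by (simp_all add: \<Delta>_def)
      define E where "E i = expectation (\<lambda>\<omega>. g (S n i \<omega>) (V n i \<omega>))" for i
      define st where "st = \<eta> * (1 + 4 * B\<^sup>2) * \<Delta> + 4 * C' * B ^ 3 * (\<Delta> ^ 3 + 2 * sqrt \<Delta> ^ 3) + K * B\<^sup>2 * \<Delta>\<^sup>2"
      have step: "\<bar>E (Suc i) - E i\<bar> \<le> \<Delta> * (\<eta> + K' * p n) + C * (2 * B * sqrt t + \<epsilon> + t) * (\<Delta> * (1 / sqrt (t - time n i))) + st"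
        if i: "i < n" for i
      proof -
        have "\<bar>E (Suc i) - E i\<bar> \<le> \<Delta> * expectation (\<lambda>\<omega>. \<bar>stopped_generator n i \<omega>\<bar>) + st"
          unfolding E_def st_def \<Delta>_def by (rule step_expectation(2)[OF n(1,2) i n(3) K less_imp_le[OF \<eta>] C' taylor])
        also have "\<Delta> * expectation (\<lambda>\<omega>. \<bar>stopped_generator n i \<omega>\<bar>)
          \<le> \<Delta> * (\<eta> + K' * p n + C * (2 * B * sqrt t + \<epsilon> + t) * (1 / sqrt (t - time n i)))"
          unfolding K'_def p_def
          by (intro mult_left_mono expectation_generator_le[OF n(1,2) i K \<epsilon>(1) cl[THEN conjunct1] \<eta>] less_imp_le[OF \<Delta>(1)])
        finally show ?thesis
          by (simp add: algebra_simps)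
      qed
      have "E n - E 0 = (\<Sum>i<n. E (Suc i) - E i)"
        by (rule sum_lessThan_telescope[symmetric])
      then have "\<bar>E n - E 0\<bar> \<le> (\<Sum>i<n. \<bar>E (Suc i) - E i\<bar>)"
        by simp
      also have "\<dots> \<le> (\<Sum>i<n. \<Delta> * (\<eta> + K' * p n) + C * (2 * B * sqrt t + \<epsilon> + t) * (\<Delta> * (1 / sqrt (t - time n i))) + st)"
        by (intro sum_mono step) simp
      also have "\<dots> = real n * \<Delta> * (\<eta> + K' * p n) + C * (2 * B * sqrt t + \<epsilon> + t) * (\<Sum>i<n. \<Delta> * (1 / sqrt (t - time n i))) + real n * st"
        by (simp add: sum.distrib sum_distrib_left)
      also have "\<dots> \<le> real n * \<Delta> * (\<eta> + K' * p n) + C * (2 * B * sqrt t + \<epsilon> + t) * (2 * sqrt t) + real n * st"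
        using C B \<epsilon>(1) t(2) grid_singular_sum_le[OF t(2) n(1)] unfolding \<Delta>_def
        by (intro add_mono mult_left_mono order_refl) auto
      also have "real n * st = \<eta> * (1 + 4 * B\<^sup>2) * t + e n"
      proof -
        have "sqrt \<Delta> ^ 3 = \<Delta> * sqrt \<Delta>"
          using \<Delta>(1) by (simp add: power3_eq_cube)
        then have "real n * st = \<eta> * (1 + 4 * B\<^sup>2) * (real n * \<Delta>)
          + (real n * \<Delta>) * (4 * C' * B ^ 3 * (\<Delta>\<^sup>2 + 2 * sqrt \<Delta>) + K * B\<^sup>2 * \<Delta>)"
          unfolding st_def by (simp add: power3_eq_cube power2_eq_square algebra_simps)
        then show ?thesis
          unfolding e_def \<Delta>_def[symmetric] \<Delta>(2) .
      qed
      finally have 1: "\<bar>E n - E 0\<bar> \<le> t * (\<eta> + K' * p n) + C * (2 * B * sqrt t + \<epsilon> + t) * (2 * sqrt t) + (\<eta> * (1 + 4 * B\<^sup>2) * t + e n)"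
        unfolding \<Delta>(2) .
      have 2: "\<bar>expectation (\<lambda>\<omega>. g t (X t \<omega>)) - E n\<bar> \<le> \<eta> + 2 * p n + 2 * (16 * B\<^sup>2 / r\<^sup>2 * t)"
        unfolding E_def p_def
      proof (rule terminal_comparison[OF n(1,2) \<epsilon>(1,3) _ \<eta>])
        show "\<bar>g t v - g t x\<bar> \<le> \<eta>" if "\<bar>v - x0\<bar> \<le> 2 * r" "\<bar>x - x0\<bar> \<le> r" "\<bar>v - x\<bar> \<le> \<epsilon>" for v x
          using cl[OF _ that, of t] t(2) by simp
      qed
      have "E 0 = g 0 x0"
        by (simp add: E_def stopped_clock_def stopped_euler_def elementary_integral_def prob_space)
      then show ?thesis
        using 1 2 unfolding L_def main_def by (simp add: algebra_simps)
    qed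
    have tn: "(\<lambda>n. t / real n) \<longlonglongrightarrow> 0"
      by (rule lim_const_over_n)
    have "(\<lambda>n. sqrt (t / real n)) \<longlonglongrightarrow> 0"
      using tendsto_real_sqrt[OF tn] by simp
    then have "e \<longlonglongrightarrow> t * (4 * C' * B ^ 3 * (0\<^sup>2 + 2 * 0) + K * B\<^sup>2 * 0)"
      unfolding e_def by (intro tendsto_intros tn)
    moreover have p0: "p \<longlonglongrightarrow> 0"
      unfolding p_def by (rule bad_prob_tendsto[OF \<epsilon>(1)])
    ultimately have "(\<lambda>n. main + (t * K' * p n + e n + 2 * p n)) \<longlonglongrightarrow>
        main + (t * K' * 0 + t * (4 * C' * B ^ 3 * (0\<^sup>2 + 2 * 0) + K * B\<^sup>2 * 0) + 2 * 0)"
      by (intro tendsto_add tendsto_mult tendsto_const)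
    then have "(\<lambda>n. main + (t * K' * p n + e n + 2 * p n)) \<longlonglongrightarrow> main"
      by simp
    moreover have "\<forall>\<^sub>F n in sequentially. L \<le> main + (t * K' * p n + e n + 2 * p n)"
    proof -
      have "\<forall>\<^sub>F n in sequentially. t / real n < \<kappa>"
        using order_tendstoD(2)[OF tn \<kappa>] .
      moreover have "\<forall>\<^sub>F n in sequentially. \<bar>x0\<bar> + r \<le> real n"
        using filterlim_real_sequentially by (simp add: filterlim_at_top)
      ultimately show ?thesis
        using eventually_gt_at_top[of "0 :: nat"] by eventually_elim (intro bound; simp)
    qed
    ultimately have "L \<le> main"
      by (intro tendsto_lowerbound[of _ main sequentially]) auto
    also have "main \<le> c + Q * \<eta>"
    proof -
      have "C * (2 * B * sqrt t + \<epsilon> + t) * (2 * sqrt t) \<le> 2 * C * (2 * B + 1) * t + 2 * C * sqrt t * \<eta>"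
      proof -
        have s: "sqrt t * sqrt t = t" "sqrt t \<le> 1"
          using t(2) t1 by simp_all
        have "C * (2 * B * sqrt t + \<epsilon> + t) * (2 * sqrt t) = 4 * B * C * (sqrt t * sqrt t) + 2 * C * sqrt t * \<epsilon> + 2 * C * (t * sqrt t)"
          by (simp add: algebra_simps)
        also have "\<dots> \<le> 4 * B * C * t + 2 * C * sqrt t * \<eta> + 2 * C * t"
          unfolding s(1) using C t(2) s(2) \<epsilon>(2) by (intro add_mono mult_left_mono mult_left_le order_refl) auto
        finally show ?thesis
          by (simp add: algebra_simps)
      qed
      then show ?thesis
        unfolding main_def c_def Q_def by (simp add: algebra_simps)
    qed
    finally show ?thesis .
  qed
  have "L \<le> c + \<delta>" if "0 < \<delta>" for \<delta>
    using main[of "\<delta> / Q"] that Q by simp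
  then show ?thesis
    unfolding L_def c_def by (rule field_le_epsilon)
qed

end

section \<open>The standard normal distribution function\<close>

interpretation std_normal: real_distribution std_normal_distribution
  by (rule real_dist_normal_dist)

lemma std_normal_cdf_integral:
  assumes "x < y"
  shows "std_normal_cdf y - std_normal_cdf x = integral {x..y} std_normal_density"
proof -
  have c: "continuous_on {x..y} std_normal_density"
    unfolding normal_density_def by (intro continuous_intros) auto
  have si: "set_integrable lborel {x..y} std_normal_density"
    by (rule borel_integrable_compact[OF compact_Icc c, folded set_integrable_def])
  have "std_normal_cdf y - std_normal_cdf x = measure std_normal_distribution {x<..y}"
    unfolding std_normal_cdf_def by (rule std_normal.cdf_diff_eq[OF assms])
  also have "\<dots> = (\<integral>z. indicator {x<..y} z \<partial>std_normal_distribution)"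
    by simp
  also have "\<dots> = (\<integral>z. std_normal_density z * indicator {x<..y} z \<partial>lborel)"
    by (subst integral_density) (auto simp: normal_density_nonneg)
  also have "\<dots> = (LINT z:{x..y}|lborel. std_normal_density z)"
    unfolding set_lebesgue_integral_def
    using AE_lborel_singleton[of x]
    by (intro integral_cong_AE) (auto simp: indicator_def elim!: eventually_mono)
  also have "\<dots> = integral {x..y} std_normal_density"
    using si by (rule set_borel_integral_eq_integral)
  finally show ?thesis .
qed

lemma std_normal_cdf_has_derivative [derivative_intros]:
  "(std_normal_cdf has_real_derivative std_normal_density x) (at x)"
proof -
  have c: "continuous_on {x - 1..x + 1} std_normal_density"
    unfolding normal_density_def by (intro continuous_intros) auto
  have "((\<lambda>y. std_normal_cdf (x - 1) + integral {x - 1..y} std_normal_density) has_real_derivative std_normal_density x)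
      (at x within {x - 1..x + 1})"
    by (auto intro!: derivative_eq_intros integral_has_real_derivative[OF c])
  moreover have "at x within {x - 1..x + 1} = at x"
    by (rule at_within_interior) (simp add: interior_atLeastAtMost_real)
  ultimately have "((\<lambda>y. std_normal_cdf (x - 1) + integral {x - 1..y} std_normal_density) has_real_derivative std_normal_density x) (at x)"
    by simp
  moreover have "\<forall>\<^sub>F y in nhds x. std_normal_cdf (x - 1) + integral {x - 1..y} std_normal_density = std_normal_cdf y"
  proof -
    have "\<forall>\<^sub>F y in nhds x. y \<in> {x - 1<..}"
      by (intro eventually_nhds_in_open) auto
    then show ?thesis
      by eventually_elim (simp add: std_normal_cdf_integral[symmetric])
  qed
  ultimately show ?thesis
    by (rule DERIV_cong_ev[OF refl _ refl, THEN iffD1, rotated])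
qed

lemma std_normal_cdf_bounds: "0 \<le> std_normal_cdf x" "std_normal_cdf x \<le> 1" "\<bar>std_normal_cdf x\<bar> \<le> 1"
  using std_normal.cdf_nonneg[of x] std_normal.cdf_bounded_prob[of x] by (simp_all add: std_normal_cdf_def)

lemma std_normal_cdf_at_top: "(std_normal_cdf \<longlongrightarrow> 1) at_top"
  unfolding std_normal_cdf_def by (rule std_normal.cdf_lim_at_top_prob)

lemma std_normal_cdf_at_bot: "(std_normal_cdf \<longlongrightarrow> 0) at_bot"
  unfolding std_normal_cdf_def by (rule std_normal.cdf_lim_at_bot)

lemma std_normal_cdf_isCont: "isCont std_normal_cdf x"
  using std_normal_cdf_has_derivative by (rule DERIV_isCont)

lemma std_normal_cdf_strict_mono: "strict_mono std_normal_cdf"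
proof (rule strict_monoI)
  fix x y :: real assume "x < y"
  then show "std_normal_cdf x < std_normal_cdf y"
  proof (rule DERIV_pos_imp_increasing)
    show "\<exists>d. (std_normal_cdf has_real_derivative d) (at z) \<and> 0 < d" for z
      using std_normal_cdf_has_derivative[of z] normal_density_pos[of 1 0 z] by (intro exI[of _ "std_normal_density z"]) simp
  qed
qed

lemma std_normal_density_has_derivative [derivative_intros]:
  "(std_normal_density has_real_derivative - x * std_normal_density x) (at x)"
proof -
  have "((\<lambda>x. c * exp (- x\<^sup>2 / 2)) has_real_derivative - x * (c * exp (- x\<^sup>2 / 2))) (at x)" for c :: real
    by (auto intro!: derivative_eq_intros)
  from this[of "1 / sqrt (2 * pi)"] show ?thesis
    by (simp add: normal_density_def[abs_def])
qed

lemma std_normal_density_le_1: "std_normal_density x \<le> 1"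
proof -
  have "1 / sqrt (2 * pi) \<le> 1"
    using pi_gt3 by (simp add: real_le_rsqrt divide_le_eq_1)
  moreover have "exp (- x\<^sup>2 / 2) \<le> 1"
    by simp
  ultimately have "1 / sqrt (2 * pi) * exp (- x\<^sup>2 / 2) \<le> 1 * 1"
    by (intro mult_mono) auto
  then show ?thesis
    by (simp add: normal_density_def)
qed

lemma std_normal_cdf_inverse:
  assumes "0 < \<alpha>" "\<alpha> < 1"
  shows "std_normal_cdf (inv std_normal_cdf \<alpha>) = \<alpha>"
proof -
  obtain l where l: "std_normal_cdf l < \<alpha>"
    using order_tendstoD(2)[OF std_normal_cdf_at_bot assms(1)] by (auto dest: eventually_happens)
  obtain u where u: "\<alpha> < std_normal_cdf u"
    using order_tendstoD(1)[OF std_normal_cdf_at_top assms(2)] by (auto dest: eventually_happens)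
  have "l \<le> u"
    using less_trans[OF l u] by (simp add: strict_mono_less[OF std_normal_cdf_strict_mono])
  then have "\<exists>x\<ge>l. x \<le> u \<and> std_normal_cdf x = \<alpha>"
    using l u std_normal_cdf_isCont by (intro IVT) auto
  then show ?thesis
    by (metis f_inv_into_f rangeI)
qed

lemma std_normal_cdf_inv [simp]: "inv std_normal_cdf (std_normal_cdf z) = z"
  by (rule inv_f_f[OF strict_mono_imp_inj_on[OF std_normal_cdf_strict_mono]])

text \<open>By the symmetry of the density the sum of the values at z and -z has derivative 0; its
  limit at infinity is 1.\<close>

lemma std_normal_cdf_0: "std_normal_cdf 0 = 1 / 2"
proof -
  have "std_normal_cdf z + std_normal_cdf (- z) = 2 * std_normal_cdf 0" for z
  proof -
    have "((\<lambda>z. std_normal_cdf z + std_normal_cdf (- z)) has_real_derivative 0) (at z)" for z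
      by (auto intro!: derivative_eq_intros DERIV_chain2[OF std_normal_cdf_has_derivative] simp: normal_density_def)
    then have "std_normal_cdf z + std_normal_cdf (- z) = std_normal_cdf 0 + std_normal_cdf (- 0)"
      by (intro DERIV_isconst_all) blast
    then show ?thesis by simp
  qed
  moreover have "((\<lambda>z. std_normal_cdf z + std_normal_cdf (- z)) \<longlongrightarrow> 1 + 0) at_top"
    by (intro tendsto_add std_normal_cdf_at_top filterlim_compose[OF std_normal_cdf_at_bot filterlim_uminus_at_bot_at_top])
  ultimately have "((\<lambda>z :: real. 2 * std_normal_cdf 0) \<longlongrightarrow> 1) at_top"
    by simp
  then show ?thesis
    using tendsto_const_iff[of "at_top :: real filter" "2 * std_normal_cdf 0" 1] by simp
qed

section \<open>Coordinates with unit diffusion\<close>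

text \<open>Only the square of the diffusion coefficient in the new coordinate is prescribed, which
  leaves its sign free. \<open>drift_bound\<close> expresses that the drift in this coordinate
  vanishes at the origin at a linear rate.\<close>

locale unit_diffusion_coordinate = sde M F W T a b x0 X
  for M :: "'a measure" and F W T a b x0 X +
  fixes \<psi> \<psi>s \<psi>x \<psi>xx :: "real \<Rightarrow> real \<Rightarrow> real" and r C t1 :: real
  assumes \<psi>_cont: "continuous_on (time_range T \<times> UNIV) (\<lambda>(s, x). \<psi> s x)"
    and \<psi>s_cont: "continuous_on (time_range T \<times> UNIV) (\<lambda>(s, x). \<psi>s s x)"
    and \<psi>x_cont: "continuous_on (time_range T \<times> UNIV) (\<lambda>(s, x). \<psi>x s x)"
    and \<psi>xx_cont: "continuous_on (time_range T \<times> UNIV) (\<lambda>(s, x). \<psi>xx s x)"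
    and \<psi>_ds: "\<And>s x. s \<in> time_range T \<Longrightarrow> ((\<lambda>s. \<psi> s x) has_real_derivative \<psi>s s x) (at s within time_range T)"
    and \<psi>_dx: "\<And>s x. s \<in> time_range T \<Longrightarrow> (\<psi> s has_real_derivative \<psi>x s x) (at x)"
    and \<psi>_dxx: "\<And>s x. s \<in> time_range T \<Longrightarrow> (\<psi>x s has_real_derivative \<psi>xx s x) (at x)"
    and unit_diffusion: "\<And>s x. s \<in> time_range T \<Longrightarrow> (b x s * \<psi>x s x)\<^sup>2 = 1"
    and origin: "\<psi> 0 x0 = 0"
    and r: "0 < r" and C: "0 \<le> C" and t1: "0 < t1" "t1 \<le> 1" "t1 \<in> time_range T"
    and drift_bound: "\<And>s x. s \<in> {0..t1} \<Longrightarrow> \<bar>x - x0\<bar> \<le> r \<Longrightarrow>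
      \<bar>\<psi>s s x + a x s * \<psi>x s x + (b x s)\<^sup>2 / 2 * \<psi>xx s x\<bar> \<le> C * (\<bar>x - x0\<bar> + s)"
begin

lemma coefficients_bounded:
  obtains B where "0 < B" "\<And>s x. s \<in> {0..t1} \<Longrightarrow> \<bar>x - x0\<bar> \<le> r \<Longrightarrow> \<bar>a x s\<bar> \<le> B \<and> \<bar>b x s\<bar> \<le> B"
proof -
  let ?Q = "{x0 - r..x0 + r} \<times> {0..t1}"
  have bdd: "\<exists>B. \<forall>p\<in>?Q. \<bar>f p\<bar> \<le> B" if "continuous_on (UNIV \<times> time_range T) f" for f :: "real \<times> real \<Rightarrow> real"
  proof -
    have "continuous_on ?Q f"
      by (rule continuous_on_subset[OF that Sigma_mono[OF subset_UNIV time_range_subset[OF t1(3)]]])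
    then have "bounded (f ` ?Q)"
      by (intro compact_imp_bounded compact_continuous_image compact_Times) auto
    then show ?thesis
      unfolding bounded_iff by auto
  qed
  obtain B1 where B1: "\<forall>p\<in>?Q. \<bar>(\<lambda>(x, t). a x t) p\<bar> \<le> B1"
    using bdd[OF a_continuous] by (rule exE)
  obtain B2 where B2: "\<forall>p\<in>?Q. \<bar>(\<lambda>(x, t). b x t) p\<bar> \<le> B2"
    using bdd[OF b_continuous] by (rule exE)
  show ?thesis
  proof (rule that[of "max 1 (max B1 B2)"])
    fix s x assume "s \<in> {0..t1}" "\<bar>x - x0\<bar> \<le> r"
    then have sx: "(x, s) \<in> ?Q" by (auto simp: abs_le_iff)
    show "\<bar>a x s\<bar> \<le> max 1 (max B1 B2) \<and> \<bar>b x s\<bar> \<le> max 1 (max B1 B2)"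
      using B1[rule_format, OF sx] B2[rule_format, OF sx] by (simp add: le_max_iff_disj)
  qed simp
qed

text \<open>The parameter \<open>e\<close> moves the singularity of the heat kernel beyond time
  \<open>t\<close>, so that the test function is regular up to \<open>t\<close>. The bound is free
  of \<open>e\<close>, because 1 / sqrt (t + e - s) is at most the integrable weight 1 / sqrt (t -
  s).\<close>

lemma smoothed_estimate:
  assumes B: "0 < B" "\<And>s x. s \<in> {0..t1} \<Longrightarrow> \<bar>x - x0\<bar> \<le> r \<Longrightarrow> \<bar>a x s\<bar> \<le> B \<and> \<bar>b x s\<bar> \<le> B"
    and t: "0 < t" "t \<le> t1" and e: "0 < e"
  shows "\<bar>expectation (\<lambda>\<omega>. std_normal_cdf ((k - \<psi> t (X t \<omega>)) / sqrt e)) - std_normal_cdf (k / sqrt (t + e))\<bar>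
    \<le> (32 * B\<^sup>2 / r\<^sup>2 + 2 * C * (2 * B + 1)) * t"
proof -
  let ?\<phi> = std_normal_density
  define \<rho> where "\<rho> s = sqrt (t + e - s)" for s
  define \<theta> where "\<theta> s x = (k - \<psi> s x) / \<rho> s" for s x
  define g where "g s x = std_normal_cdf (\<theta> s x)" for s x
  define gs where "gs s x = ?\<phi> (\<theta> s x) * (- \<psi>s s x / \<rho> s + \<theta> s x / (2 * (\<rho> s)\<^sup>2))" for s x
  define gx where "gx s x = - ?\<phi> (\<theta> s x) * \<psi>x s x / \<rho> s" for s x
  define gxx where "gxx s x = - ?\<phi> (\<theta> s x) * \<psi>xx s x / \<rho> s - \<theta> s x * ?\<phi> (\<theta> s x) * (\<psi>x s x)\<^sup>2 / (\<rho> s)\<^sup>2" for s x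
  have t_in: "t \<in> time_range T"
    using time_range_subset[OF t1(3)] t by auto
  have sub: "{0..t} \<subseteq> time_range T"
    by (rule time_range_subset[OF t_in])
  have \<rho>: "0 < \<rho> s" "(\<rho> s)\<^sup>2 = t + e - s" if "s \<in> {0..t}" for s
    using that e by (simp_all add: \<rho>_def)
  have cf: "continuous_on ({0..t} \<times> UNIV) (\<lambda>p. f (fst p) (snd p))"
    if f: "continuous_on (time_range T \<times> UNIV) (\<lambda>(s, x). f s x)" for f :: "real \<Rightarrow> real \<Rightarrow> real"
    using continuous_on_subset[OF f Sigma_mono[OF sub order_refl]] by (simp add: split_beta')
  note c\<psi> = cf[OF \<psi>_cont] cf[OF \<psi>s_cont] cf[OF \<psi>x_cont] cf[OF \<psi>xx_cont]
  have c\<rho>: "continuous_on ({0..t} \<times> UNIV) (\<lambda>p :: real \<times> real. \<rho> (fst p))"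
    unfolding \<rho>_def by (intro continuous_intros)
  have \<rho>0: "\<rho> (fst p) \<noteq> 0" if "p \<in> {0..t} \<times> UNIV" for p :: "real \<times> real"
    using \<rho>(1)[of "fst p"] that by auto
  have c\<theta>: "continuous_on ({0..t} \<times> UNIV) (\<lambda>p. \<theta> (fst p) (snd p))"
    unfolding \<theta>_def using \<rho>0 by (intro continuous_intros c\<psi> c\<rho>) auto
  have c\<phi>: "continuous_on ({0..t} \<times> UNIV) (\<lambda>p. ?\<phi> (\<theta> (fst p) (snd p)))"
    unfolding normal_density_def by (intro continuous_intros c\<theta>) auto
  have c\<Phi>: "continuous_on ({0..t} \<times> UNIV) (\<lambda>p. std_normal_cdf (\<theta> (fst p) (snd p)))"
    by (rule continuous_on_compose2[OF _ c\<theta> subset_UNIV])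
      (intro continuous_at_imp_continuous_on ballI std_normal_cdf_isCont)
  interpret smooth_test_function M F W T a b x0 X t r B g gs gx gxx C
  proof
    show "t \<in> time_range T" "0 < t" "t \<le> 1" "0 < r" "0 < B" "0 \<le> C"
      using t_in t t1 r B C by simp_all
    show "\<bar>a x s\<bar> \<le> B \<and> \<bar>b x s\<bar> \<le> B" if "s \<in> {0..t}" "\<bar>x - x0\<bar> \<le> r" for s x
      using that t by (intro B(2)) auto
    show "continuous_on ({0..t} \<times> UNIV) (\<lambda>(s, x). g s x)"
      using c\<Phi> by (simp add: g_def split_beta')
    show "continuous_on ({0..t} \<times> UNIV) (\<lambda>(s, x). gs s x)"
      unfolding gs_def split_beta' using \<rho>0
      by (intro continuous_intros c\<psi> c\<rho> c\<theta> c\<phi>) auto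
    show "continuous_on ({0..t} \<times> UNIV) (\<lambda>(s, x). gx s x)"
      unfolding gx_def split_beta' using \<rho>0
      by (intro continuous_intros c\<psi> c\<rho> c\<theta> c\<phi>) auto
    show "continuous_on ({0..t} \<times> UNIV) (\<lambda>(s, x). gxx s x)"
      unfolding gxx_def split_beta' using \<rho>0
      by (intro continuous_intros c\<psi> c\<rho> c\<theta> c\<phi>) auto
    show "\<bar>g s x\<bar> \<le> 1" for s x
      unfolding g_def by (rule std_normal_cdf_bounds)
  next
    fix s x assume s: "s \<in> {0..t}"
    then have sT: "s \<in> time_range T" using sub by blast
    have \<rho>s: "\<rho> s \<noteq> 0" using \<rho>(1)[OF s] by simp
    have "((\<lambda>s. t + e - s) has_real_derivative - 1) (at s within {0..t})"
      by (auto intro!: derivative_eq_intros)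
    then have "(\<rho> has_real_derivative inverse (sqrt (t + e - s)) / 2 * - 1) (at s within {0..t})"
      unfolding \<rho>_def using s e by (intro DERIV_chain2[OF DERIV_real_sqrt]) auto
    then have d\<rho>: "(\<rho> has_real_derivative - (1 / (2 * \<rho> s))) (at s within {0..t})"
      by (simp add: \<rho>_def inverse_eq_divide mult.commute)
    have "((\<lambda>s. \<psi> s x) has_real_derivative \<psi>s s x) (at s within {0..t})"
      by (rule has_field_derivative_subset[OF \<psi>_ds[OF sT] sub])
    then have "((\<lambda>s. \<theta> s x) has_real_derivative (- \<psi>s s x / \<rho> s + \<theta> s x / (2 * (\<rho> s)\<^sup>2))) (at s within {0..t})"
      unfolding \<theta>_def using \<rho>s
      by (auto intro!: derivative_eq_intros d\<rho> simp: field_simps power2_eq_square)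
    then show "((\<lambda>s. g s x) has_real_derivative gs s x) (at s within {0..t})"
      unfolding g_def gs_def by (rule DERIV_chain2[OF std_normal_cdf_has_derivative])
    have \<theta>x: "(\<theta> s has_real_derivative - (\<psi>x s x / \<rho> s)) (at x)"
      unfolding \<theta>_def using \<rho>s by (auto intro!: derivative_eq_intros \<psi>_dx[OF sT])
    then have "(g s has_real_derivative ?\<phi> (\<theta> s x) * - (\<psi>x s x / \<rho> s)) (at x)"
      unfolding g_def by (rule DERIV_chain2[OF std_normal_cdf_has_derivative])
    then show "(g s has_real_derivative gx s x) (at x)"
      by (simp add: gx_def)
    have "((\<lambda>x. ?\<phi> (\<theta> s x)) has_real_derivative (- \<theta> s x * ?\<phi> (\<theta> s x)) * - (\<psi>x s x / \<rho> s)) (at x)"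
      using \<theta>x by (rule DERIV_chain2[OF std_normal_density_has_derivative])
    then show "(gx s has_real_derivative gxx s x) (at x)"
      unfolding gx_def gxx_def using \<rho>s
      by (auto intro!: derivative_eq_intros \<psi>_dxx[OF sT] simp: field_simps power2_eq_square)
  next
    fix s x assume s: "0 \<le> s" "s < t" and x: "\<bar>x - x0\<bar> \<le> r"
    have sI: "s \<in> {0..t}" using s by simp
    have sT: "s \<in> time_range T" using sI sub by blast
    have \<rho>s: "0 < \<rho> s" "sqrt (t - s) \<le> \<rho> s"
      using \<rho>(1)[OF sI] e by (simp_all add: \<rho>_def)
    have u: "(b x s)\<^sup>2 * (\<psi>x s x)\<^sup>2 = 1"
      using unit_diffusion[OF sT, of x] by (simp add: power_mult_distrib)
    \<comment> \<open>The last summand is the heat equation in the coordinate \<open>\<psi>\<close>;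
      it vanishes because the diffusion is of unit size. The drift remains, weighted by the density,
      which is at most 1, over \<open>\<rho> s\<close>.\<close>
    have "gs s x + a x s * gx s x + (b x s)\<^sup>2 / 2 * gxx s x
      = - (?\<phi> (\<theta> s x) / \<rho> s) * (\<psi>s s x + a x s * \<psi>x s x + (b x s)\<^sup>2 / 2 * \<psi>xx s x)
        + ?\<phi> (\<theta> s x) * \<theta> s x / (2 * (\<rho> s)\<^sup>2) * (1 - (b x s)\<^sup>2 * (\<psi>x s x)\<^sup>2)"
      unfolding gs_def gx_def gxx_def using \<rho>s(1) by (simp add: field_simps power2_eq_square)
    then have eq: "gs s x + a x s * gx s x + (b x s)\<^sup>2 / 2 * gxx s x
      = - (?\<phi> (\<theta> s x) / \<rho> s) * (\<psi>s s x + a x s * \<psi>x s x + (b x s)\<^sup>2 / 2 * \<psi>xx s x)"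
      unfolding u by simp
    have q: "0 \<le> ?\<phi> (\<theta> s x) / \<rho> s" "?\<phi> (\<theta> s x) / \<rho> s \<le> 1 / sqrt (t - s)"
      using \<rho>s s std_normal_density_le_1[of "\<theta> s x"] normal_density_nonneg[of 0 1 "\<theta> s x"]
      by (auto intro!: frac_le)
    have "\<bar>- (?\<phi> (\<theta> s x) / \<rho> s) * (\<psi>s s x + a x s * \<psi>x s x + (b x s)\<^sup>2 / 2 * \<psi>xx s x)\<bar>
      \<le> (1 / sqrt (t - s)) * (C * (\<bar>x - x0\<bar> + s))"
      unfolding abs_mult abs_minus_cancel abs_of_nonneg[OF q(1)]
      using q drift_bound[of s x] s t x by (intro mult_mono) auto
    then show "\<bar>gs s x + a x s * gx s x + (b x s)\<^sup>2 / 2 * gxx s x\<bar> \<le> C * (\<bar>x - x0\<bar> + s) / sqrt (t - s)"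
      unfolding eq by simp
  qed
  show ?thesis
    using dynkin_estimate by (simp add: g_def \<theta>_def \<rho>_def origin)
qed

text \<open>The indicator of \<open>Y \<le> k\<close> is caught between smoothed steps: on this
  event the argument of the step shifted to \<open>k + \<delta>\<close> is at least 1 / \<delta>,
  and off it the argument of the step shifted to \<open>k - \<delta>\<close> is at most -1 /
  \<delta>. As \<delta> tends to 0 these errors vanish while the constant stays the same.\<close>

lemma cdf_estimate:
  obtains C' where "\<And>t k. 0 < t \<Longrightarrow> t \<le> t1 \<Longrightarrow>
    \<bar>prob {\<omega>\<in>space M. \<psi> t (X t \<omega>) \<le> k} - std_normal_cdf (k / sqrt t)\<bar> \<le> C' * t"
proof -
  obtain B where B: "0 < B" "\<And>s x. s \<in> {0..t1} \<Longrightarrow> \<bar>x - x0\<bar> \<le> r \<Longrightarrow> \<bar>a x s\<bar> \<le> B \<and> \<bar>b x s\<bar> \<le> B"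
    using coefficients_bounded by blast
  define C' where "C' = 32 * B\<^sup>2 / r\<^sup>2 + 2 * C * (2 * B + 1)"
  show ?thesis
  proof (rule that[of C'])
    fix t k :: real assume t: "0 < t" "t \<le> t1"
    have t_in: "t \<in> time_range T"
      using time_range_subset[OF t1(3)] t by auto
    have \<psi>c: "continuous_on UNIV (\<psi> t)"
      using \<psi>_dx[OF t_in] by (intro continuous_at_imp_continuous_on ballI DERIV_isCont) auto
    have Ym [measurable]: "(\<lambda>\<omega>. \<psi> t (X t \<omega>)) \<in> borel_measurable M"
      by (rule measurable_compose[OF X_measurable[OF t_in] borel_measurable_continuous_onI[OF \<psi>c]])
    define Y where "Y \<omega> = \<psi> t (X t \<omega>)" for \<omega>
    have [measurable]: "Y \<in> borel_measurable M"
      using Ym by (simp add: Y_def[abs_def])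
    define p where "p = prob {\<omega>\<in>space M. Y \<omega> \<le> k}"
    have \<Phi>m [measurable]: "std_normal_cdf \<in> borel_measurable borel"
      by (intro borel_measurable_continuous_onI continuous_at_imp_continuous_on ballI std_normal_cdf_isCont)
    have int: "integrable M (\<lambda>\<omega>. std_normal_cdf ((m - Y \<omega>) / d))" for m d
      by (rule bounded_integrable[OF _ std_normal_cdf_bounds(3)]) measurable
    \<comment> \<open>Smoothing on the scale \<open>\<delta>\<^sup>2\<close> while \<open>k\<close> is shifted by the larger \<open>\<delta>\<close>.\<close>
    have est: "\<bar>expectation (\<lambda>\<omega>. std_normal_cdf ((m - Y \<omega>) / \<delta>\<^sup>2)) - std_normal_cdf (m / sqrt (t + \<delta> ^ 4))\<bar> \<le> C' * t"
      if "0 < \<delta>" for m \<delta>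
    proof -
      have "sqrt (\<delta> ^ 4) = \<delta>\<^sup>2"
        using that by (intro real_sqrt_unique) (auto simp: power_mult[symmetric])
      then show ?thesis
        using smoothed_estimate[OF B t, of "\<delta> ^ 4" m] that by (simp add: Y_def C'_def)
    qed
    have mono: "std_normal_cdf x \<le> std_normal_cdf y" if "x \<le> y" for x y
      using that by (simp add: strict_mono_less_eq[OF std_normal_cdf_strict_mono])
    have ind: "integrable M (indicator {\<omega>\<in>space M. Y \<omega> \<le> k} :: 'a \<Rightarrow> real)"
      by (rule integrable_real_indicator) (simp_all add: emeasure_eq_measure)
    have Eind: "expectation (indicator {\<omega>\<in>space M. Y \<omega> \<le> k} :: 'a \<Rightarrow> real) = p"
      by (simp add: p_def)
    have upper: "p * std_normal_cdf (1 / \<delta>) \<le> std_normal_cdf ((k + \<delta>) / sqrt (t + \<delta> ^ 4)) + C' * t" if \<delta>: "0 < \<delta>" for \<delta>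
    proof -
      have "p * std_normal_cdf (1 / \<delta>) = expectation (\<lambda>\<omega>. indicator {\<omega>\<in>space M. Y \<omega> \<le> k} \<omega> * std_normal_cdf (1 / \<delta>))"
        using ind Eind by simp
      also have "\<dots> \<le> expectation (\<lambda>\<omega>. std_normal_cdf ((k + \<delta> - Y \<omega>) / \<delta>\<^sup>2))"
      proof (rule integral_mono[OF _ int])
        fix \<omega>
        show "indicator {\<omega>\<in>space M. Y \<omega> \<le> k} \<omega> * std_normal_cdf (1 / \<delta>) \<le> std_normal_cdf ((k + \<delta> - Y \<omega>) / \<delta>\<^sup>2)"
        proof (cases "Y \<omega> \<le> k")
          case True
          then have "\<delta> / \<delta>\<^sup>2 \<le> (k + \<delta> - Y \<omega>) / \<delta>\<^sup>2"
            by (intro divide_right_mono) auto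
          then have "1 / \<delta> \<le> (k + \<delta> - Y \<omega>) / \<delta>\<^sup>2"
            using \<delta> by (simp add: power2_eq_square)
          from mono[OF this] show ?thesis
            using std_normal_cdf_bounds(1)[of "(k + \<delta> - Y \<omega>) / \<delta>\<^sup>2"] by (auto simp: indicator_def)
        qed (use std_normal_cdf_bounds in simp)
      qed (use ind in simp)
      finally show ?thesis
        using est[OF \<delta>, of "k + \<delta>"] by linarith
    qed
    have lower: "std_normal_cdf ((k - \<delta>) / sqrt (t + \<delta> ^ 4)) - C' * t \<le> p + std_normal_cdf (- (1 / \<delta>))" if \<delta>: "0 < \<delta>" for \<delta>
    proof -
      have "expectation (\<lambda>\<omega>. std_normal_cdf ((k - \<delta> - Y \<omega>) / \<delta>\<^sup>2))
        \<le> expectation (\<lambda>\<omega>. indicator {\<omega>\<in>space M. Y \<omega> \<le> k} \<omega> + std_normal_cdf (- (1 / \<delta>)))"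
      proof (rule integral_mono[OF int])
        fix \<omega> assume \<omega>: "\<omega> \<in> space M"
        show "std_normal_cdf ((k - \<delta> - Y \<omega>) / \<delta>\<^sup>2) \<le> indicator {\<omega>\<in>space M. Y \<omega> \<le> k} \<omega> + std_normal_cdf (- (1 / \<delta>))"
        proof (cases "Y \<omega> \<le> k")
          case True
          then show ?thesis
            using \<omega> std_normal_cdf_bounds(1)[of "- (1 / \<delta>)"] std_normal_cdf_bounds(2)[of "(k - \<delta> - Y \<omega>) / \<delta>\<^sup>2"] by simp
        next
          case False
          then have "(k - \<delta> - Y \<omega>) / \<delta>\<^sup>2 \<le> (- \<delta>) / \<delta>\<^sup>2"
            by (intro divide_right_mono) auto
          then have "(k - \<delta> - Y \<omega>) / \<delta>\<^sup>2 \<le> - (1 / \<delta>)"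
            using \<delta> by (simp add: power2_eq_square)
          from mono[OF this] show ?thesis
            by (auto simp: indicator_def intro: order_trans)
        qed
      qed (use ind in simp)
      also have "\<dots> = p + std_normal_cdf (- (1 / \<delta>))"
        using ind Eind by (simp add: prob_space)
      finally show ?thesis
        using est[OF \<delta>, of "k - \<delta>"] by linarith
    qed
    have inv: "filterlim (\<lambda>\<delta> :: real. 1 / \<delta>) at_top (at_right 0)"
      using filterlim_inverse_at_top_right by (simp add: inverse_eq_divide)
    have l1: "((\<lambda>\<delta>. std_normal_cdf (1 / \<delta>)) \<longlongrightarrow> 1) (at_right 0)"
      by (rule filterlim_compose[OF std_normal_cdf_at_top inv])
    have l2: "((\<lambda>\<delta>. std_normal_cdf (- (1 / \<delta>))) \<longlongrightarrow> 0) (at_right 0)"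
      by (rule filterlim_compose[OF std_normal_cdf_at_bot]) (rule filterlim_compose[OF filterlim_uminus_at_bot_at_top inv])
    have id: "((\<lambda>\<delta> :: real. \<delta>) \<longlongrightarrow> 0) (at_right 0)"
      by (rule tendsto_ident_at)
    have st0: "sqrt (t + 0 ^ 4) \<noteq> 0"
      using t by simp
    have l3: "((\<lambda>\<delta>. std_normal_cdf ((k + \<delta>) / sqrt (t + \<delta> ^ 4))) \<longlongrightarrow> std_normal_cdf ((k + 0) / sqrt (t + 0 ^ 4))) (at_right 0)"
      by (intro isCont_tendsto_compose[OF std_normal_cdf_isCont] tendsto_intros id st0)
    have l4: "((\<lambda>\<delta>. std_normal_cdf ((k - \<delta>) / sqrt (t + \<delta> ^ 4))) \<longlongrightarrow> std_normal_cdf ((k - 0) / sqrt (t + 0 ^ 4))) (at_right 0)"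
      by (intro isCont_tendsto_compose[OF std_normal_cdf_isCont] tendsto_intros id st0)
    have pos: "\<forall>\<^sub>F \<delta> in at_right (0 :: real). 0 < \<delta>"
      by (rule eventually_at_right_less)
    have "p * 1 \<le> std_normal_cdf ((k + 0) / sqrt (t + 0 ^ 4)) + C' * t"
    proof (rule tendsto_le[OF trivial_limit_at_right_real])
      show "((\<lambda>\<delta>. std_normal_cdf ((k + \<delta>) / sqrt (t + \<delta> ^ 4)) + C' * t) \<longlongrightarrow> std_normal_cdf ((k + 0) / sqrt (t + 0 ^ 4)) + C' * t) (at_right 0)"
        by (intro tendsto_add l3 tendsto_const)
      show "((\<lambda>\<delta>. p * std_normal_cdf (1 / \<delta>)) \<longlongrightarrow> p * 1) (at_right 0)"
        by (intro tendsto_mult l1 tendsto_const)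
      show "\<forall>\<^sub>F \<delta> in at_right 0. p * std_normal_cdf (1 / \<delta>) \<le> std_normal_cdf ((k + \<delta>) / sqrt (t + \<delta> ^ 4)) + C' * t"
        using pos by eventually_elim (rule upper)
    qed
    moreover have "std_normal_cdf ((k - 0) / sqrt (t + 0 ^ 4)) - C' * t \<le> p + 0"
    proof (rule tendsto_le[OF trivial_limit_at_right_real])
      show "((\<lambda>\<delta>. p + std_normal_cdf (- (1 / \<delta>))) \<longlongrightarrow> p + 0) (at_right 0)"
        by (intro tendsto_add l2 tendsto_const)
      show "((\<lambda>\<delta>. std_normal_cdf ((k - \<delta>) / sqrt (t + \<delta> ^ 4)) - C' * t) \<longlongrightarrow> std_normal_cdf ((k - 0) / sqrt (t + 0 ^ 4)) - C' * t) (at_right 0)"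
        by (intro tendsto_diff l4 tendsto_const)
      show "\<forall>\<^sub>F \<delta> in at_right 0. std_normal_cdf ((k - \<delta>) / sqrt (t + \<delta> ^ 4)) - C' * t \<le> p + std_normal_cdf (- (1 / \<delta>))"
        using pos by eventually_elim (rule lower)
    qed
    ultimately show "\<bar>prob {\<omega>\<in>space M. \<psi> t (X t \<omega>) \<le> k} - std_normal_cdf (k / sqrt t)\<bar> \<le> C' * t"
      unfolding p_def Y_def by (simp add: abs_le_iff)
  qed
qed

end

section \<open>The Lamperti coordinate\<close>

lemma partial_derivative_snd:
  fixes f :: "real \<times> real \<Rightarrow> real"
  assumes f: "(f has_derivative (\<lambda>h. p * fst h + q * snd h)) (at (s, x) within A \<times> B)" and s: "s \<in> A"
  shows "((\<lambda>x. f (s, x)) has_real_derivative q) (at x within B)"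
proof -
  have "((\<lambda>x. (s, x)) has_derivative (\<lambda>h. (0, h))) (at x within B)"
    by (auto intro!: derivative_eq_intros)
  moreover have "(f has_derivative (\<lambda>h. p * fst h + q * snd h)) (at (s, x) within (\<lambda>x. (s, x)) ` B)"
    using s by (intro has_derivative_subset[OF f]) auto
  ultimately have "((\<lambda>x. f (s, x)) has_derivative (\<lambda>h. p * fst (0 :: real, h) + q * snd (0 :: real, h))) (at x within B)"
    by (rule has_derivative_in_compose)
  then show ?thesis
    by (simp add: has_field_derivative_def)
qed

lemma partial_derivative_fst:
  fixes f :: "real \<times> real \<Rightarrow> real"
  assumes f: "(f has_derivative (\<lambda>h. p * fst h + q * snd h)) (at (s, x) within A \<times> B)" and x: "x \<in> B"
  shows "((\<lambda>s. f (s, x)) has_real_derivative p) (at s within A)"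
proof -
  have "((\<lambda>s. (s, x)) has_derivative (\<lambda>h. (h, 0))) (at s within A)"
    by (auto intro!: derivative_eq_intros)
  moreover have "(f has_derivative (\<lambda>h. p * fst h + q * snd h)) (at (s, x) within (\<lambda>s. (s, x)) ` A)"
    using x by (intro has_derivative_subset[OF f]) auto
  ultimately have "((\<lambda>s. f (s, x)) has_derivative (\<lambda>h. p * fst (h, 0 :: real) + q * snd (h, 0 :: real))) (at s within A)"
    by (rule has_derivative_in_compose)
  then show ?thesis
    by (simp add: has_field_derivative_def)
qed

text \<open>The definition of the derivative with accuracy 1 bounds the increment by
  \<open>1 + K\<close> times the displacement, where \<open>K\<close> bounds the derivative. Working
  within \<open>S\<close> admits points on the boundary t = 0.\<close>

lemma differentiable_lipschitz_at:
  fixes f :: "real \<times> real \<Rightarrow> real"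
  assumes "f differentiable (at (s0, x0) within S)"
  obtains d K where "0 < d" "0 \<le> K"
    "\<And>s x. (s, x) \<in> S \<Longrightarrow> \<bar>s - s0\<bar> + \<bar>x - x0\<bar> < d \<Longrightarrow> \<bar>f (s, x) - f (s0, x0)\<bar> \<le> K * (\<bar>s - s0\<bar> + \<bar>x - x0\<bar>)"
proof -
  from assms obtain f' where "(f has_derivative f') (at (s0, x0) within S)"
    unfolding differentiable_def by blast
  then have bl: "bounded_linear f'" and lim: "\<forall>e>0. \<exists>d>0. \<forall>y\<in>S. norm (y - (s0, x0)) < d \<longrightarrow>
      norm (f y - f (s0, x0) - f' (y - (s0, x0))) \<le> e * norm (y - (s0, x0))"
    unfolding has_derivative_within_alt by blast+
  obtain d where d: "0 < d" "\<forall>y\<in>S. norm (y - (s0, x0)) < d \<longrightarrow>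
      norm (f y - f (s0, x0) - f' (y - (s0, x0))) \<le> 1 * norm (y - (s0, x0))"
    using lim[rule_format, of 1] by auto
  obtain K where K: "0 \<le> K" "\<And>h. norm (f' h) \<le> norm h * K"
    using bounded_linear.nonneg_bounded[OF bl] by blast
  show ?thesis
  proof (rule that[of d "1 + K"])
    fix s x assume sx: "(s, x) \<in> S" "\<bar>s - s0\<bar> + \<bar>x - x0\<bar> < d"
    define h where "h = (s, x) - (s0, x0)"
    have nh: "norm h \<le> \<bar>s - s0\<bar> + \<bar>x - x0\<bar>"
      by (simp add: h_def norm_prod_def sqrt_sum_squares_le_sum_abs)
    then have "norm (f (s, x) - f (s0, x0) - f' h) \<le> 1 * norm h"
      using d(2) sx unfolding h_def by (meson le_less_trans)
    then have "\<bar>f (s, x) - f (s0, x0)\<bar> \<le> (1 + K) * norm h"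
      using K(2)[of h] unfolding real_norm_def by (simp add: algebra_simps)
    also have "\<dots> \<le> (1 + K) * (\<bar>s - s0\<bar> + \<bar>x - x0\<bar>)"
      using nh K(1) by (intro mult_left_mono) auto
    finally show "\<bar>f (s, x) - f (s0, x0)\<bar> \<le> (1 + K) * (\<bar>s - s0\<bar> + \<bar>x - x0\<bar>)" .
  qed (use d K in auto)
qed

lemma taylor_cubic_bound:
  fixes f f1 f2 f3 :: "real \<Rightarrow> real"
  assumes "\<And>x. (f has_real_derivative f1 x) (at x)" "\<And>x. (f1 has_real_derivative f2 x) (at x)"
    "\<And>x. (f2 has_real_derivative f3 x) (at x)" "continuous_on UNIV f3"
  obtains K where "0 \<le> K" "\<And>h. \<bar>h\<bar> \<le> 1 \<Longrightarrow> \<bar>f (x0 + h) - (f x0 + f1 x0 * h + f2 x0 / 2 * h\<^sup>2)\<bar> \<le> K * \<bar>h\<bar> ^ 3"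
proof -
  have "compact (f3 ` {x0 - 1..x0 + 1})"
    by (intro compact_continuous_image continuous_on_subset[OF assms(4)]) auto
  then obtain B where B: "\<forall>y\<in>f3 ` {x0 - 1..x0 + 1}. norm y \<le> B"
    by (rule compact_imp_bounded[THEN bounded_iff[THEN iffD1], THEN exE])
  show ?thesis
  proof (rule that[of "max 0 B"])
    fix h :: real assume h: "\<bar>h\<bar> \<le> 1"
    show "\<bar>f (x0 + h) - (f x0 + f1 x0 * h + f2 x0 / 2 * h\<^sup>2)\<bar> \<le> max 0 B * \<bar>h\<bar> ^ 3"
    proof (cases "h = 0")
      case False
      define D where "D m = (if m = 0 then f else if m = 1 then f1 else if m = 2 then f2 else f3)" for m :: nat
      have "\<exists>y. (if x0 + h < x0 then x0 + h < y \<and> y < x0 else x0 < y \<and> y < x0 + h) \<and>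
        f (x0 + h) = (\<Sum>m<3. D m x0 / fact m * (x0 + h - x0) ^ m) + D 3 y / fact 3 * (x0 + h - x0) ^ 3"
      proof (rule Taylor[of 3 D f "min x0 (x0 + h)" "max x0 (x0 + h)"])
        show "\<forall>m t. m < 3 \<and> min x0 (x0 + h) \<le> t \<and> t \<le> max x0 (x0 + h) \<longrightarrow> (D m has_real_derivative D (Suc m) t) (at t)"
        proof (intro allI impI)
          fix m :: nat and t assume "m < 3 \<and> min x0 (x0 + h) \<le> t \<and> t \<le> max x0 (x0 + h)"
          then have "m = 0 \<or> m = 1 \<or> m = 2" by auto
          then show "(D m has_real_derivative D (Suc m) t) (at t)"
            using assms(1-3) by (elim disjE) (simp_all add: D_def)
        qed
      qed (use False in \<open>auto simp: D_def\<close>)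
      then obtain y where y: "(if x0 + h < x0 then x0 + h < y \<and> y < x0 else x0 < y \<and> y < x0 + h)"
        and eq: "f (x0 + h) = (\<Sum>m<3. D m x0 / fact m * (x0 + h - x0) ^ m) + D 3 y / fact 3 * (x0 + h - x0) ^ 3"
        by blast
      have "y \<in> {x0 - 1..x0 + 1}"
        using y h by (auto split: if_splits)
      then have f3: "\<bar>f3 y\<bar> \<le> B"
        using B by auto
      have "f (x0 + h) - (f x0 + f1 x0 * h + f2 x0 / 2 * h\<^sup>2) = f3 y / 6 * h ^ 3"
        using eq by (simp add: D_def numeral_3_eq_3 fact_numeral power2_eq_square)
      moreover have "\<bar>f3 y / 6 * h ^ 3\<bar> \<le> max 0 B * \<bar>h\<bar> ^ 3"
        unfolding abs_mult power_abs using f3 by (intro mult_right_mono) (auto simp: le_max_iff_disj)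
      ultimately show ?thesis
        by simp
    qed simp
  qed simp
qed

text \<open>The density decreases with the modulus, so its value at \<open>\<bar>z\<bar> + 1\<close>
  bounds it from below on the unit interval around \<open>z\<close>. This linear growth converts an
  error in probability into one in the argument.\<close>

lemma std_normal_cdf_growth:
  obtains \<mu> where "0 < \<mu>" "\<And>h. 0 \<le> h \<Longrightarrow> h \<le> 1 \<Longrightarrow> std_normal_cdf z + \<mu> * h \<le> std_normal_cdf (z + h)"
    "\<And>h. 0 \<le> h \<Longrightarrow> h \<le> 1 \<Longrightarrow> std_normal_cdf (z - h) \<le> std_normal_cdf z - \<mu> * h"
proof -
  define \<mu> where "\<mu> = std_normal_density (\<bar>z\<bar> + 1)"
  have \<mu>: "0 < \<mu>"
    unfolding \<mu>_def by (rule normal_density_pos) simp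
  have ge: "\<mu> \<le> std_normal_density w" if "\<bar>w\<bar> \<le> \<bar>z\<bar> + 1" for w
  proof -
    have "w\<^sup>2 \<le> (\<bar>z\<bar> + 1)\<^sup>2"
      using power_mono[OF that abs_ge_zero, of 2] by simp
    then show ?thesis
      unfolding \<mu>_def normal_density_def by (intro mult_left_mono) auto
  qed
  have incr: "std_normal_cdf x + \<mu> * (y - x) \<le> std_normal_cdf y" if "x \<le> y" "\<bar>x\<bar> \<le> \<bar>z\<bar> + 1" "\<bar>y\<bar> \<le> \<bar>z\<bar> + 1" for x y
  proof (cases "x = y")
    case False
    then have "x < y" using that by simp
    then obtain w where w: "x < w" "w < y" "std_normal_cdf y - std_normal_cdf x = (y - x) * std_normal_density w"
      using MVT2[of x y std_normal_cdf std_normal_density] std_normal_cdf_has_derivative by blast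
    have "\<mu> * (y - x) \<le> std_normal_density w * (y - x)"
      using w(1,2) that by (intro mult_right_mono ge) auto
    then show ?thesis
      using w(3) by (simp add: mult.commute)
  qed simp
  show ?thesis
  proof (rule that[OF \<mu>])
    fix h :: real assume h: "0 \<le> h" "h \<le> 1"
    show "std_normal_cdf z + \<mu> * h \<le> std_normal_cdf (z + h)"
      using incr[of z "z + h"] h abs_triangle_ineq[of z h] by simp
    show "std_normal_cdf (z - h) \<le> std_normal_cdf z - \<mu> * h"
      using incr[of "z - h" z] h abs_triangle_ineq4[of z h] by simp
  qed
qed

text \<open>Monotonicity of the distribution function. Strict inequality at \<open>l\<close> keeps
  every point below \<open>l\<close> out of the set whose infimum is the quantile.\<close>

lemma (in prob_space) quantile_between:
  assumes X: "X \<in> borel_measurable M" and l: "prob {\<omega>\<in>space M. X \<omega> \<le> l} < \<alpha>" and u: "\<alpha> \<le> prob {\<omega>\<in>space M. X \<omega> \<le> u}"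
  shows "l \<le> quantile M X \<alpha>" "quantile M X \<alpha> \<le> u"
proof -
  have cdf: "cdf (distr M borel X) x = prob {\<omega>\<in>space M. X \<omega> \<le> x}" for x
    unfolding cdf_def using X by (subst measure_distr) (auto intro!: arg_cong[where f = prob])
  have mem: "u \<in> {x. \<alpha> \<le> cdf (distr M borel X) x}"
    using u by (simp add: cdf)
  have lb: "l \<le> x" if "x \<in> {x. \<alpha> \<le> cdf (distr M borel X) x}" for x
  proof (rule ccontr)
    assume "\<not> l \<le> x"
    then have "prob {\<omega>\<in>space M. X \<omega> \<le> x} \<le> prob {\<omega>\<in>space M. X \<omega> \<le> l}"
      using X by (intro finite_measure_mono) auto
    then show False
      using that l by (simp add: cdf)
  qed
  show "l \<le> quantile M X \<alpha>"
    unfolding quantile_def using mem lb by (intro cInf_greatest) blast+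
  show "quantile M X \<alpha> \<le> u"
    unfolding quantile_def using mem lb by (intro cInf_lower bdd_belowI[of _ l])
qed

text \<open>
  \<open>P\<close>, \<open>A\<close>, \<open>Q\<close> are the families of partial derivatives of \<open>\<phi>\<close>, \<open>a\<close>, \<open>b\<close> provided by \<open>smooth_on\<close>;
  the arguments of \<open>P\<close> are in the order \<open>(t, x)\<close>, those of \<open>A\<close> and \<open>Q\<close> in the order \<open>(x, t)\<close>.
\<close>
locale lamperti_sde = sde M F W T a b x0 X
  for M :: "'a measure" and F W T a b x0 X +
  fixes \<phi> :: "real \<Rightarrow> real \<Rightarrow> real" and P A Q :: "nat \<Rightarrow> nat \<Rightarrow> real \<times> real \<Rightarrow> real"
  assumes T_pos: "0 < T"
    and P_0: "\<And>s x. s \<in> time_range T \<Longrightarrow> P 0 0 (s, x) = \<phi> s x"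
    and P_deriv: "\<And>i j s x. s \<in> time_range T \<Longrightarrow>
      (P i j has_derivative (\<lambda>h. P (Suc i) j (s, x) * fst h + P i (Suc j) (s, x) * snd h)) (at (s, x) within time_range T \<times> UNIV)"
    and A_0: "\<And>s x. s \<in> time_range T \<Longrightarrow> A 0 0 (x, s) = a x s"
    and A_deriv: "\<And>i j s x. s \<in> time_range T \<Longrightarrow>
      (A i j has_derivative (\<lambda>h. A (Suc i) j (x, s) * fst h + A i (Suc j) (x, s) * snd h)) (at (x, s) within UNIV \<times> time_range T)"
    and Q_0: "\<And>s x. s \<in> time_range T \<Longrightarrow> Q 0 0 (x, s) = b x s"
    and Q_deriv: "\<And>i j s x. s \<in> time_range T \<Longrightarrow>
      (Q i j has_derivative (\<lambda>h. Q (Suc i) j (x, s) * fst h + Q i (Suc j) (x, s) * snd h)) (at (x, s) within UNIV \<times> time_range T)"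
    and b_nonzero: "\<And>s x. s \<in> time_range T \<Longrightarrow> b x s \<noteq> 0"
    and \<phi>_primitive: "\<And>s x. s \<in> time_range T \<Longrightarrow> (\<phi> s has_real_derivative 1 / b x s) (at x)"
begin

lemma zero_in: "0 \<in> time_range T"
  using T_pos by (simp add: time_range_def zero_ereal_def[symmetric])

lemma P_continuous: "continuous_on (time_range T \<times> UNIV) (P i j)"
  by (rule has_derivative_continuous_on) (auto intro: P_deriv)

lemma P_ds: "s \<in> time_range T \<Longrightarrow> ((\<lambda>s. P i j (s, x)) has_real_derivative P (Suc i) j (s, x)) (at s within time_range T)"
  by (rule partial_derivative_fst[OF P_deriv]) simp_all

lemma P_dx: "s \<in> time_range T \<Longrightarrow> ((\<lambda>x. P i j (s, x)) has_real_derivative P i (Suc j) (s, x)) (at x)"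
  by (rule partial_derivative_snd[OF P_deriv])

lemma P_01: "s \<in> time_range T \<Longrightarrow> P 0 (Suc 0) (s, x) = 1 / b x s"
proof -
  assume s: "s \<in> time_range T"
  then have "(\<lambda>x. P 0 0 (s, x)) = \<phi> s"
    using P_0 by (intro ext)
  then show ?thesis
    using DERIV_unique[OF P_dx[OF s, of 0 0 x]] \<phi>_primitive[OF s, of x] by simp
qed

definition b0' :: real where "b0' = deriv (\<lambda>x. b x 0) x0"

lemma b_dx0: "((\<lambda>x. b x 0) has_real_derivative b0') (at x0)"
proof -
  have "((\<lambda>x. Q 0 0 (x, 0)) has_real_derivative Q 1 0 (x0, 0)) (at x0)"
    using partial_derivative_fst[OF Q_deriv[OF zero_in, of 0 0 x0] zero_in] by simp
  then have "((\<lambda>x. b x 0) has_real_derivative Q 1 0 (x0, 0)) (at x0)"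
    by (simp add: Q_0[OF zero_in])
  then show ?thesis
    by (simp add: b0'_def DERIV_imp_deriv)
qed

lemma P_02: "P 0 2 (0, x0) = - b0' / (b x0 0)\<^sup>2"
proof -
  have "((\<lambda>x. 1 / b x 0) has_real_derivative - b0' / (b x0 0)\<^sup>2) (at x0)"
    using b_dx0 b_nonzero[OF zero_in, of x0] by (auto intro!: derivative_eq_intros simp: power2_eq_square)
  moreover have "((\<lambda>x. 1 / b x 0) has_real_derivative P 0 2 (0, x0)) (at x0)"
    using P_dx[OF zero_in, of 0 1 x0] by (simp only: P_01[OF zero_in] numeral_2_eq_2 One_nat_def)
  ultimately show ?thesis
    using DERIV_unique by blast
qed

text \<open>Ito's drift of \<phi>(t, X_t), expressed at the point \<open>x\<close> instead of at z =
  \<phi>(t, x), so that \<phi> need not be inverted.\<close>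

definition drift :: "real \<Rightarrow> real \<Rightarrow> real" where
  "drift s x = P 1 0 (s, x) + a x s * P 0 1 (s, x) + (b x s)\<^sup>2 / 2 * P 0 2 (s, x)"

text \<open>The subtracted line is the tangent at time 0 of the curve \<open>z0\<close> of the
  Lamperti transformation. First order suffices: it already removes the drift at (x0, 0), and what
  is left grows linearly.\<close>

definition coord :: "real \<Rightarrow> real \<Rightarrow> real" where
  "coord s x = sgn (b x0 0) * (\<phi> s x - \<phi> 0 x0 - drift 0 x0 * s)"

lemma drift_origin: "drift 0 x0 = P 1 0 (0, x0) + a x0 0 / b x0 0 - b0' / 2"
  using b_nonzero[OF zero_in, of x0] by (simp add: drift_def P_01[OF zero_in] P_02)

lemma P_differentiable: "P i j differentiable (at (0, x0) within time_range T \<times> UNIV)"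
  using P_deriv[OF zero_in] unfolding differentiable_def by blast

lemma drift_differentiable: "(\<lambda>z. drift (fst z) (snd z)) differentiable (at (0, x0) within time_range T \<times> UNIV)"
proof -
  let ?S = "time_range T \<times> UNIV :: (real \<times> real) set"
  \<comment> \<open>\<phi> is smooth as a function of (t, x), the coefficients as functions of (x,
    t).\<close>
  have swap: "(\<lambda>z. f (snd z, fst z)) differentiable (at (0, x0) within ?S)"
    if f: "f differentiable (at (x0, 0) within UNIV \<times> time_range T)" for f :: "real \<times> real \<Rightarrow> real"
  proof -
    from f obtain f' where f': "(f has_derivative f') (at (x0, 0) within UNIV \<times> time_range T)"
      unfolding differentiable_def by blast
    have "((\<lambda>z :: real \<times> real. (snd z, fst z)) has_derivative (\<lambda>z. (snd z, fst z))) (at (0, x0) within ?S)"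
      by (auto intro!: derivative_eq_intros)
    moreover have img: "(\<lambda>z. (snd z, fst z)) ` ?S \<subseteq> UNIV \<times> time_range T"
      by (rule image_subsetI) auto
    have "(f has_derivative f') (at (snd (0 :: real, x0), fst (0 :: real, x0)) within (\<lambda>z. (snd z, fst z)) ` ?S)"
      using has_derivative_subset[OF f' img] by simp
    ultimately have "((\<lambda>z. f (snd z, fst z)) has_derivative (\<lambda>h. f' (snd h, fst h))) (at (0, x0) within ?S)"
      by (rule has_derivative_in_compose)
    then show ?thesis
      unfolding differentiable_def by blast
  qed
  have A: "A 0 0 differentiable (at (x0, 0) within UNIV \<times> time_range T)"
    and Q: "Q 0 0 differentiable (at (x0, 0) within UNIV \<times> time_range T)"
    using A_deriv[OF zero_in, of 0 0 x0] Q_deriv[OF zero_in, of 0 0 x0] unfolding differentiable_def by blast+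
  have "(\<lambda>z. P 1 0 z + A 0 0 (snd z, fst z) * P 0 1 z + Q 0 0 (snd z, fst z) * Q 0 0 (snd z, fst z) * P 0 2 z * (1 / 2))
      differentiable (at (0, x0) within ?S)"
    by (intro differentiable_add differentiable_mult P_differentiable swap A Q differentiable_const)
  then show ?thesis
  proof (rule differentiable_transform_within[of _ _ _ 1])
    fix z :: "real \<times> real" assume "z \<in> ?S"
    then have "fst z \<in> time_range T" by auto
    then show "P 1 0 z + A 0 0 (snd z, fst z) * P 0 1 z + Q 0 0 (snd z, fst z) * Q 0 0 (snd z, fst z) * P 0 2 z * (1 / 2) = drift (fst z) (snd z)"
      by (simp add: drift_def A_0 Q_0 power2_eq_square)
  qed (use zero_in in auto)
qed

text \<open>A continuous function without zeros on the connected strip over [0, s] has constant sign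
  there. One factor \<open>sgn (b x0 0)\<close> therefore makes the coordinate increasing at all
  times.\<close>

lemma sgn_b: "s \<in> time_range T \<Longrightarrow> sgn (b x s) = sgn (b x0 0)"
proof -
  assume s: "s \<in> time_range T"
  have "connected {0..s}" by simp
  then have "connected ((UNIV :: real set) \<times> {0..s})"
    by (intro connected_Times) auto
  moreover have "continuous_on (UNIV \<times> {0..s}) (\<lambda>(x, t). b x t)"
    by (rule continuous_on_subset[OF b_continuous Sigma_mono[OF order_refl time_range_subset[OF s]]])
  ultimately have conn: "connected ((\<lambda>(x, t). b x t) ` (UNIV \<times> {0..s}))"
    by (intro connected_continuous_image)
  have s0: "0 \<le> s" using s by (simp add: time_range_def)
  have img: "b x s \<in> (\<lambda>(x, t). b x t) ` (UNIV \<times> {0..s})" "b x0 0 \<in> (\<lambda>(x, t). b x t) ` (UNIV \<times> {0..s})"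
    using imageI[of "(x, s)" "UNIV \<times> {0..s}" "\<lambda>(x, t). b x t"] imageI[of "(x0, 0)" "UNIV \<times> {0..s}" "\<lambda>(x, t). b x t"] s0
    by simp_all
  have no0: "0 \<notin> (\<lambda>(x, t). b x t) ` (UNIV \<times> {0..s})"
    using b_nonzero time_range_subset[OF s] by auto
  have "\<not> (b x s < 0 \<and> 0 < b x0 0)" "\<not> (b x0 0 < 0 \<and> 0 < b x s)"
    using connectedD_interval[OF conn img(1,2), of 0] connectedD_interval[OF conn img(2,1), of 0] no0 by auto
  then show ?thesis
    using b_nonzero[OF s, of x] b_nonzero[OF zero_in, of x0] by (auto simp: sgn_if)
qed

lemma sgn_div_b: "s \<in> time_range T \<Longrightarrow> sgn (b x0 0) * (1 / b x s) = 1 / \<bar>b x s\<bar>"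
proof -
  assume s: "s \<in> time_range T"
  have "sgn (b x s) * (1 / b x s) = 1 / \<bar>b x s\<bar>"
    using b_nonzero[OF s, of x] by (simp add: sgn_if)
  then show ?thesis
    unfolding sgn_b[OF s] .
qed

lemma coord_dx: "s \<in> time_range T \<Longrightarrow> (coord s has_real_derivative 1 / \<bar>b x s\<bar>) (at x)"
  unfolding coord_def[abs_def] sgn_div_b[symmetric] by (auto intro!: derivative_eq_intros \<phi>_primitive)

lemma coord_strict_mono:
  assumes s: "s \<in> time_range T"
  shows "strict_mono (coord s)"
proof (rule strict_monoI)
  fix x y :: real assume "x < y"
  then show "coord s x < coord s y"
  proof (rule DERIV_pos_imp_increasing)
    show "\<exists>d. (coord s has_real_derivative d) (at z) \<and> 0 < d" for z
      using coord_dx[OF s, of z] b_nonzero[OF s, of z] by (intro exI[of _ "1 / \<bar>b z s\<bar>"]) simp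
  qed
qed

text \<open>In this coordinate the drift is, up to sign, the difference of \<open>drift\<close> at
  (s, x) and at (0, x0), which differentiability at that point makes linear in the displacement. As
  \<open>coord t\<close> is increasing, a bound on \<open>X t\<close> is the same event as a bound
  on its coordinate.\<close>

lemma normal_approximation:
  obtains t1 C where "0 < t1" "t1 \<in> time_range T" "0 \<le> C" "\<And>t x. 0 < t \<Longrightarrow> t \<le> t1 \<Longrightarrow>
    \<bar>prob {\<omega>\<in>space M. X t \<omega> \<le> x} - std_normal_cdf (coord t x / sqrt t)\<bar> \<le> C * t"
proof -
  define \<sigma> where "\<sigma> = sgn (b x0 0)"
  have \<sigma>: "\<sigma>\<^sup>2 = 1" "\<bar>\<sigma>\<bar> = 1"
    using b_nonzero[OF zero_in, of x0] by (auto simp: \<sigma>_def sgn_if)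
  obtain d K where d: "0 < d" "0 \<le> K" and lip:
    "\<And>s x. (s, x) \<in> time_range T \<times> UNIV \<Longrightarrow> \<bar>s - 0\<bar> + \<bar>x - x0\<bar> < d \<Longrightarrow> \<bar>drift s x - drift 0 x0\<bar> \<le> K * (\<bar>s - 0\<bar> + \<bar>x - x0\<bar>)"
    using differentiable_lipschitz_at[OF drift_differentiable] by auto
  obtain t' where t': "0 < ereal t'" "ereal t' < T"
    using ereal_dense2[OF T_pos] by blast
  \<comment> \<open>Times up to \<open>d / 3\<close> and positions within \<open>d / 3\<close> keep
    the sum of the two displacements below \<open>d\<close>, where the linear bound holds.\<close>
  define t1 where "t1 = min t' (min 1 (d / 3))"
  have t1: "0 < t1" "t1 \<le> 1" "t1 \<le> d / 3" "t1 \<le> t'"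
    using t'(1) d(1) by (auto simp: t1_def)
  have "ereal t1 \<le> ereal t'" using t1(4) by simp
  then have t1T: "t1 \<in> time_range T"
    using t1(1) le_less_trans[OF _ t'(2)] by (simp add: time_range_def)
  have cc: "continuous_on (time_range T \<times> UNIV) (\<lambda>(s, x). f s x)"
    if "continuous_on (time_range T \<times> UNIV) f'" "\<And>s x. s \<in> time_range T \<Longrightarrow> f s x = f' (s, x)" for f and f' :: "real \<times> real \<Rightarrow> real"
    using that(2) by (intro continuous_on_eq[OF that(1)]) auto
  interpret U: unit_diffusion_coordinate M F W T a b x0 X coord "\<lambda>s x. \<sigma> * (P 1 0 (s, x) - drift 0 x0)"
      "\<lambda>s x. \<sigma> * P 0 1 (s, x)" "\<lambda>s x. \<sigma> * P 0 2 (s, x)" "d / 3" K t1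
  proof
    show "continuous_on (time_range T \<times> UNIV) (\<lambda>(s, x). coord s x)"
      by (rule cc[of "\<lambda>z. \<sigma> * (P 0 0 z - \<phi> 0 x0 - drift 0 x0 * fst z)"])
        (auto intro!: continuous_intros P_continuous simp: coord_def P_0 \<sigma>_def)
    show "continuous_on (time_range T \<times> UNIV) (\<lambda>(s, x). \<sigma> * (P 1 0 (s, x) - drift 0 x0))"
      by (rule cc[of "\<lambda>z. \<sigma> * (P 1 0 z - drift 0 x0)"]) (auto intro!: continuous_intros P_continuous)
    show "continuous_on (time_range T \<times> UNIV) (\<lambda>(s, x). \<sigma> * P 0 1 (s, x))"
      by (rule cc[of "\<lambda>z. \<sigma> * P 0 1 z"]) (auto intro!: continuous_intros P_continuous)
    show "continuous_on (time_range T \<times> UNIV) (\<lambda>(s, x). \<sigma> * P 0 2 (s, x))"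
      by (rule cc[of "\<lambda>z. \<sigma> * P 0 2 z"]) (auto intro!: continuous_intros P_continuous)
  next
    fix s x assume s: "s \<in> time_range T"
    have "((\<lambda>s. \<sigma> * (P 0 0 (s, x) - \<phi> 0 x0 - drift 0 x0 * s)) has_real_derivative \<sigma> * (P 1 0 (s, x) - drift 0 x0)) (at s within time_range T)"
      using P_ds[OF s, of 0 0 x] by (auto intro!: derivative_eq_intros)
    then show "((\<lambda>s. coord s x) has_real_derivative \<sigma> * (P 1 0 (s, x) - drift 0 x0)) (at s within time_range T)"
      by (rule has_field_derivative_transform_within[where d = 1]) (use s in \<open>auto simp: coord_def P_0 \<sigma>_def\<close>)
    show "(coord s has_real_derivative \<sigma> * P 0 1 (s, x)) (at x)"
      using coord_dx[OF s, of x] by (simp only: P_01[OF s] One_nat_def \<sigma>_def sgn_div_b[OF s])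
    show "((\<lambda>x. \<sigma> * P 0 1 (s, x)) has_real_derivative \<sigma> * P 0 2 (s, x)) (at x)"
      using P_dx[OF s, of 0 1 x] by (intro DERIV_cmult) (simp add: numeral_2_eq_2)
    show "(b x s * (\<sigma> * P 0 1 (s, x)))\<^sup>2 = 1"
      using \<sigma>(1) b_nonzero[OF s, of x] P_01[OF s, of x] by (simp add: power_mult_distrib power_divide)
  next
    show "coord 0 x0 = 0" by (simp add: coord_def)
    show "0 < d / 3" "0 \<le> K" "0 < t1" "t1 \<le> 1" "t1 \<in> time_range T"
      using d t1 t1T by simp_all
  next
    fix s x assume s: "s \<in> {0..t1}" and x: "\<bar>x - x0\<bar> \<le> d / 3"
    have sT: "s \<in> time_range T" using time_range_subset[OF t1T] s by blast
    have "\<sigma> * (P 1 0 (s, x) - drift 0 x0) + a x s * (\<sigma> * P 0 1 (s, x)) + (b x s)\<^sup>2 / 2 * (\<sigma> * P 0 2 (s, x))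
      = \<sigma> * (drift s x - drift 0 x0)"
      by (simp add: drift_def algebra_simps)
    moreover have "\<bar>drift s x - drift 0 x0\<bar> \<le> K * (\<bar>s - 0\<bar> + \<bar>x - x0\<bar>)"
      using s x sT t1(3) d(1) by (intro lip) auto
    ultimately show "\<bar>\<sigma> * (P 1 0 (s, x) - drift 0 x0) + a x s * (\<sigma> * P 0 1 (s, x)) + (b x s)\<^sup>2 / 2 * (\<sigma> * P 0 2 (s, x))\<bar>
      \<le> K * (\<bar>x - x0\<bar> + s)"
      using \<sigma>(2) s by (simp add: abs_mult add.commute)
  qed
  obtain C' where C': "\<And>t k. 0 < t \<Longrightarrow> t \<le> t1 \<Longrightarrow>
    \<bar>prob {\<omega>\<in>space M. coord t (X t \<omega>) \<le> k} - std_normal_cdf (k / sqrt t)\<bar> \<le> C' * t"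
    using U.cdf_estimate by blast
  show ?thesis
  proof (rule that[of t1 "max 0 C'"])
    fix t x assume t: "0 < t" "t \<le> t1"
    then have tT: "t \<in> time_range T" using time_range_subset[OF t1T] by auto
    have "\<bar>prob {\<omega>\<in>space M. X t \<omega> \<le> x} - std_normal_cdf (coord t x / sqrt t)\<bar> \<le> C' * t"
      using C'[OF t, of "coord t x"] by (simp add: strict_mono_less_eq[OF coord_strict_mono[OF tT]])
    also have "\<dots> \<le> max 0 C' * t"
      using t by (intro mult_right_mono) auto
    finally show "\<bar>prob {\<omega>\<in>space M. X t \<omega> \<le> x} - std_normal_cdf (coord t x / sqrt t)\<bar> \<le> max 0 C' * t" .
  qed (use t1 t1T in auto)
qed

end

section \<open>Expansion of the quantiles\<close>

context lamperti_sde
begin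

text \<open>The term of order sqrt t carries the modulus of \<open>b x0 0\<close>: changing the sign
  of both \<open>b\<close> and \<open>W\<close> leaves \<open>X\<close> unchanged, while quantiles
  increase with \<alpha>. The product \<open>b x0 0 * b0'\<close> is not affected by that
  sign.\<close>

definition expansion :: "real \<Rightarrow> real \<Rightarrow> real" where
  "expansion z t = x0 + \<bar>b x0 0\<bar> * sqrt t * z + (a x0 0 - 1/2 * b x0 0 * b0' * (1 - z\<^sup>2)) * t"

lemma coord_initial_taylor:
  obtains K where "0 \<le> K" "\<And>y. \<bar>y\<bar> \<le> 1 \<Longrightarrow>
    \<bar>coord 0 (x0 + y) - (y / \<bar>b x0 0\<bar> - sgn (b x0 0) * b0' / (2 * (b x0 0)\<^sup>2) * y\<^sup>2)\<bar> \<le> K * \<bar>y\<bar> ^ 3"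
proof -
  let ?\<sigma> = "sgn (b x0 0)"
  have "continuous_on UNIV (\<lambda>x. P 0 3 (0, x))"
    by (intro continuous_on_compose2[OF P_continuous[of 0 3]] continuous_intros) (use zero_in in auto)
  then obtain K where K: "0 \<le> K" "\<And>h. \<bar>h\<bar> \<le> 1 \<Longrightarrow>
      \<bar>P 0 0 (0, x0 + h) - (P 0 0 (0, x0) + P 0 1 (0, x0) * h + P 0 2 (0, x0) / 2 * h\<^sup>2)\<bar> \<le> K * \<bar>h\<bar> ^ 3"
    using taylor_cubic_bound[of "\<lambda>x. P 0 0 (0, x)" "\<lambda>x. P 0 1 (0, x)" "\<lambda>x. P 0 2 (0, x)" "\<lambda>x. P 0 3 (0, x)" x0]
      P_dx[OF zero_in, of 0 0] P_dx[OF zero_in, of 0 1] P_dx[OF zero_in, of 0 2]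
    by (auto simp: numeral_2_eq_2 numeral_3_eq_3)
  show ?thesis
  proof (rule that[OF K(1)])
    fix y :: real assume y: "\<bar>y\<bar> \<le> 1"
    have "coord 0 (x0 + y) - (y / \<bar>b x0 0\<bar> - ?\<sigma> * b0' / (2 * (b x0 0)\<^sup>2) * y\<^sup>2)
      = ?\<sigma> * (P 0 0 (0, x0 + y) - (P 0 0 (0, x0) + P 0 1 (0, x0) * y + P 0 2 (0, x0) / 2 * y\<^sup>2))"
    proof -
      have "y / \<bar>b x0 0\<bar> = ?\<sigma> * (1 / b x0 0) * y"
        unfolding sgn_div_b[OF zero_in] by simp
      then have 1: "y / \<bar>b x0 0\<bar> = ?\<sigma> * P 0 1 (0, x0) * y"
        by (simp add: P_01[OF zero_in])
      have 2: "?\<sigma> * b0' / (2 * (b x0 0)\<^sup>2) = - (?\<sigma> * P 0 2 (0, x0) / 2)"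
        by (simp add: P_02)
      show ?thesis
        unfolding coord_def P_0[OF zero_in] 1 2 by (simp add: algebra_simps)
    qed
    moreover have "\<bar>?\<sigma>\<bar> = 1"
      using b_nonzero[OF zero_in, of x0] by (simp add: sgn_if)
    ultimately show "\<bar>coord 0 (x0 + y) - (y / \<bar>b x0 0\<bar> - ?\<sigma> * b0' / (2 * (b x0 0)\<^sup>2) * y\<^sup>2)\<bar> \<le> K * \<bar>y\<bar> ^ 3"
      using K(2)[OF y] by (simp only: abs_mult mult_1)
  qed
qed

text \<open>The time derivative of \<phi> at (0, x0) occurs both in \<phi> and in the subtracted
  drift, and cancels. Hence the arbitrary function of time in the primitive leaves no trace.\<close>

lemma coord_time_increment:
  obtains d K where "0 < d" "0 \<le> K" "\<And>t y. 0 \<le> t \<Longrightarrow> t + \<bar>y\<bar> < d \<Longrightarrow>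
    \<bar>coord t (x0 + y) - coord 0 (x0 + y) - sgn (b x0 0) * (b0' / 2 - a x0 0 / b x0 0) * t\<bar> \<le> K * (t + \<bar>y\<bar>) * t"
proof -
  let ?\<sigma> = "sgn (b x0 0)"
  have \<sigma>: "\<bar>?\<sigma>\<bar> = 1"
    using b_nonzero[OF zero_in, of x0] by (simp add: sgn_if)
  obtain d K where d: "0 < d" "0 \<le> K" and lip:
    "\<And>s x. (s, x) \<in> time_range T \<times> UNIV \<Longrightarrow> \<bar>s - 0\<bar> + \<bar>x - x0\<bar> < d \<Longrightarrow> \<bar>P 1 0 (s, x) - P 1 0 (0, x0)\<bar> \<le> K * (\<bar>s - 0\<bar> + \<bar>x - x0\<bar>)"
    using differentiable_lipschitz_at[OF P_differentiable[of 1 0]] by auto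
  obtain t' where t': "0 < ereal t'" "ereal t' < T"
    using ereal_dense2[OF T_pos] by blast
  show ?thesis
  proof (rule that[of "min d t'" K])
    show "0 < min d t'" "0 \<le> K" using d t' by simp_all
    fix t y :: real assume t: "0 \<le> t" "t + \<bar>y\<bar> < min d t'"
    show "\<bar>coord t (x0 + y) - coord 0 (x0 + y) - ?\<sigma> * (b0' / 2 - a x0 0 / b x0 0) * t\<bar> \<le> K * (t + \<bar>y\<bar>) * t"
    proof (cases "t = 0")
      case False
      then have tp: "0 < t" using t by simp
      have "ereal t < ereal t'" using t(2) abs_ge_zero[of y] by simp linarith
      then have tT: "t \<in> time_range T"
        using t(1) less_trans[OF _ t'(2)] by (simp add: time_range_def)
      have sub: "{0..t} \<subseteq> time_range T"
        by (rule time_range_subset[OF tT])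
      have "\<exists>s\<in>{0<..<t}. P 0 0 (t, x0 + y) - P 0 0 (0, x0 + y) = P 1 0 (s, x0 + y) * (t - 0)"
      proof (rule mvt_simple[OF tp, of "\<lambda>s. P 0 0 (s, x0 + y)" "\<lambda>s. (*) (P 1 0 (s, x0 + y))"])
        show "((\<lambda>s. P 0 0 (s, x0 + y)) has_derivative (*) (P 1 0 (s, x0 + y))) (at s within {0..t})" if "0 \<le> s" "s \<le> t" for s
        proof -
          have "s \<in> time_range T" using sub that by auto
          from has_field_derivative_subset[OF P_ds[OF this, of 0 0 "x0 + y"] sub] show ?thesis
            by (simp add: has_field_derivative_def)
        qed
      qed
      then obtain s where s: "0 < s" "s < t" "P 0 0 (t, x0 + y) - P 0 0 (0, x0 + y) = P 1 0 (s, x0 + y) * t"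
        by auto
      have sT: "s \<in> time_range T" using sub s by auto
      have "\<bar>P 1 0 (s, x0 + y) - P 1 0 (0, x0)\<bar> \<le> K * (\<bar>s - 0\<bar> + \<bar>x0 + y - x0\<bar>)"
        using s t sT by (intro lip) auto
      also have "\<dots> \<le> K * (t + \<bar>y\<bar>)"
        using s d(2) by (intro mult_left_mono) auto
      finally have "\<bar>P 1 0 (s, x0 + y) - P 1 0 (0, x0)\<bar> * t \<le> K * (t + \<bar>y\<bar>) * t"
        using tp by (intro mult_right_mono) auto
      moreover have "coord t (x0 + y) - coord 0 (x0 + y) - ?\<sigma> * (b0' / 2 - a x0 0 / b x0 0) * t
        = ?\<sigma> * ((P 1 0 (s, x0 + y) - P 1 0 (0, x0)) * t)"
      proof -
        have "\<phi> t (x0 + y) - \<phi> 0 (x0 + y) = P 1 0 (s, x0 + y) * t"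
          using s(3) by (simp only: P_0[OF tT] P_0[OF zero_in])
        then have eq: "\<phi> t (x0 + y) = \<phi> 0 (x0 + y) + P 1 0 (s, x0 + y) * t"
          by simp
        show ?thesis
          unfolding coord_def drift_origin eq by (simp add: algebra_simps)
      qed
      ultimately show ?thesis
        using \<sigma> tp by (simp only: abs_mult mult_1 abs_of_pos)
    qed simp
  qed
qed

text \<open>With u = sqrt t, \<open>expansion z\<close> inverts the coordinate to second order at
  the value \<open>z * u\<close>. The quadratic term of the coordinate, evaluated at a displacement
  close to \<open>\<bar>b x0 0\<bar> * z * u\<close>, produces the \<open>z\<^sup>2\<close> in the
  coefficient of t.\<close>

lemma coord_expansion:
  obtains u0 K where "0 < u0" "0 \<le> K"
    "\<And>u. 0 < u \<Longrightarrow> u \<le> u0 \<Longrightarrow> \<bar>coord (u\<^sup>2) (expansion z (u\<^sup>2)) - z * u\<bar> \<le> K * u ^ 3"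
proof -
  define b0 where "b0 = b x0 0"
  define \<sigma> where "\<sigma> = sgn b0"
  define c where "c = a x0 0 - 1/2 * b0 * b0' * (1 - z\<^sup>2)"
  have b0: "b0 \<noteq> 0" using b_nonzero[OF zero_in] by (simp add: b0_def)
  have \<sigma>: "\<bar>b0\<bar> = \<sigma> * b0" "\<sigma>\<^sup>2 = 1" "\<bar>\<sigma>\<bar> = 1" "\<sigma> \<noteq> 0"
    using b0 by (auto simp: \<sigma>_def sgn_if)
  obtain K1 where K1: "0 \<le> K1" "\<And>y. \<bar>y\<bar> \<le> 1 \<Longrightarrow>
    \<bar>coord 0 (x0 + y) - (y / \<bar>b0\<bar> - \<sigma> * b0' / (2 * b0\<^sup>2) * y\<^sup>2)\<bar> \<le> K1 * \<bar>y\<bar> ^ 3"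
    using coord_initial_taylor unfolding b0_def \<sigma>_def by blast
  obtain d K2 where K2: "0 < d" "0 \<le> K2" "\<And>t y. 0 \<le> t \<Longrightarrow> t + \<bar>y\<bar> < d \<Longrightarrow>
    \<bar>coord t (x0 + y) - coord 0 (x0 + y) - \<sigma> * (b0' / 2 - a x0 0 / b0) * t\<bar> \<le> K2 * (t + \<bar>y\<bar>) * t"
    using coord_time_increment unfolding b0_def \<sigma>_def by blast
  define L where "L = \<bar>b0\<bar> * \<bar>z\<bar> + \<bar>c\<bar>"
  define R where "R = \<bar>\<sigma> * b0' / (2 * b0\<^sup>2)\<bar> * (2 * \<bar>b0\<bar> * \<bar>z\<bar> * \<bar>c\<bar> + c\<^sup>2)"
  have L: "0 \<le> L" by (simp add: L_def)
  \<comment> \<open>The displacement \<open>y\<close> is at most \<open>L * u\<close>. The two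
    quotients keep it below 1 for the spatial expansion and keep
    \<open>u\<^sup>2 + \<bar>y\<bar>\<close> below \<open>d\<close> for the time increment.\<close>
  define u0 where "u0 = min 1 (min (1 / (L + 1)) (d / (2 * (L + 1))))"
  have u0: "0 < u0" "u0 \<le> 1" "u0 \<le> 1 / (L + 1)" "u0 \<le> d / (2 * (L + 1))"
    using L K2(1) by (auto simp: u0_def)
  show ?thesis
  proof (rule that[OF u0(1), of "K1 * L ^ 3 + K2 * (1 + L) + R"])
    show "0 \<le> K1 * L ^ 3 + K2 * (1 + L) + R"
      using K1(1) K2(2) L by (simp add: R_def)
    fix u :: real assume u: "0 < u" "u \<le> u0"
    have u1: "u \<le> 1" using u u0 by simp
    define y where "y = \<bar>b0\<bar> * u * z + c * u\<^sup>2"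
    have ex: "expansion z (u\<^sup>2) = x0 + y"
      using u by (simp add: expansion_def y_def c_def b0_def)
    have u2: "u\<^sup>2 \<le> u" "u ^ 4 \<le> u ^ 3"
      using u u1 by (simp_all add: power2_eq_square mult_left_le power_decreasing)
    have y: "\<bar>y\<bar> \<le> L * u"
    proof -
      have "\<bar>y\<bar> \<le> \<bar>b0\<bar> * \<bar>z\<bar> * u + \<bar>c\<bar> * u\<^sup>2"
        unfolding y_def using u by (intro order_trans[OF abs_triangle_ineq]) (simp add: abs_mult)
      also have "\<bar>c\<bar> * u\<^sup>2 \<le> \<bar>c\<bar> * u"
        using u2 by (intro mult_left_mono) auto
      finally show ?thesis
        by (simp add: L_def algebra_simps)
    qed
    have Lu: "(L + 1) * u \<le> 1" "(L + 1) * u \<le> d / 2"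
    proof -
      have "u \<le> 1 / (L + 1)" "u \<le> d / (2 * (L + 1))"
        by (rule order_trans[OF u(2) u0(3)] order_trans[OF u(2) u0(4)])+
      then have "u * (L + 1) \<le> 1" "u * (2 * (L + 1)) \<le> d"
        using L by (simp_all add: pos_le_divide_eq)
      then show "(L + 1) * u \<le> 1" "(L + 1) * u \<le> d / 2"
        by (simp_all add: algebra_simps)
    qed
    have y1: "\<bar>y\<bar> \<le> 1"
      using y Lu(1) u by (simp add: distrib_right)
    have yd: "u\<^sup>2 + \<bar>y\<bar> < d"
      using y Lu(2) u u2(1) K2(1) by (simp add: distrib_right)
    have E1: "\<bar>coord 0 (x0 + y) - (y / \<bar>b0\<bar> - \<sigma> * b0' / (2 * b0\<^sup>2) * y\<^sup>2)\<bar> \<le> K1 * L ^ 3 * u ^ 3"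
    proof -
      have "\<bar>y\<bar> ^ 3 \<le> (L * u) ^ 3"
        using y by (intro power_mono) auto
      then have "K1 * \<bar>y\<bar> ^ 3 \<le> K1 * (L * u) ^ 3"
        using K1(1) by (intro mult_left_mono) auto
      then show ?thesis
        using K1(2)[OF y1] by (simp add: power_mult_distrib mult.assoc)
    qed
    have E2: "\<bar>coord (u\<^sup>2) (x0 + y) - coord 0 (x0 + y) - \<sigma> * (b0' / 2 - a x0 0 / b0) * u\<^sup>2\<bar> \<le> K2 * (1 + L) * u ^ 3"
    proof -
      have "K2 * (u\<^sup>2 + \<bar>y\<bar>) * u\<^sup>2 \<le> K2 * ((1 + L) * u) * u\<^sup>2"
        using y u2(1) K2(2) by (intro mult_right_mono mult_left_mono) (auto simp: distrib_right)
      also have "\<dots> = K2 * (1 + L) * u ^ 3"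
        by (simp add: power2_eq_square power3_eq_cube)
      finally show ?thesis
        using K2(3)[OF _ yd] by simp
    qed
    have E3: "\<bar>y / \<bar>b0\<bar> - \<sigma> * b0' / (2 * b0\<^sup>2) * y\<^sup>2 + \<sigma> * (b0' / 2 - a x0 0 / b0) * u\<^sup>2 - z * u\<bar> \<le> R * u ^ 3"
    proof -
      have ysq: "y\<^sup>2 = b0\<^sup>2 * z\<^sup>2 * u\<^sup>2 + (2 * \<bar>b0\<bar> * z * c * u ^ 3 + c\<^sup>2 * u ^ 4)"
        by (simp add: y_def power2_eq_square power3_eq_cube power4_eq_xxxx algebra_simps)
      have "y / \<bar>b0\<bar> = z * u + \<sigma> * c / b0 * u\<^sup>2"
        unfolding y_def \<sigma>(1) using b0 \<sigma>(4) \<sigma>(2) by (simp add: field_simps power2_eq_square)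
      moreover have "\<sigma> * b0' / (2 * b0\<^sup>2) * (b0\<^sup>2 * z\<^sup>2 * u\<^sup>2) = \<sigma> * (b0' / 2) * z\<^sup>2 * u\<^sup>2"
        using b0 by simp
      \<comment> \<open>This cancellation of all terms of second order determines the coefficient
        \<open>c\<close> of t in the expansion.\<close>
      moreover have "\<sigma> * c / b0 * u\<^sup>2 - \<sigma> * (b0' / 2) * z\<^sup>2 * u\<^sup>2 + \<sigma> * (b0' / 2 - a x0 0 / b0) * u\<^sup>2 = 0"
        unfolding c_def using b0 by (simp add: field_simps)
      ultimately have "y / \<bar>b0\<bar> - \<sigma> * b0' / (2 * b0\<^sup>2) * y\<^sup>2 + \<sigma> * (b0' / 2 - a x0 0 / b0) * u\<^sup>2 - z * u
        = - (\<sigma> * b0' / (2 * b0\<^sup>2)) * (2 * \<bar>b0\<bar> * z * c * u ^ 3 + c\<^sup>2 * u ^ 4)"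
        unfolding ysq distrib_left by linarith
      moreover have "\<bar>2 * \<bar>b0\<bar> * z * c * u ^ 3 + c\<^sup>2 * u ^ 4\<bar> \<le> (2 * \<bar>b0\<bar> * \<bar>z\<bar> * \<bar>c\<bar> + c\<^sup>2) * u ^ 3"
      proof -
        have "\<bar>2 * \<bar>b0\<bar> * z * c * u ^ 3\<bar> = 2 * \<bar>b0\<bar> * \<bar>z\<bar> * \<bar>c\<bar> * u ^ 3" "\<bar>c\<^sup>2 * u ^ 4\<bar> = c\<^sup>2 * u ^ 4"
          using u by (simp_all add: abs_mult)
        moreover have "c\<^sup>2 * u ^ 4 \<le> c\<^sup>2 * u ^ 3"
          using u2(2) by (intro mult_left_mono) auto
        ultimately show ?thesis
          using abs_triangle_ineq[of "2 * \<bar>b0\<bar> * z * c * u ^ 3" "c\<^sup>2 * u ^ 4"] by (simp add: distrib_right)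
      qed
      ultimately show ?thesis
        unfolding R_def by (simp only: abs_mult abs_minus_cancel mult.assoc) (rule mult_left_mono, auto simp: mult_ac)
    qed
    have "\<bar>coord (u\<^sup>2) (x0 + y) - z * u\<bar> \<le> K1 * L ^ 3 * u ^ 3 + K2 * (1 + L) * u ^ 3 + R * u ^ 3"
      using E1 E2 E3 by linarith
    then show "\<bar>coord (u\<^sup>2) (expansion z (u\<^sup>2)) - z * u\<bar> \<le> (K1 * L ^ 3 + K2 * (1 + L) + R) * u ^ 3"
      unfolding ex by (simp add: distrib_right)
  qed
qed

text \<open>The derivative of the coordinate is the reciprocal of \<open>\<bar>b\<bar>\<close>, and
  \<open>b\<close> is bounded on a compact box. The bound turns an error in the coordinate into one
  in space.\<close>

lemma coord_growth:
  assumes t1: "t1 \<in> time_range T"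
  obtains m where "0 < m" "\<And>t x y. t \<in> {0..t1} \<Longrightarrow> x0 - 1 \<le> x \<Longrightarrow> x \<le> y \<Longrightarrow> y \<le> x0 + 1 \<Longrightarrow> m * (y - x) \<le> coord t y - coord t x"
proof -
  let ?Q = "{x0 - 1..x0 + 1} \<times> {0..t1}"
  have "continuous_on ?Q (\<lambda>(x, t). b x t)"
    by (rule continuous_on_subset[OF b_continuous Sigma_mono[OF subset_UNIV time_range_subset[OF t1]]])
  then have "compact ((\<lambda>(x, t). b x t) ` ?Q)"
    by (rule compact_continuous_image) (intro compact_Times, auto)
  then obtain B where B: "\<forall>y\<in>(\<lambda>(x, t). b x t) ` ?Q. norm y \<le> B"
    by (rule compact_imp_bounded[THEN bounded_iff[THEN iffD1], THEN exE])
  define m where "m = 1 / max 1 B"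
  show ?thesis
  proof (rule that[of m])
    show "0 < m" by (simp add: m_def)
    fix t x y :: real assume *: "t \<in> {0..t1}" "x0 - 1 \<le> x" "x \<le> y" "y \<le> x0 + 1"
    have tT: "t \<in> time_range T" using time_range_subset[OF t1] *(1) by blast
    show "m * (y - x) \<le> coord t y - coord t x"
    proof (cases "x = y")
      case False
      then have "x < y" using * by simp
      then obtain w where w: "x < w" "w < y" "coord t y - coord t x = (y - x) * (1 / \<bar>b w t\<bar>)"
        using MVT2[of x y "coord t" "\<lambda>x. 1 / \<bar>b x t\<bar>"] coord_dx[OF tT] by blast
      have "(w, t) \<in> ?Q" using w * by auto
      then have "\<bar>b w t\<bar> \<le> B"
        using B[rule_format, OF imageI] by fastforce
      then have "m \<le> 1 / \<bar>b w t\<bar>"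
        unfolding m_def using b_nonzero[OF tT, of w] by (intro divide_left_mono) auto
      then have "(y - x) * m \<le> (y - x) * (1 / \<bar>b w t\<bar>)"
        using *(3) by (intro mult_left_mono) auto
      then show ?thesis
        using w(3) by (simp add: mult.commute)
    qed simp
  qed
qed

text \<open>Moving the candidate by \<open>K * u ^ 3\<close> to either side changes its coordinate
  by enough to outweigh the expansion error and, after division by sqrt t, still changes the normal
  probability by more than the approximation error. The quantile is thus caught between the two
  shifted points.\<close>

lemma quantile_expansion:
  assumes \<alpha>: "0 < \<alpha>" "\<alpha> < 1"
  obtains u0 K where "0 < u0" "0 \<le> K"
    "\<And>u. 0 < u \<Longrightarrow> u \<le> u0 \<Longrightarrow> \<bar>quantile M (X (u\<^sup>2)) \<alpha> - expansion (inv std_normal_cdf \<alpha>) (u\<^sup>2)\<bar> \<le> K * u ^ 3"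
proof -
  define z where "z = inv std_normal_cdf \<alpha>"
  have z: "std_normal_cdf z = \<alpha>"
    unfolding z_def by (rule std_normal_cdf_inverse[OF \<alpha>])
  obtain t1 C where t1: "0 < t1" "t1 \<in> time_range T" and C: "0 \<le> C" and approx: "\<And>t x. 0 < t \<Longrightarrow> t \<le> t1 \<Longrightarrow>
    \<bar>prob {\<omega>\<in>space M. X t \<omega> \<le> x} - std_normal_cdf (coord t x / sqrt t)\<bar> \<le> C * t"
    using normal_approximation by blast
  obtain u1 K1 where u1: "0 < u1" and K1: "0 \<le> K1"
    and coord: "\<And>u. 0 < u \<Longrightarrow> u \<le> u1 \<Longrightarrow> \<bar>coord (u\<^sup>2) (expansion z (u\<^sup>2)) - z * u\<bar> \<le> K1 * u ^ 3"
    using coord_expansion by blast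
  obtain m where m: "0 < m" and growth:
    "\<And>t x y. t \<in> {0..t1} \<Longrightarrow> x0 - 1 \<le> x \<Longrightarrow> x \<le> y \<Longrightarrow> y \<le> x0 + 1 \<Longrightarrow> m * (y - x) \<le> coord t y - coord t x"
    using coord_growth[OF t1(2)] by blast
  obtain \<mu> where \<mu>: "0 < \<mu>" and \<Phi>: "\<And>h. 0 \<le> h \<Longrightarrow> h \<le> 1 \<Longrightarrow> std_normal_cdf z + \<mu> * h \<le> std_normal_cdf (z + h)"
    "\<And>h. 0 \<le> h \<Longrightarrow> h \<le> 1 \<Longrightarrow> std_normal_cdf (z - h) \<le> std_normal_cdf z - \<mu> * h"
    using std_normal_cdf_growth by blast
  \<comment> \<open>A shift of the normal argument by \<open>H * t\<close> changes the probability
    by at least \<open>(C + 1) * t\<close>. Exceeding \<open>C * t\<close> gives the strict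
    inequality that the lower side requires; \<open>K\<close> is chosen so that the coordinate moves
    by \<open>K1 * u ^ 3\<close> plus \<open>H * u ^ 3\<close>.\<close>
  define H where "H = (C + 1) / \<mu>"
  define K where "K = (K1 + H) / m"
  have H: "0 \<le> H" "\<mu> * H = C + 1" and K: "0 \<le> K" "m * K = K1 + H"
    using C \<mu> K1 m by (simp_all add: H_def K_def)
  define c where "c = a x0 0 - 1/2 * b x0 0 * b0' * (1 - z\<^sup>2)"
  define L where "L = \<bar>b x0 0\<bar> * \<bar>z\<bar> + \<bar>c\<bar> + K"
  have L: "0 \<le> L" using K(1) by (simp add: L_def)
  \<comment> \<open>The bound with \<open>L\<close> keeps both shifted points within distance 1 of
    \<open>x0\<close>, where \<open>coord_growth\<close> applies, the one with \<open>H\<close>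
    keeps \<open>H * u\<^sup>2\<close> at most 1 for \<open>std_normal_cdf_growth\<close>, and
    \<open>sqrt t1\<close> gives \<open>u\<^sup>2 \<le> t1\<close>.\<close>
  define u0 where "u0 = min (min 1 u1) (min (sqrt t1) (min (1 / (L + 1)) (1 / (H + 1))))"
  have u0: "0 < u0" "u0 \<le> 1" "u0 \<le> u1" "u0 \<le> sqrt t1" "u0 \<le> 1 / (L + 1)" "u0 \<le> 1 / (H + 1)"
    using u1 t1 L H(1) by (auto simp: u0_def)
  show ?thesis
  proof (rule that[OF u0(1) K(1)])
    fix u :: real assume u: "0 < u" "u \<le> u0"
    define t where "t = u\<^sup>2"
    define \<beta> where "\<beta> = expansion z t"
    have "t \<le> (sqrt t1)\<^sup>2"
      unfolding t_def using u u0(4) by (intro power_mono) auto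
    then have t: "0 < t" "t \<le> t1" "sqrt t = u"
      using u t1(1) by (simp_all add: t_def)
    have tT: "t \<in> time_range T" using time_range_subset[OF t1(2)] t by auto
    have u1': "u \<le> 1" "u\<^sup>2 \<le> u" "u ^ 3 \<le> u" "u ^ 3 = u\<^sup>2 * u"
      using u u0(2) by (auto simp: power2_eq_square power3_eq_cube mult_left_le intro: mult_le_one)
    have "u \<le> 1 / (L + 1)" "u \<le> 1 / (H + 1)"
      by (rule order_trans[OF u(2) u0(5)] order_trans[OF u(2) u0(6)])+
    then have "u * (L + 1) \<le> 1" "u * (H + 1) \<le> 1"
      using L H(1) by (simp_all add: pos_le_divide_eq)
    then have Lu: "(L + 1) * u \<le> 1" "(H + 1) * u \<le> 1"
      by (simp_all add: mult.commute)
    have Hu: "0 \<le> H * u\<^sup>2" "H * u\<^sup>2 \<le> 1"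
    proof -
      show "0 \<le> H * u\<^sup>2" using H by simp
      have "H * u\<^sup>2 \<le> H * u"
        using u1'(2) H(1) by (rule mult_left_mono)
      then show "H * u\<^sup>2 \<le> 1"
        using Lu(2) u(1) by (simp add: distrib_right)
    qed
    have near: "\<bar>\<beta> - x0\<bar> + K * u ^ 3 \<le> 1"
    proof -
      have "\<bar>\<beta> - x0\<bar> \<le> \<bar>b x0 0\<bar> * u * \<bar>z\<bar> + \<bar>c\<bar> * u\<^sup>2"
        unfolding \<beta>_def expansion_def t(3) c_def[symmetric] using t(1) u(1)
        by (simp add: add.assoc t_def) (intro order_trans[OF abs_triangle_ineq], simp add: abs_mult)
      also have "\<dots> \<le> \<bar>b x0 0\<bar> * \<bar>z\<bar> * u + \<bar>c\<bar> * u"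
        using mult_left_mono[OF u1'(2), of "\<bar>c\<bar>"] by (simp add: mult_ac)
      finally have "\<bar>\<beta> - x0\<bar> + K * u ^ 3 \<le> L * u"
        using mult_left_mono[OF u1'(3) K(1)] by (simp add: L_def distrib_right)
      then show ?thesis
        using Lu(1) u(1) by (simp add: distrib_right)
    qed
    have ku: "0 \<le> K * u ^ 3"
      using K u by simp
    have cb: "\<bar>coord t \<beta> - z * u\<bar> \<le> K1 * u ^ 3"
      using coord[of u] u u0(3) by (simp add: \<beta>_def t_def)
    have mK: "m * (K * u ^ 3) = K1 * u ^ 3 + H * u\<^sup>2 * u"
      using K(2) u1'(4) by (simp add: mult.assoc[symmetric] distrib_right)
    have up: "\<alpha> \<le> prob {\<omega>\<in>space M. X t \<omega> \<le> \<beta> + K * u ^ 3}"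
    proof -
      have "m * (\<beta> + K * u ^ 3 - \<beta>) \<le> coord t (\<beta> + K * u ^ 3) - coord t \<beta>"
        using near ku t by (intro growth) auto
      then have "(z + H * u\<^sup>2) * u \<le> coord t (\<beta> + K * u ^ 3)"
        using cb mK by (simp add: distrib_right)
      then have "z + H * u\<^sup>2 \<le> coord t (\<beta> + K * u ^ 3) / u"
        using u(1) by (simp add: pos_le_divide_eq)
      then have "std_normal_cdf (z + H * u\<^sup>2) \<le> std_normal_cdf (coord t (\<beta> + K * u ^ 3) / sqrt t)"
        by (simp add: t(3) strict_mono_less_eq[OF std_normal_cdf_strict_mono])
      moreover have "\<alpha> + (C + 1) * t \<le> std_normal_cdf (z + H * u\<^sup>2)"
        using \<Phi>(1)[OF Hu] H(2) by (simp add: z t_def mult.assoc[symmetric])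
      ultimately show ?thesis
        using approx[OF t(1,2), of "\<beta> + K * u ^ 3"] t(1) by (simp add: distrib_right)
    qed
    have low: "prob {\<omega>\<in>space M. X t \<omega> \<le> \<beta> - K * u ^ 3} < \<alpha>"
    proof -
      have "m * (\<beta> - (\<beta> - K * u ^ 3)) \<le> coord t \<beta> - coord t (\<beta> - K * u ^ 3)"
        using near ku t by (intro growth) auto
      then have "coord t (\<beta> - K * u ^ 3) \<le> (z - H * u\<^sup>2) * u"
        using cb mK by (simp add: left_diff_distrib)
      then have "coord t (\<beta> - K * u ^ 3) / u \<le> z - H * u\<^sup>2"
        using u(1) by (simp add: pos_divide_le_eq)
      then have "std_normal_cdf (coord t (\<beta> - K * u ^ 3) / sqrt t) \<le> std_normal_cdf (z - H * u\<^sup>2)"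
        by (simp add: t(3) strict_mono_less_eq[OF std_normal_cdf_strict_mono])
      moreover have "std_normal_cdf (z - H * u\<^sup>2) \<le> \<alpha> - (C + 1) * t"
        using \<Phi>(2)[OF Hu] H(2) by (simp add: z t_def mult.assoc[symmetric])
      ultimately show ?thesis
        using approx[OF t(1,2), of "\<beta> - K * u ^ 3"] t(1) by (simp add: distrib_right)
    qed
    show "\<bar>quantile M (X (u\<^sup>2)) \<alpha> - expansion (inv std_normal_cdf \<alpha>) (u\<^sup>2)\<bar> \<le> K * u ^ 3"
      using quantile_between[OF X_measurable[OF tT] low up] unfolding z_def[symmetric] t_def[symmetric] \<beta>_def
      by (simp add: abs_le_iff)
  qed
qed

end

section \<open>Order estimates and conclusion\<close>

lemma bigo_three_halves:
  fixes f :: "real \<Rightarrow> real"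
  assumes "0 < u0" "\<And>u. 0 < u \<Longrightarrow> u \<le> u0 \<Longrightarrow> \<bar>f (u\<^sup>2)\<bar> \<le> K * u ^ 3"
  shows "f \<in> O[at_right 0](\<lambda>t. t powr (3/2))"
proof (rule bigoI)
  have "\<forall>\<^sub>F t in at_right (0 :: real). t < u0\<^sup>2"
    using assms(1) by (intro order_tendstoD(2)[OF tendsto_ident_at]) simp
  then show "\<forall>\<^sub>F t in at_right 0. norm (f t) \<le> K * norm (t powr (3/2))"
    using eventually_at_right_less[of "0 :: real"]
  proof eventually_elim
    case (elim t)
    have "sqrt t \<le> sqrt (u0\<^sup>2)"
      using elim by (intro real_sqrt_le_mono) simp
    then have "\<bar>f ((sqrt t)\<^sup>2)\<bar> \<le> K * sqrt t ^ 3"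
      using elim assms(1) by (intro assms(2)) auto
    moreover have "t powr (3/2) = sqrt t ^ 3"
      using elim powr_half_sqrt_powr[of t 3] by (simp add: powr_realpow real_sqrt_power)
    ultimately show ?case
      using elim by simp
  qed
qed

lemma smooth_curve_expansion:
  assumes "smooth_curve \<gamma>"
  obtains K where "0 \<le> K" "\<And>v. \<bar>v\<bar> \<le> 1 \<Longrightarrow> \<bar>\<gamma> v - (\<gamma> 0 + deriv \<gamma> 0 * v + 1/2 * deriv (deriv \<gamma>) 0 * v\<^sup>2)\<bar> \<le> K * \<bar>v\<bar> ^ 3"
proof -
  have d: "((deriv ^^ n) \<gamma> has_real_derivative (deriv ^^ Suc n) \<gamma> s) (at s)" for n s
    using assms unfolding smooth_curve_def by (simp add: DERIV_deriv_iff_field_differentiable)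
  have "continuous_on UNIV ((deriv ^^ 3) \<gamma>)"
    using d by (intro continuous_at_imp_continuous_on ballI DERIV_isCont) blast
  then obtain K where "0 \<le> K" "\<And>h. \<bar>h\<bar> \<le> 1 \<Longrightarrow>
      \<bar>\<gamma> (0 + h) - (\<gamma> 0 + deriv \<gamma> 0 * h + deriv (deriv \<gamma>) 0 / 2 * h\<^sup>2)\<bar> \<le> K * \<bar>h\<bar> ^ 3"
    using taylor_cubic_bound[of \<gamma> "deriv \<gamma>" "deriv (deriv \<gamma>)" "(deriv ^^ 3) \<gamma>" 0] d[of 0] d[of 1] d[of 2]
    by (auto simp: numeral_2_eq_2 numeral_3_eq_3)
  then show ?thesis
    by (intro that[of K]) auto
qed

lemma smooth_onE:
  assumes "smooth_on S f"
  obtains D where "\<And>z. z \<in> S \<Longrightarrow> D 0 0 z = f z"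
    "\<And>i j z. z \<in> S \<Longrightarrow> (D i j has_derivative (\<lambda>h. D (Suc i) j z * fst h + D i (Suc j) z * snd h)) (at z within S)"
  using assms unfolding smooth_on_def by blast

lemma smooth_on_continuous:
  assumes "smooth_on S f"
  shows "continuous_on S f"
proof -
  obtain D where D: "\<And>z. z \<in> S \<Longrightarrow> D 0 0 z = f z"
    "\<And>i j z. z \<in> S \<Longrightarrow> (D i j has_derivative (\<lambda>h. D (Suc i) j z * fst h + D i (Suc j) z * snd h)) (at z within S)"
    using smooth_onE[OF assms] by blast
  have "continuous_on S (D 0 0)"
    using D(2) by (rule has_derivative_continuous_on)
  then show ?thesis
    by (rule continuous_on_eq) (rule D(1))
qed

theorem theorem3:
  fixes M :: "'a measure" and F :: "real \<Rightarrow> 'a measure"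
    and W X :: "real \<Rightarrow> 'a \<Rightarrow> real"
    and T :: ereal and a b :: "real \<Rightarrow> real \<Rightarrow> real" and x0 :: real
    and \<phi> :: "real \<Rightarrow> real \<Rightarrow> real" and z0 :: "real \<Rightarrow> real"
  defines "a0 \<equiv> a x0 0" and "b0 \<equiv> b x0 0" and "b0' \<equiv> deriv (\<lambda>x. b x 0) x0"
  assumes "brownian_motion M F W"
    and "0 < T"
    and "smooth_on (UNIV \<times> time_range T) (\<lambda>(x, t). a x t)"
    and "smooth_on (UNIV \<times> time_range T) (\<lambda>(x, t). b x t)"
    and "\<forall>x. \<forall>t\<in>time_range T. b x t \<noteq> 0"
    and "sde_solution M F W T (UNIV \<times> time_range T) a b x0 X"
    and "lamperti_transform T a b x0 \<phi> z0"
    and "sde_well_posed M F W T (transformed_domain T \<phi> z0)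
           (transformed_drift T a b \<phi> z0) (\<lambda>y t. 1) 0"
    and "fokker_planck_well_posed T (transformed_domain T \<phi> z0) (transformed_drift T a b \<phi> z0)"
  shows "(\<forall>\<alpha>. 0 < \<alpha> \<and> \<alpha> < 1 \<longrightarrow>
           (\<lambda>t. quantile M (X t) \<alpha> -
              (x0 + \<bar>b0\<bar> * sqrt t * inv std_normal_cdf \<alpha>
               + (a0 - 1/2 * b0 * b0' * (1 - (inv std_normal_cdf \<alpha>)\<^sup>2)) * t))
             \<in> O[at_right 0](\<lambda>t. t powr (3/2)))
       \<and> (\<lambda>t. median M (X t) - (x0 + stratonovich_drift a b x0 0 * t))
             \<in> O[at_right 0](\<lambda>t. t powr (3/2))
       \<and> (\<forall>\<gamma>. ito_jet_representative a b x0 \<gamma> \<longrightarrow>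
           (\<lambda>t. quantile M (X t) (std_normal_cdf 1) - \<gamma> (sgn b0 * sqrt t))
             \<in> O[at_right 0](\<lambda>t. t powr (3/2)) \<and>
           (\<lambda>t. quantile M (X t) (std_normal_cdf (- 1)) - \<gamma> (- (sgn b0) * sqrt t))
             \<in> O[at_right 0](\<lambda>t. t powr (3/2)))"
proof -
  let ?S = "time_range T \<times> (UNIV :: real set)" and ?R = "(UNIV :: real set) \<times> time_range T"
  note bm = \<open>brownian_motion M F W\<close> and T = \<open>0 < T\<close>
    and a_smooth = \<open>smooth_on ?R (\<lambda>(x, t). a x t)\<close> and b_smooth = \<open>smooth_on ?R (\<lambda>(x, t). b x t)\<close>
    and b_nz = \<open>\<forall>x. \<forall>t\<in>time_range T. b x t \<noteq> 0\<close> and sol = \<open>sde_solution M F W T ?R a b x0 X\<close>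
    and lamp = \<open>lamperti_transform T a b x0 \<phi> z0\<close>
  have \<phi>_smooth: "smooth_on ?S (\<lambda>(t, x). \<phi> t x)"
    and \<phi>_prim: "\<And>t x. t \<in> time_range T \<Longrightarrow> (\<phi> t has_real_derivative 1 / b x t) (at x)"
    using lamp unfolding lamperti_transform_def by blast+
  obtain P where P: "\<And>z. z \<in> ?S \<Longrightarrow> P 0 0 z = (case z of (t, x) \<Rightarrow> \<phi> t x)"
    "\<And>i j z. z \<in> ?S \<Longrightarrow> (P i j has_derivative (\<lambda>h. P (Suc i) j z * fst h + P i (Suc j) z * snd h)) (at z within ?S)"
    using smooth_onE[OF \<phi>_smooth] by blast
  obtain A where A: "\<And>z. z \<in> ?R \<Longrightarrow> A 0 0 z = (case z of (x, t) \<Rightarrow> a x t)"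
    "\<And>i j z. z \<in> ?R \<Longrightarrow> (A i j has_derivative (\<lambda>h. A (Suc i) j z * fst h + A i (Suc j) z * snd h)) (at z within ?R)"
    using smooth_onE[OF a_smooth] by blast
  obtain Q where Q: "\<And>z. z \<in> ?R \<Longrightarrow> Q 0 0 z = (case z of (x, t) \<Rightarrow> b x t)"
    "\<And>i j z. z \<in> ?R \<Longrightarrow> (Q i j has_derivative (\<lambda>h. Q (Suc i) j z * fst h + Q i (Suc j) z * snd h)) (at z within ?R)"
    using smooth_onE[OF b_smooth] by blast
  interpret L: lamperti_sde M F W T a b x0 X \<phi> P A Q
  proof
    show "brownian_motion M F W" "0 < T" "sde_solution M F W T ?R a b x0 X"
      by (rule bm T sol)+
    show "continuous_on ?R (\<lambda>(x, t). a x t)" "continuous_on ?R (\<lambda>(x, t). b x t)"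
      by (rule smooth_on_continuous[OF a_smooth] smooth_on_continuous[OF b_smooth])+
  next
    fix s x assume s: "s \<in> time_range T"
    have z: "(s, x) \<in> ?S" "(x, s) \<in> ?R" using s by simp_all
    show "P 0 0 (s, x) = \<phi> s x" "A 0 0 (x, s) = a x s" "Q 0 0 (x, s) = b x s"
      using P(1)[OF z(1)] A(1)[OF z(2)] Q(1)[OF z(2)] by simp_all
    show "b x s \<noteq> 0" using b_nz s by blast
    show "(\<phi> s has_real_derivative 1 / b x s) (at x)" by (rule \<phi>_prim[OF s])
    fix i j
    show "(P i j has_derivative (\<lambda>h. P (Suc i) j (s, x) * fst h + P i (Suc j) (s, x) * snd h)) (at (s, x) within ?S)"
      by (rule P(2)[OF z(1)])
    show "(A i j has_derivative (\<lambda>h. A (Suc i) j (x, s) * fst h + A i (Suc j) (x, s) * snd h)) (at (x, s) within ?R)"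
      by (rule A(2)[OF z(2)])
    show "(Q i j has_derivative (\<lambda>h. Q (Suc i) j (x, s) * fst h + Q i (Suc j) (x, s) * snd h)) (at (x, s) within ?R)"
      by (rule Q(2)[OF z(2)])
  qed
  have b0': "L.b0' = b0'"
    by (simp add: L.b0'_def b0'_def)
  have expansion: "L.expansion z t = x0 + \<bar>b0\<bar> * sqrt t * z + (a0 - 1/2 * b0 * b0' * (1 - z\<^sup>2)) * t" for z t
    unfolding L.expansion_def b0' a0_def b0_def ..
  have quantile: "(\<lambda>t. quantile M (X t) \<alpha> - L.expansion (inv std_normal_cdf \<alpha>) t) \<in> O[at_right 0](\<lambda>t. t powr (3/2))"
    if \<alpha>: "0 < \<alpha>" "\<alpha> < 1" for \<alpha>
  proof -
    obtain u0 K where "0 < u0" "0 \<le> K"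
      "\<And>u. 0 < u \<Longrightarrow> u \<le> u0 \<Longrightarrow> \<bar>quantile M (X (u\<^sup>2)) \<alpha> - L.expansion (inv std_normal_cdf \<alpha>) (u\<^sup>2)\<bar> \<le> K * u ^ 3"
      using L.quantile_expansion[OF \<alpha>] by blast
    then show ?thesis
      by (intro bigo_three_halves[of u0 _ K])
  qed
  have inv_half: "inv std_normal_cdf (1 / 2) = 0"
    using std_normal_cdf_inv[of 0] by (simp add: std_normal_cdf_0)
  \<comment> \<open>At the normal quantile 0 the sqrt t term disappears and the coefficient of t is
    the Ito drift minus half of \<open>b0 * b0'\<close>, the Stratonovich drift.\<close>
  have median: "(\<lambda>t. median M (X t) - (x0 + stratonovich_drift a b x0 0 * t)) \<in> O[at_right 0](\<lambda>t. t powr (3/2))"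
    using quantile[of "1 / 2"]
    by (simp add: median_def inv_half expansion stratonovich_drift_def a0_def b0_def b0'_def)
  have \<Phi>_range: "0 < std_normal_cdf z" "std_normal_cdf z < 1" for z
    using strict_monoD[OF std_normal_cdf_strict_mono, of "z - 1" z] strict_monoD[OF std_normal_cdf_strict_mono, of z "z + 1"]
      std_normal_cdf_bounds(1)[of "z - 1"] std_normal_cdf_bounds(2)[of "z + 1"] by simp_all
  have curve: "(\<lambda>t. quantile M (X t) (std_normal_cdf z) - \<gamma> (z * sgn b0 * sqrt t)) \<in> O[at_right 0](\<lambda>t. t powr (3/2))"
    if \<gamma>: "ito_jet_representative a b x0 \<gamma>" and z: "\<bar>z\<bar> = 1" for \<gamma> z
  proof -
    have \<gamma>': "smooth_curve \<gamma>" "\<gamma> 0 = x0" "deriv \<gamma> 0 = b0" "1/2 * deriv (deriv \<gamma>) 0 = a0"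
      using \<gamma> by (simp_all add: ito_jet_representative_def a0_def b0_def)
    obtain K where K: "0 \<le> K" "\<And>v. \<bar>v\<bar> \<le> 1 \<Longrightarrow> \<bar>\<gamma> v - (x0 + b0 * v + a0 * v\<^sup>2)\<bar> \<le> K * \<bar>v\<bar> ^ 3"
      using smooth_curve_expansion[OF \<gamma>'(1)] unfolding \<gamma>'(2-4) by blast
    have "b0 \<noteq> 0"
      using L.b_nonzero[OF L.zero_in] by (simp add: b0_def)
    then have v: "\<bar>z * sgn b0\<bar> = 1" "(z * sgn b0)\<^sup>2 = 1" "b0 * (z * sgn b0) = \<bar>b0\<bar> * z" "z\<^sup>2 = 1"
      using z by (auto simp: abs_mult sgn_if power2_eq_square abs_if split: if_splits)
    have e: "(\<lambda>t. L.expansion z t - \<gamma> (z * sgn b0 * sqrt t)) \<in> O[at_right 0](\<lambda>t. t powr (3/2))"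
    proof (rule bigo_three_halves[of 1 _ K])
      fix u :: real assume u: "0 < u" "u \<le> 1"
      have "b0 * (w * u) = \<bar>b0\<bar> * u * z \<and> (w * u)\<^sup>2 = u\<^sup>2" if "w\<^sup>2 = 1" "b0 * w = \<bar>b0\<bar> * z" for w
        using that by (simp add: power_mult_distrib mult.assoc[symmetric])
      note w = this[OF v(2,3), THEN conjunct1] this[OF v(2,3), THEN conjunct2]
      \<comment> \<open>Since \<open>z\<^sup>2 = 1\<close>, the term with \<open>b0'\<close> drops
        out and the expansion is the 2-jet of the curve. The factor \<open>sgn b0\<close> in the
        parameter orients the curve so that its linear term becomes
        \<open>\<bar>b0\<bar> * z * u\<close>.\<close>
      have "L.expansion z (u\<^sup>2) = x0 + b0 * (z * sgn b0 * u) + a0 * (z * sgn b0 * u)\<^sup>2"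
        unfolding expansion v(4) w using u by simp
      moreover have "\<bar>z * sgn b0 * u\<bar> = u"
        unfolding abs_mult[of _ u] v(1) using u by simp
      ultimately show "\<bar>L.expansion z (u\<^sup>2) - \<gamma> (z * sgn b0 * sqrt (u\<^sup>2))\<bar> \<le> K * u ^ 3"
        using K(2)[of "z * sgn b0 * u"] u by (simp add: abs_minus_commute)
    qed simp
    have q: "(\<lambda>t. quantile M (X t) (std_normal_cdf z) - L.expansion z t) \<in> O[at_right 0](\<lambda>t. t powr (3/2))"
      using quantile[OF \<Phi>_range, of z] by simp
    have "(\<lambda>t. (quantile M (X t) (std_normal_cdf z) - L.expansion z t) + (L.expansion z t - \<gamma> (z * sgn b0 * sqrt t)))
        \<in> O[at_right 0](\<lambda>t. t powr (3/2))"
      by (rule sum_in_bigo(1)[OF q e])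
    then show ?thesis by simp
  qed
  show ?thesis
    using quantile median curve[of _ 1] curve[of _ "- 1"] by (simp add: expansion)
qed

end
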